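(* Let $p$ be an odd prime and let $G$ be a group of order $p^5$ in the isoclinism family $\Phi_9$. Let $m$ and $m'$ denote the exponents of $C_G(G')$ and $C_G(G')/G'$, respectively. Then the Wedderburn decomposition of $\mathbb{Q}G$ is $$\mathbb{Q}G\cong\mathbb{Q}(G/G')\ \oplus\bigoplus_{d\mid m,\ d\nmid m'}\frac{a_d}{p}M_p(\mathbb{Q}(\zeta_d))\ \oplus\bigoplus_{d\mid m,\ d\mid m'}\frac{a_d-a_d'}{p}M_p(\mathbb{Q}(\zeta_d)),$$ where $a_d$ and $a_d'$ are the number of cyclic subgroups of order $d$ of $C_G(G')$ and of $C_G(G')/G'$, respectively.
   Context: $\zeta_d$ is a primitive $d$-th root of unity; $M_n(D)$ is the ring of $n\times n$ matrices over $D$; $aR$ denotes the direct sum of $a$ copies of the algebra $R$; $C_G(G')$ is the centralizer of $G'$ in $G$ (an abelian subgroup of index $p$ here); $d$ ranges over positive divisors. Two groups $G,H$ are isoclinic if there are isomorphisms $G/Z(G)\to H/Z(H)$ and $G'\to H'$ compatible with the commutator maps. $\Phi_9$ (R. James) is the isoclinism family of the order-$p^5$ group $\Phi_9(1^5)=\langle\alpha,\alpha_1,\dots,\alpha_4:[\alpha_i,\alpha]=\alpha_{i+1}\ (i=1,2,3),\ \alpha^p=\alpha_j^{(p)}=1\ (j=1,2,3,4)\rangle$, with $[x,y]=x^{-1}y^{-1}xy$, unlisted commutators of generators trivial, and $\alpha_j^{(p)}=\alpha_j^{p}\alpha_{j+1}^{\binom p2}\cdots\alpha_{j+k-1}^{\binom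 pk}\cdots\alpha_{j+p-1}$ where $\alpha_l=1$ for $l>4$ (so $\alpha_j^{(p)}=1$ for all $j$ amounts to $\alpha_j^p=1$ for all $j$ when $p\ge5$). *)

theory Defs
  imports
    "HOL-Algebra.Algebra"
    "HOL-Library.Poly_Mapping"
    "HOL-Computational_Algebra.Primes"
    "Jordan_Normal_Form.Matrix"
begin

definition centralizer :: "('a, 'b) monoid_scheme \<Rightarrow> 'a set \<Rightarrow> 'a set" where
  "centralizer G S = {x \<in> carrier G. \<forall>s\<in>S. x \<otimes>\<^bsub>G\<^esub> s = s \<otimes>\<^bsub>G\<^esub> x}"

definition center :: "('a, 'b) monoid_scheme \<Rightarrow> 'a set" where
  "center G = centralizer G (carrier G)"

definition commutator :: "('a, 'b) monoid_scheme \<Rightarrow> 'a \<Rightarrow> 'a \<Rightarrow> 'a" where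
  "commutator G x y = inv\<^bsub>G\<^esub> x \<otimes>\<^bsub>G\<^esub> inv\<^bsub>G\<^esub> y \<otimes>\<^bsub>G\<^esub> x \<otimes>\<^bsub>G\<^esub> y"

abbreviation commutator_subgroup :: "('a, 'b) monoid_scheme \<Rightarrow> 'a set" where
  "commutator_subgroup G \<equiv> derived G (carrier G)"

definition isoclinic :: "('a, 'b) monoid_scheme \<Rightarrow> ('c, 'd) monoid_scheme \<Rightarrow> bool" where
  "isoclinic G H \<longleftrightarrow>
     (\<exists>\<phi> \<in> iso (G Mod center G) (H Mod center H).
      \<exists>\<psi> \<in> iso (G\<lparr>carrier := commutator_subgroup G\<rparr>) (H\<lparr>carrier := commutator_subgroup H\<rparr>).
        \<forall>x\<in>carrier G. \<forall>y\<in>carrier G. \<forall>u\<in>carrier H. \<forall>v\<in>carrier H.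
          \<phi> (center G #>\<^bsub>G\<^esub> x) = center H #>\<^bsub>H\<^esub> u \<longrightarrow>
          \<phi> (center G #>\<^bsub>G\<^esub> y) = center H #>\<^bsub>H\<^esub> v \<longrightarrow>
          \<psi> (commutator G x y) = commutator H u v)"

definition exponent :: "('a, 'b) monoid_scheme \<Rightarrow> nat" where
  "exponent G = (LEAST n. n > 0 \<and> (\<forall>x\<in>carrier G. x [^]\<^bsub>G\<^esub> n = \<one>\<^bsub>G\<^esub>))"

definition num_cyclic_subgroups :: "('a, 'b) monoid_scheme \<Rightarrow> nat \<Rightarrow> nat" where
  "num_cyclic_subgroups G d =
     card {H. subgroup H G \<and> cyclic_group (G\<lparr>carrier := H\<rparr>) \<and> card H = d}"

text \<open>The letter \<open>(x, True)\<close> stands for the generator \<open>x\<close>, and \<open>(x, False)\<close> for its inverse.\<close>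

type_synonym 'a word = "('a \<times> bool) list"

abbreviation words :: "'a set \<Rightarrow> 'a word set" where
  "words S \<equiv> lists (S \<times> UNIV)"

definition inv_word :: "'a word \<Rightarrow> 'a word" where
  "inv_word w = rev (map (\<lambda>(x, b). (x, \<not> b)) w)"

definition pow_word :: "'a word \<Rightarrow> nat \<Rightarrow> 'a word" where
  "pow_word w n = concat (replicate n w)"

definition comm_word :: "'a word \<Rightarrow> 'a word \<Rightarrow> 'a word" where
  "comm_word u v = inv_word u @ inv_word v @ u @ v"

inductive presentation_eq :: "'a set \<Rightarrow> 'a word set \<Rightarrow> 'a word \<Rightarrow> 'a word \<Rightarrow> bool"
  for S :: "'a set" and R :: "'a word set" where
  refl: "w \<in> words S \<Longrightarrow> presentation_eq S R w w"
| sym: "presentation_eq S R u v \<Longrightarrow> presentation_eq S R v u"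
| trans: "presentation_eq S R u v \<Longrightarrow> presentation_eq S R v w \<Longrightarrow> presentation_eq S R u w"
| cancel: "u \<in> words S \<Longrightarrow> v \<in> words S \<Longrightarrow> x \<in> S \<Longrightarrow>
    presentation_eq S R (u @ [(x, b), (x, \<not> b)] @ v) (u @ v)"
| relator: "u \<in> words S \<Longrightarrow> v \<in> words S \<Longrightarrow> r \<in> R \<Longrightarrow> r \<in> words S \<Longrightarrow>
    presentation_eq S R (u @ r @ v) (u @ v)"

definition presented_group :: "'a set \<Rightarrow> 'a word set \<Rightarrow> 'a word set monoid" where
  "presented_group S R =
     \<lparr>carrier = words S // {(u, v). presentation_eq S R u v},
      monoid.mult = (\<lambda>A B. {w. \<exists>u\<in>A. \<exists>v\<in>B. presentation_eq S R (u @ v) w}),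
      monoid.one = {w. presentation_eq S R [] w}\<rparr>"

text \<open>A presentation of \<open>\<Phi>\<^sub>9(1\<^sup>5)\<close>. Generator \<open>0\<close> is \<open>\<alpha>\<close>, and generator \<open>i\<close> is \<open>\<alpha>\<^sub>i\<close> for \<open>1 \<le> i \<le> 4\<close>;
  \<open>\<alpha>\<^sub>i\<close> is the empty word for \<open>i > 4\<close>.\<close>

definition phi9_alpha :: "nat word" where
  "phi9_alpha = [(0, True)]"

definition phi9_alpha_i :: "nat \<Rightarrow> nat word" where
  "phi9_alpha_i i = (if i \<le> 4 then [(i, True)] else [])"

text \<open>The word \<open>\<alpha>\<^sub>j\<^sup>p \<alpha>\<^sub>j\<^sub>+\<^sub>1\<^bsup>(p choose 2)\<^esup> \<dots> \<alpha>\<^sub>j\<^sub>+\<^sub>p\<^sub>-\<^sub>1\<close>, i.e. James's \<open>\<alpha>\<^sub>j\<^bsup>(p)\<^esup>\<close>.\<close>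

definition phi9_power_word :: "nat \<Rightarrow> nat \<Rightarrow> nat word" where
  "phi9_power_word p j =
     concat (map (\<lambda>k. pow_word (phi9_alpha_i (j + k - 1)) (p choose k)) [1..<p + 1])"

definition phi9_relators :: "nat \<Rightarrow> nat word set" where
  "phi9_relators p =
     {comm_word (phi9_alpha_i i) phi9_alpha @ inv_word (phi9_alpha_i (i + 1)) | i. i \<in> {1..3}} \<union>
     {comm_word (phi9_alpha_i 4) phi9_alpha} \<union>
     {comm_word (phi9_alpha_i i) (phi9_alpha_i j) | i j. i \<in> {1..4} \<and> j \<in> {1..4}} \<union>
     {pow_word phi9_alpha p} \<union>
     {phi9_power_word p j | j. j \<in> {1..4}}"

definition phi9_group :: "nat \<Rightarrow> nat word set monoid" where
  "phi9_group p = presented_group {0..4} (phi9_relators p)"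

definition rat_algebra_iso :: "(rat, 'a) module \<Rightarrow> (rat, 'b) module \<Rightarrow> bool" where
  "rat_algebra_iso A B \<longleftrightarrow>
     (\<exists>h \<in> ring_iso A B. \<forall>c. \<forall>x\<in>carrier A. h (c \<odot>\<^bsub>A\<^esub> x) = c \<odot>\<^bsub>B\<^esub> h x)"

definition rat_group_algebra :: "('a, 'b) monoid_scheme \<Rightarrow> (rat, 'a \<Rightarrow>\<^sub>0 rat) module" where
  "rat_group_algebra G =
     \<lparr>carrier = {f. Poly_Mapping.keys f \<subseteq> carrier G},
      monoid.mult = (\<lambda>f g. \<Sum>x\<in>Poly_Mapping.keys f. \<Sum>y\<in>Poly_Mapping.keys g.
        Poly_Mapping.single (x \<otimes>\<^bsub>G\<^esub> y) (Poly_Mapping.lookup f x * Poly_Mapping.lookup g y)),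
      monoid.one = Poly_Mapping.single \<one>\<^bsub>G\<^esub> 1,
      ring.zero = 0,
      ring.add = (\<lambda>f g. f + g),
      module.smult = (\<lambda>c f. Poly_Mapping.map (\<lambda>a. c * a) f)\<rparr>"

definition complex_ring :: "complex ring" where
  "complex_ring =
     \<lparr>carrier = UNIV,
      monoid.mult = (\<lambda>x y. x * y),
      monoid.one = 1,
      ring.zero = 0,
      ring.add = (\<lambda>x y. x + y)\<rparr>"

text \<open>Every subfield of the complex numbers contains the rationals, and
  \<open>cis (2 * pi / d)\<close> is a primitive \<open>d\<close>-th root of unity for \<open>d > 0\<close>.\<close>

definition cyclotomic_field :: "nat \<Rightarrow> complex set" where
  "cyclotomic_field d = generate_field complex_ring {cis (2 * pi / real d)}"

definition matrix_algebra :: "nat \<Rightarrow> complex set \<Rightarrow> (rat, complex mat) module" where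
  "matrix_algebra n K =
     \<lparr>carrier = {A \<in> carrier_mat n n. elements_mat A \<subseteq> K},
      monoid.mult = (\<lambda>A B. A * B),
      monoid.one = 1\<^sub>m n,
      ring.zero = 0\<^sub>m n n,
      ring.add = (\<lambda>A B. A + B),
      module.smult = (\<lambda>c A. of_rat c \<cdot>\<^sub>m A)\<rparr>"

definition algebra_sum2 :: "(rat, 'a) module \<Rightarrow> (rat, 'b) module \<Rightarrow> (rat, 'a \<times> 'b) module"
    (infixr \<open>\<oplus>\<^sub>Q\<close> 65) where
  "A \<oplus>\<^sub>Q B =
     \<lparr>carrier = carrier A \<times> carrier B,
      monoid.mult = (\<lambda>(a, b) (a', b'). (a \<otimes>\<^bsub>A\<^esub> a', b \<otimes>\<^bsub>B\<^esub> b')),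
      monoid.one = (\<one>\<^bsub>A\<^esub>, \<one>\<^bsub>B\<^esub>),
      ring.zero = (\<zero>\<^bsub>A\<^esub>, \<zero>\<^bsub>B\<^esub>),
      ring.add = (\<lambda>(a, b) (a', b'). (a \<oplus>\<^bsub>A\<^esub> a', b \<oplus>\<^bsub>B\<^esub> b')),
      module.smult = (\<lambda>c (a, b). (c \<odot>\<^bsub>A\<^esub> a, c \<odot>\<^bsub>B\<^esub> b))\<rparr>"

text \<open>The direct sum of a family of algebras, for a finite index set (the unit element needs this);
  the sum over the empty set is the zero algebra.\<close>

definition algebra_sum :: "'i set \<Rightarrow> ('i \<Rightarrow> (rat, 'a) module) \<Rightarrow> (rat, 'i \<Rightarrow> 'a) module" where
  "algebra_sum I A =
     \<lparr>carrier = (\<Pi>\<^sub>E i\<in>I. carrier (A i)),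
      monoid.mult = (\<lambda>x y. \<lambda>i\<in>I. x i \<otimes>\<^bsub>A i\<^esub> y i),
      monoid.one = (\<lambda>i\<in>I. \<one>\<^bsub>A i\<^esub>),
      ring.zero = (\<lambda>i\<in>I. \<zero>\<^bsub>A i\<^esub>),
      ring.add = (\<lambda>x y. \<lambda>i\<in>I. x i \<oplus>\<^bsub>A i\<^esub> y i),
      module.smult = (\<lambda>c x. \<lambda>i\<in>I. c \<odot>\<^bsub>A i\<^esub> x i)\<rparr>"

abbreviation algebra_copies :: "nat \<Rightarrow> (rat, 'a) module \<Rightarrow> (rat, nat \<Rightarrow> 'a) module" where
  "algebra_copies n A \<equiv> algebra_sum {..<n} (\<lambda>_. A)"

end

theory Submission
  imports Defs "Jordan_Normal_Form.Char_Poly" "HOL-Computational_Algebra.Field_as_Ring"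
    "HOL-Number_Theory.Residues"
begin

text \<open>Let \<open>A\<close> be the centralizer of \<open>G'\<close>. Transporting normal forms from \<open>\<Phi>\<^sub>9(1\<^sup>5)\<close> along the
  isoclinism shows that \<open>A\<close> is abelian of index \<open>p\<close>, with \<open>G = A\<langle>g\<rangle>\<close>, and that
  every \<open>p\<close>-th power in \<open>A\<close> is of the form \<open>[[b, g], g]\<close>. The last property implies that a
  character \<open>\<chi>\<close> of \<open>A\<close> that is nontrivial on \<open>G'\<close> has no power among its proper conjugates under \<open>g\<close>.
  Hence \<open>Gal \<times> \<langle>g\<rangle>\<close> acts freely on the characters of order \<open>d\<close> that are nontrivial on \<open>G'\<close>,
  and counting characters by torsion elements gives \<open>(a\<^sub>d - a'\<^sub>d) / p\<close> orbits. Each orbit contributes, through the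
  induced representation, one map \<open>\<rat>G \<rightarrow> M\<^sub>p(\<rat>(\<zeta>\<^sub>d))\<close>. Together with \<open>\<rat>G \<rightarrow> \<rat>(G/G')\<close> these maps are
  jointly injective, by Fourier inversion on \<open>A\<close> and the irreducibility of the \<open>p\<close>-power cyclotomic
  polynomials, and jointly surjective, because the idempotents of \<open>\<rat>A\<close> attached to the Galois orbits have
  rational coefficients (Ramanujan sums).\<close>

section \<open>Characters of finite abelian groups\<close>

text \<open>Orbits must have the full size: if a proper conjugate of \<chi> were a power of \<chi>,
  the values of the induced character would generate a proper subfield of the cyclotomic field, and
  the component would be another algebra. The condition on \<open>p\<close>-th powers excludes this.
  Isoclinism determines \<open>p\<close>-th powers only modulo the centre, and for
  \<open>p = 3\<close> the cube of \<open>a1\<close> is not even central. Both difficulties vanish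
  because order p^5 forces the centre to be generated by \<open>[a3, g]\<close>: a power of
  \<open>a3\<close> times a central element is then always a double commutator with
  \<open>g\<close>. In the count, a cyclic group of order \<open>d\<close> has as many generators as
  there are units modulo \<open>d\<close>; this factor cancels against the Galois part of an orbit
  and leaves the division by \<open>p\<close>. If \<open>d\<close> does not divide m', then a'_d =
  0, so the two sums of the statement form one family of components. Neither Galois automorphisms
  nor an isomorphism of \<open>A\<close> with its dual is constructed: vanishing rational sums of
  powers of a root of unity, and cardinalities of torsion subgroups, take their place.\<close>

text \<open>Characters are extended by \<open>0\<close> outside of the carrier; for a subgroup of a larger group this is the extension
  that enters the formula for induced representations.\<close>

definition characters :: "('a, 'b) monoid_scheme \<Rightarrow> ('a \<Rightarrow> complex) set" where
  "characters G = {\<chi>. (\<forall>x. x \<notin> carrier G \<longrightarrow> \<chi> x = 0) \<and> \<chi> \<one>\<^bsub>G\<^esub> = 1 \<and>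
     (\<forall>x\<in>carrier G. \<forall>y\<in>carrier G. \<chi> (x \<otimes>\<^bsub>G\<^esub> y) = \<chi> x * \<chi> y)}"

text \<open>Multiplication by a primitive root \<omega> permutes the roots and multiplies the sum by
  \<open>\<omega> ^ i\<close>, which is not 1.\<close>

lemma sum_roots_unity_power:
  assumes "0 < i" "i < n"
  shows "(\<Sum>w | w ^ n = (1::complex). w ^ i) = 0"
proof -
  define \<omega> where "\<omega> = cis (2 * pi / n)"
  have n: "n > 0" using assms by simp
  have w: "\<omega> ^ n = 1" using n by (simp add: \<omega>_def DeMoivre)
  have wi: "\<omega> ^ i \<noteq> 1"
  proof
    assume "\<omega> ^ i = 1"
    hence "cis (2 * pi * real i / real n) = cis (2 * pi * real 0 / real n)"
      by (simp add: \<omega>_def DeMoivre mult_ac)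
    thus False
      using inj_onD[OF bij_betw_imp_inj_on[OF bij_betw_roots_unity[OF n]], of i 0] assms by simp
  qed
  have "\<omega> \<noteq> 0" by (simp add: \<omega>_def)
  hence "(\<Sum>w | w ^ n = (1::complex). w ^ i) = (\<Sum>w | w ^ n = (1::complex). (\<omega> * w) ^ i)"
    using w by (intro sum.reindex_bij_witness[of _ "\<lambda>w. \<omega> * w" "\<lambda>w. w / \<omega>"])
      (auto simp: power_mult_distrib power_divide n)
  also have "\<dots> = \<omega> ^ i * (\<Sum>w | w ^ n = (1::complex). w ^ i)"
    by (simp add: power_mult_distrib sum_distrib_left)
  finally show ?thesis using wi by auto
qed

locale finite_comm_group = comm_group +
  assumes finite_carrier: "finite (carrier G)"
begin

lemma characterI:
  assumes "\<And>x. x \<notin> carrier G \<Longrightarrow> \<chi> x = 0" "\<chi> \<one> = 1"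
    and "\<And>x y. x \<in> carrier G \<Longrightarrow> y \<in> carrier G \<Longrightarrow> \<chi> (x \<otimes> y) = \<chi> x * \<chi> y"
  shows "\<chi> \<in> characters G"
  using assms by (auto simp: characters_def)

lemma character_mult:
  "\<chi> \<in> characters G \<Longrightarrow> x \<in> carrier G \<Longrightarrow> y \<in> carrier G \<Longrightarrow> \<chi> (x \<otimes> y) = \<chi> x * \<chi> y"
  by (auto simp: characters_def)

lemma character_one: "\<chi> \<in> characters G \<Longrightarrow> \<chi> \<one> = 1"
  by (auto simp: characters_def)

lemma character_outside: "\<chi> \<in> characters G \<Longrightarrow> x \<notin> carrier G \<Longrightarrow> \<chi> x = 0"
  by (auto simp: characters_def)

lemma character_pow:
  assumes "\<chi> \<in> characters G" "x \<in> carrier G"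
  shows "\<chi> (x [^] (n::nat)) = \<chi> x ^ n"
  by (induction n) (use assms in \<open>auto simp: character_one character_mult\<close>)

lemma order_pos: "Coset.order G > 0"
  using finite_carrier one_closed by (auto simp: Coset.order_def card_gt_0_iff)

lemma character_pow_order:
  assumes "\<chi> \<in> characters G" "x \<in> carrier G"
  shows "\<chi> x ^ Coset.order G = 1"
  using character_pow[OF assms, of "Coset.order G"] assms pow_order_eq_1[of x]
  by (simp add: character_one)

lemma character_nonzero:
  assumes "\<chi> \<in> characters G" "x \<in> carrier G"
  shows "\<chi> x \<noteq> 0"
  using character_pow_order[OF assms] order_pos by (metis power_0_left not_gr0 zero_neq_one)

lemma character_inv:
  assumes "\<chi> \<in> characters G" "x \<in> carrier G"
  shows "\<chi> (inv x) = inverse (\<chi> x)"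
proof -
  have "\<chi> x * \<chi> (inv x) = 1"
    using character_mult[OF assms(1) assms(2) inv_closed[OF assms(2)]] assms
    by (simp add: character_one)
  thus ?thesis by (metis inverse_unique)
qed

lemma finite_characters: "finite (characters G)"
proof -
  have "finite {w. w ^ Coset.order G = (1::complex)}"
    using finite_roots_unity[of "Coset.order G"] order_pos by auto
  hence "finite {f. \<forall>x. (x \<in> carrier G \<longrightarrow> f x \<in> {w. w ^ Coset.order G = (1::complex)}) \<and>
      (x \<notin> carrier G \<longrightarrow> f x = 0)}"
    by (intro finite_set_of_finite_funs finite_carrier)
  moreover have "characters G \<subseteq> {f. \<forall>x. (x \<in> carrier G \<longrightarrow> f x \<in> {w. w ^ Coset.order G = (1::complex)}) \<and>
      (x \<notin> carrier G \<longrightarrow> f x = 0)}"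
    by (auto simp: character_outside character_pow_order)
  ultimately show ?thesis by (rule rev_finite_subset)
qed

lemma sum_character_subgroup:
  assumes "\<chi> \<in> characters G" "subgroup B G"
  shows "(\<Sum>b\<in>B. \<chi> b) = (if \<forall>b\<in>B. \<chi> b = 1 then of_nat (card B) else 0)"
proof (cases "\<forall>b\<in>B. \<chi> b = 1")
  case False
  interpret B: subgroup B G by fact
  from False obtain c where c: "c \<in> B" "\<chi> c \<noteq> 1" by auto
  have "(\<Sum>b\<in>B. \<chi> b) = (\<Sum>b\<in>B. \<chi> (c \<otimes> b))"
    using c by (intro sum.reindex_bij_witness[of _ "\<lambda>b. c \<otimes> b" "\<lambda>b. inv c \<otimes> b"])
      (auto simp: m_assoc[symmetric])
  also have "\<dots> = \<chi> c * (\<Sum>b\<in>B. \<chi> b)"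
    using c assms by (simp add: sum_distrib_left character_mult)
  finally show ?thesis using c False by auto
qed auto

text \<open>For a root of unity \<open>w\<close> of order dividing \<open>|G|\<close>, the projection of \<open>v\<close> to the
  eigenspace of translation by \<open>b\<close> for the eigenvalue \<open>w\<^sup>-\<^sup>1\<close>, up to the factor \<open>|G|\<close>.\<close>

definition eigenproj :: "'a \<Rightarrow> complex \<Rightarrow> ('a \<Rightarrow> complex) \<Rightarrow> 'a \<Rightarrow> complex" where
  "eigenproj b w v x = (\<Sum>i<Coset.order G. w ^ i * v (x \<otimes> b [^] i))"

text \<open>Raising the summation index by one wraps around, because \<open>w\<close> and
  \<open>b\<close> both have order dividing |G|.\<close>

lemma eigenproj_eigen:
  assumes "w ^ Coset.order G = 1" "b \<in> carrier G" "x \<in> carrier G"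
  shows "eigenproj b w v (x \<otimes> b) = inverse w * eigenproj b w v x"
proof -
  obtain n where n: "Coset.order G = Suc n" using order_pos by (cases "Coset.order G") auto
  have w0: "w \<noteq> 0" using assms n by auto
  have bn: "b [^] Suc n = \<one>" using assms pow_order_eq_1[of b] n by simp
  have "w * eigenproj b w v (x \<otimes> b) = (\<Sum>i<Suc n. w ^ Suc i * v (x \<otimes> b [^] Suc i))"
    unfolding eigenproj_def n sum_distrib_left
  proof (rule sum.cong[OF HOL.refl])
    fix i
    have "x \<otimes> b \<otimes> b [^] i = x \<otimes> b [^] Suc i"
      using assms by (simp only: nat_pow_Suc2 m_assoc nat_pow_closed)
    thus "w * (w ^ i * v (x \<otimes> b \<otimes> b [^] i)) = w ^ Suc i * v (x \<otimes> b [^] Suc i)" by simp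
  qed
  also have "\<dots> = (\<Sum>i<n. w ^ Suc i * v (x \<otimes> b [^] Suc i)) + v x"
    using assms n bn by simp
  also have "\<dots> = (\<Sum>i<Suc n. w ^ i * v (x \<otimes> b [^] i))"
    unfolding sum.lessThan_Suc_shift[of "\<lambda>i. w ^ i * v (x \<otimes> b [^] i)"] using assms by simp
  finally have "w * eigenproj b w v (x \<otimes> b) = eigenproj b w v x"
    by (simp add: eigenproj_def n)
  thus ?thesis using w0 by (simp add: field_simps)
qed

text \<open>Summing over \<open>w\<close> first annihilates every shift except
  \<open>i = 0\<close>.\<close>

lemma sum_eigenproj:
  assumes "b \<in> carrier G" "x \<in> carrier G"
  shows "(\<Sum>w | w ^ Coset.order G = 1. eigenproj b w v x) = of_nat (Coset.order G) * v x"
proof -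
  have "(\<Sum>w | w ^ Coset.order G = 1. eigenproj b w v x) =
      (\<Sum>i<Coset.order G. (\<Sum>w | w ^ Coset.order G = 1. w ^ i) * v (x \<otimes> b [^] i))"
    unfolding eigenproj_def by (subst sum.swap) (simp add: sum_distrib_right)
  also have "\<dots> = (\<Sum>i<Coset.order G. (if i = 0 then of_nat (Coset.order G) * v x else 0))"
    using assms by (intro sum.cong HOL.refl)
      (auto simp: sum_roots_unity_power card_roots_unity_eq order_pos)
  also have "\<dots> = of_nat (Coset.order G) * v x" using order_pos by simp
  finally show ?thesis .
qed

lemma eigenproj_commute:
  assumes "b \<in> carrier G" "c \<in> carrier G" "\<And>x. x \<in> carrier G \<Longrightarrow> v (x \<otimes> c) = e * v x"
    and "x \<in> carrier G"
  shows "eigenproj b w v (x \<otimes> c) = e * eigenproj b w v x"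
proof -
  have "v (x \<otimes> c \<otimes> b [^] i) = e * v (x \<otimes> b [^] i)" for i :: nat
    using assms(3)[of "x \<otimes> b [^] i"] assms by (simp add: m_ac)
  thus ?thesis by (simp add: eigenproj_def sum_distrib_left mult_ac)
qed

text \<open>Project for one element of \<open>B\<close> after the other. Translations commute, so
  earlier eigenvalue equations survive, and some projection is nonzero because together they sum to
  a multiple of the vector. The last conjunct records that the equations of \<open>v\<close> itself
  survive too; through it an eigenvalue can be prescribed in advance.\<close>

lemma simultaneous_eigenvector:
  fixes v :: "'a \<Rightarrow> complex"
  assumes "finite B" "B \<subseteq> carrier G" "x0 \<in> carrier G" "v x0 \<noteq> 0"
  shows "\<exists>u. (\<exists>x\<in>carrier G. u x \<noteq> 0) \<and> (\<forall>b\<in>B. \<exists>e. \<forall>x\<in>carrier G. u (x \<otimes> b) = e * u x) \<and>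
    (\<forall>c\<in>carrier G. \<forall>e. (\<forall>x\<in>carrier G. v (x \<otimes> c) = e * v x) \<longrightarrow>
       (\<forall>x\<in>carrier G. u (x \<otimes> c) = e * u x))"
  using assms
proof (induction B rule: finite_induct)
  case empty
  thus ?case by (intro exI[of _ v]) blast
next
  case (insert b B)
  then obtain u :: "'a \<Rightarrow> complex" and y where u: "y \<in> carrier G" "u y \<noteq> 0"
    "\<forall>b\<in>B. \<exists>e. \<forall>x\<in>carrier G. u (x \<otimes> b) = e * u x"
    "\<forall>c\<in>carrier G. \<forall>e. (\<forall>x\<in>carrier G. v (x \<otimes> c) = e * v x) \<longrightarrow>
       (\<forall>x\<in>carrier G. u (x \<otimes> c) = e * u x)" by auto
  have b: "b \<in> carrier G" "B \<subseteq> carrier G" using insert.prems by auto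
  have "(\<Sum>w | w ^ Coset.order G = 1. eigenproj b w u y) \<noteq> 0"
    using sum_eigenproj[OF b(1) u(1), of u] u(2) order_pos by simp
  then obtain w where w: "w ^ Coset.order G = 1" "eigenproj b w u y \<noteq> 0"
    using sum.neutral[of "{w. w ^ Coset.order G = (1::complex)}" "\<lambda>w. eigenproj b w u y"] by blast
  have "\<exists>e. \<forall>x\<in>carrier G. eigenproj b w u (x \<otimes> c) = e * eigenproj b w u x"
    if "c \<in> insert b B" for c
  proof (cases "c = b")
    case True
    thus ?thesis using eigenproj_eigen[OF w(1) b(1)] by blast
  next
    case False
    hence "c \<in> B" using that by simp
    then obtain e where "\<forall>x\<in>carrier G. u (x \<otimes> c) = e * u x" using u by blast
    thus ?thesis using eigenproj_commute[OF b(1), of c u e] \<open>c \<in> B\<close> b by blast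
  qed
  moreover have "\<forall>x\<in>carrier G. eigenproj b w u (x \<otimes> c) = e * eigenproj b w u x"
    if "c \<in> carrier G" "\<forall>x\<in>carrier G. v (x \<otimes> c) = e * v x" for c e
    using eigenproj_commute[OF b(1) that(1), of u e] u(4) that by blast
  ultimately show ?case using w u(1) by (intro exI[of _ "eigenproj b w u"]) blast
qed

text \<open>If only the projection for \<open>w = 1\<close> of the indicator function of \<one> were
  nonzero, that function would be invariant under translation by \<open>a\<close>. Hence some
  projection for \<open>w \<noteq> 1\<close> survives, and a simultaneous eigenvector refined from
  it yields a character with value \<open>inverse w\<close> at \<open>a\<close>.\<close>

lemma characters_separate:
  assumes "a \<in> carrier G" "a \<noteq> \<one>"
  obtains \<chi> where "\<chi> \<in> characters G" "\<chi> a \<noteq> 1"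
proof -
  define d where "d = (\<lambda>x. if x = \<one> then 1 else 0 :: complex)"
  obtain w x0 where w: "w ^ Coset.order G = 1" "w \<noteq> 1" "x0 \<in> carrier G" "eigenproj a w d x0 \<noteq> 0"
  proof -
    have "\<exists>w x0. w ^ Coset.order G = 1 \<and> w \<noteq> 1 \<and> x0 \<in> carrier G \<and> eigenproj a w d x0 \<noteq> 0"
    proof (rule ccontr)
      assume *: "\<not> ?thesis"
      have fin: "finite {w. w ^ Coset.order G = (1::complex)}"
        using finite_roots_unity[of "Coset.order G"] order_pos by auto
      have "eigenproj a 1 d x = of_nat (Coset.order G) * d x" if "x \<in> carrier G" for x
      proof -
        have "of_nat (Coset.order G) * d x = (\<Sum>w | w ^ Coset.order G = 1. eigenproj a w d x)"
          using sum_eigenproj assms that by simp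
        also have "\<dots> = (\<Sum>w\<in>{1}. eigenproj a w d x)"
          using * that fin by (intro sum.mono_neutral_right) auto
        finally show ?thesis by simp
      qed
      from this[of a] this[of \<one>] eigenproj_eigen[of 1 a \<one> d] assms order_pos
      show False by (simp add: d_def)
    qed
    thus ?thesis using that by blast
  qed
  from simultaneous_eigenvector[OF finite_carrier order_refl w(3), of "eigenproj a w d"] w(4)
  obtain u y where u: "y \<in> carrier G" "u y \<noteq> 0"
    "\<forall>b\<in>carrier G. \<exists>e. \<forall>x\<in>carrier G. u (x \<otimes> b) = e * u x"
    "\<forall>c\<in>carrier G. \<forall>e. (\<forall>x\<in>carrier G. eigenproj a w d (x \<otimes> c) = e * eigenproj a w d x) \<longrightarrow>
       (\<forall>x\<in>carrier G. u (x \<otimes> c) = e * u x)" by blast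
  have ua: "u (x \<otimes> a) = inverse w * u x" if "x \<in> carrier G" for x
    using u(4) assms(1) eigenproj_eigen[OF w(1) assms(1)] that by blast
  \<comment> \<open>The eigenvalues of \<open>u\<close>, read off at the point \<open>y\<close>
    where \<open>u\<close> does not vanish.\<close>
  define \<chi> where "\<chi> = (\<lambda>x. if x \<in> carrier G then u (y \<otimes> x) / u y else 0)"
  have eig: "u (x \<otimes> b) = \<chi> b * u x" if "b \<in> carrier G" "x \<in> carrier G" for b x
  proof -
    have "\<exists>e. \<forall>x\<in>carrier G. u (x \<otimes> b) = e * u x" by (rule bspec[OF u(3) that(1)])
    then obtain e where e: "\<forall>x\<in>carrier G. u (x \<otimes> b) = e * u x" by (elim exE)
    hence "u (y \<otimes> b) = e * u y" using u(1) by blast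
    hence "\<chi> b = e" using u(2) that by (simp add: \<chi>_def)
    thus ?thesis using e that by blast
  qed
  have "\<chi> \<in> characters G"
  proof (rule characterI)
    fix a b assume ab: "a \<in> carrier G" "b \<in> carrier G"
    have "u (y \<otimes> (a \<otimes> b)) = \<chi> b * (\<chi> a * u y)"
      using eig[of b "y \<otimes> a"] eig[of a y] ab u(1) by (simp add: m_assoc)
    moreover have "u (y \<otimes> (a \<otimes> b)) = \<chi> (a \<otimes> b) * u y"
      using eig[of "a \<otimes> b" y] ab u(1) by simp
    ultimately show "\<chi> (a \<otimes> b) = \<chi> a * \<chi> b" using u(2) by simp
  qed (use u in \<open>auto simp: \<chi>_def\<close>)
  moreover have "\<chi> a = inverse w" using ua[OF u(1)] u assms by (simp add: \<chi>_def)
  hence "\<chi> a \<noteq> 1" using w(2) by simp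
  ultimately show ?thesis using that by blast
qed

section \<open>Orthogonality relations and Fourier inversion\<close>

lemma character_times:
  "\<chi> \<in> characters G \<Longrightarrow> \<psi> \<in> characters G \<Longrightarrow> (\<lambda>x. \<chi> x * \<psi> x) \<in> characters G"
  by (rule characterI) (simp_all add: character_outside character_one character_mult)

lemma character_inverse:
  assumes "\<chi> \<in> characters G"
  shows "(\<lambda>x. inverse (\<chi> x)) \<in> characters G"
  using assms
  by (intro characterI) (simp_all add: character_outside character_one character_mult)

lemma sum_characters_nontrivial:
  assumes "a \<in> carrier G" "a \<noteq> \<one>"
  shows "(\<Sum>\<chi>\<in>characters G. \<chi> a) = 0"
proof -
  obtain \<psi> where psi: "\<psi> \<in> characters G" "\<psi> a \<noteq> 1" using characters_separate assms by blast
  have nz: "x \<in> carrier G \<or> \<chi> x = 0" if "\<chi> \<in> characters G" for \<chi> x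
    using that character_outside by blast
  have "(\<Sum>\<chi>\<in>characters G. \<chi> a) = (\<Sum>\<chi>\<in>characters G. \<psi> a * \<chi> a)"
  proof (intro sum.reindex_bij_witness[of _ "\<lambda>\<chi> x. \<psi> x * \<chi> x" "\<lambda>\<chi> x. inverse (\<psi> x) * \<chi> x"])
    fix \<chi> assume chi: "\<chi> \<in> characters G"
    have *: "\<psi> x * (inverse (\<psi> x) * \<chi> x) = \<chi> x" "inverse (\<psi> x) * (\<psi> x * \<chi> x) = \<chi> x" for x
      using nz[OF chi, of x] character_nonzero[OF psi(1), of x] by auto
    show "(\<lambda>x. \<psi> x * (inverse (\<psi> x) * \<chi> x)) = \<chi>" "(\<lambda>x. inverse (\<psi> x) * (\<psi> x * \<chi> x)) = \<chi>"
      using * by auto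
    show "(\<lambda>x. inverse (\<psi> x) * \<chi> x) \<in> characters G"
      by (intro character_times character_inverse psi chi)
    show "(\<lambda>x. \<psi> x * \<chi> x) \<in> characters G"
      by (intro character_times psi chi)
    show "\<psi> a * (inverse (\<psi> a) * \<chi> a) = \<chi> a" by (rule *)
  qed
  also have "\<dots> = \<psi> a * (\<Sum>\<chi>\<in>characters G. \<chi> a)" by (simp add: sum_distrib_left)
  finally show ?thesis using psi by auto
qed

text \<open>Summing \<chi> a over all pairs gives the number of characters if the inner sum runs
  over characters, and |G| if it runs over the group.\<close>

lemma card_characters: "card (characters G) = Coset.order G"
proof -
  define \<iota> :: "'a \<Rightarrow> complex" where "\<iota> = (\<lambda>x. if x \<in> carrier G then 1 else 0)"
  have iota: "\<iota> \<in> characters G" by (auto simp: \<iota>_def characters_def)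
  have triv: "(\<forall>b\<in>carrier G. \<chi> b = 1) \<longleftrightarrow> \<chi> = \<iota>" if "\<chi> \<in> characters G" for \<chi>
    using that by (auto simp: \<iota>_def characters_def)
  have "of_nat (card (characters G)) = (\<Sum>a\<in>carrier G. if a = \<one> then of_nat (card (characters G)) else (0::complex))"
    using finite_carrier by simp
  also have "\<dots> = (\<Sum>a\<in>carrier G. \<Sum>\<chi>\<in>characters G. \<chi> a)"
    by (intro sum.cong HOL.refl) (auto simp: sum_characters_nontrivial character_one)
  also have "\<dots> = (\<Sum>\<chi>\<in>characters G. \<Sum>a\<in>carrier G. \<chi> a)" by (rule sum.swap)
  also have "\<dots> = (\<Sum>\<chi>\<in>characters G. if \<chi> = \<iota> then of_nat (card (carrier G)) else 0)"
    by (rule sum.cong[OF HOL.refl]) (simp only: sum_character_subgroup[OF _ subgroup_self] triv)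
  also have "\<dots> = of_nat (Coset.order G)"
    using iota finite_characters by (simp add: Coset.order_def)
  finally show ?thesis by (simp only: of_nat_eq_iff)
qed

lemma sum_characters:
  assumes "a \<in> carrier G"
  shows "(\<Sum>\<chi>\<in>characters G. \<chi> a) = (if a = \<one> then of_nat (Coset.order G) else 0)"
  using assms sum_characters_nontrivial[of a] by (auto simp: character_one card_characters)

lemma fourier_injective:
  fixes f :: "'a \<Rightarrow> complex"
  assumes "\<And>\<chi>. \<chi> \<in> characters G \<Longrightarrow> (\<Sum>a\<in>carrier G. f a * \<chi> a) = 0" and "x \<in> carrier G"
  shows "f x = 0"
proof -
  have "0 = (\<Sum>\<chi>\<in>characters G. \<chi> (inv x) * (\<Sum>a\<in>carrier G. f a * \<chi> a))"
    using assms(1) by simp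
  also have "\<dots> = (\<Sum>a\<in>carrier G. f a * (\<Sum>\<chi>\<in>characters G. \<chi> (inv x \<otimes> a)))"
    unfolding sum_distrib_left by (subst sum.swap) (use assms(2) in \<open>simp add: character_mult mult_ac\<close>)
  also have "\<dots> = (\<Sum>a\<in>carrier G. if a = x then f x * of_nat (Coset.order G) else 0)"
  proof (rule sum.cong[OF HOL.refl])
    fix a assume "a \<in> carrier G"
    moreover have "inv x \<otimes> a = \<one> \<longleftrightarrow> a = x"
      using \<open>a \<in> carrier G\<close> assms(2) by (metis inv_closed inv_equality inv_inv l_inv)
    ultimately show "f a * (\<Sum>\<chi>\<in>characters G. \<chi> (inv x \<otimes> a)) = (if a = x then f x * of_nat (Coset.order G) else 0)"
      using sum_characters[of "inv x \<otimes> a"] assms(2) by simp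
  qed
  also have "\<dots> = f x * of_nat (Coset.order G)" using assms finite_carrier by simp
  finally show ?thesis using order_pos by simp
qed

text \<open>The sum of \<chi> b over \<open>b\<close> in \<open>B\<close> and all characters,
  evaluated in both orders.\<close>

lemma card_characters_trivial_on:
  assumes "subgroup B G"
  shows "card {\<chi> \<in> characters G. \<forall>b\<in>B. \<chi> b = 1} * card B = Coset.order G"
proof -
  interpret B: subgroup B G by fact
  have fB: "finite B" using B.subset finite_carrier by (rule finite_subset)
  have "of_nat (card {\<chi> \<in> characters G. \<forall>b\<in>B. \<chi> b = 1} * card B) =
      (\<Sum>\<chi>\<in>characters G. if \<forall>b\<in>B. \<chi> b = 1 then of_nat (card B) else (0::complex))"
    using finite_characters by (simp add: sum.If_cases Int_def)
  also have "\<dots> = (\<Sum>b\<in>B. \<Sum>\<chi>\<in>characters G. \<chi> b)"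
    by (subst sum.swap) (simp add: sum_character_subgroup assms)
  also have "\<dots> = (\<Sum>b\<in>B. if b = \<one> then of_nat (Coset.order G) else 0)"
    by (intro sum.cong HOL.refl sum_characters) (rule B.mem_carrier)
  also have "\<dots> = of_nat (Coset.order G)" using fB by simp
  finally show ?thesis by (simp only: of_nat_eq_iff)
qed

section \<open>Counting characters by torsion elements\<close>

lemma card_powers_times_card_torsion:
  "card ((\<lambda>x. x [^] n) ` carrier G) * card {x \<in> carrier G. x [^] (n::nat) = \<one>} = Coset.order G"
proof -
  let ?f = "\<lambda>x. x [^] n"
  have "card {x \<in> carrier G. ?f x = y} = card {x \<in> carrier G. x [^] n = \<one>}"
    if "y \<in> ?f ` carrier G" for y
  proof -
    from that obtain z where z: "z \<in> carrier G" "y = z [^] n" by auto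
    have *: "z \<otimes> (inv z \<otimes> x) = x" "inv z \<otimes> (z \<otimes> x) = x" if "x \<in> carrier G" for x
      using that z(1) by (simp_all flip: m_assoc)
    have "(z \<otimes> x) [^] n = y" if "x \<in> carrier G" "x [^] n = \<one>" for x
      using that z by (simp add: nat_pow_distrib)
    moreover have "(inv z \<otimes> x) [^] n = \<one>" if "x \<in> carrier G" "x [^] n = y" for x
      using that z by (simp add: nat_pow_distrib nat_pow_inv)
    ultimately have "bij_betw (\<lambda>x. z \<otimes> x) {x \<in> carrier G. x [^] n = \<one>} {x \<in> carrier G. ?f x = y}"
      using z * by (intro bij_betw_byWitness[where f' = "\<lambda>x. inv z \<otimes> x"]) auto
    thus ?thesis by (rule bij_betw_same_card[symmetric])
  qed
  hence "(\<Sum>y\<in>?f ` carrier G. card {x \<in> carrier G. ?f x = y}) =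
      card (?f ` carrier G) * card {x \<in> carrier G. x [^] n = \<one>}" by simp
  moreover have "(\<Sum>y\<in>?f ` carrier G. card {x \<in> carrier G. ?f x = y}) = Coset.order G"
    using sum.image_gen[OF finite_carrier, of "\<lambda>_. 1::nat" ?f] by (simp add: Coset.order_def)
  ultimately show ?thesis by simp
qed

lemma subgroup_powers: "subgroup ((\<lambda>x. x [^] (n::nat)) ` carrier G) G"
proof
  fix x y assume "x \<in> (\<lambda>x. x [^] n) ` carrier G" "y \<in> (\<lambda>x. x [^] n) ` carrier G"
  thus "x \<otimes> y \<in> (\<lambda>x. x [^] n) ` carrier G"
    by (auto simp: nat_pow_distrib[symmetric])
next
  show "\<one> \<in> (\<lambda>x. x [^] n) ` carrier G" by (rule image_eqI[of _ _ \<one>]) auto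
next
  fix x assume "x \<in> (\<lambda>x. x [^] n) ` carrier G"
  thus "inv x \<in> (\<lambda>x. x [^] n) ` carrier G"
    by (auto simp flip: nat_pow_inv)
qed auto

text \<open>A character is killed by \<open>n\<close> exactly if it is trivial on the subgroup of
  \<open>n\<close>-th powers, whose index is the number of \<open>n\<close>-torsion elements. This
  count replaces an isomorphism between the group and its dual.\<close>

lemma card_characters_torsion:
  "card {\<chi> \<in> characters G. \<forall>x\<in>carrier G. \<chi> x ^ n = 1} = card {x \<in> carrier G. x [^] n = \<one>}"
proof -
  let ?B = "(\<lambda>x. x [^] n) ` carrier G"
  have "{\<chi> \<in> characters G. \<forall>x\<in>carrier G. \<chi> x ^ n = 1} = {\<chi> \<in> characters G. \<forall>b\<in>?B. \<chi> b = 1}"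
    by (rule Collect_cong) (simp add: character_pow cong: conj_cong)
  moreover have "card ?B > 0" using finite_carrier one_closed by (auto simp: card_gt_0_iff)
  moreover have "card {\<chi> \<in> characters G. \<forall>b\<in>?B. \<chi> b = 1} * card ?B =
      card {x \<in> carrier G. x [^] n = \<one>} * card ?B"
    unfolding card_characters_trivial_on[OF subgroup_powers]
    by (subst mult.commute) (rule card_powers_times_card_torsion[symmetric])
  ultimately show ?thesis by simp
qed

text \<open>Inflation identifies the characters of the quotient with those trivial on
  \<open>N\<close>, and the preceding count is applied to the quotient.\<close>

lemma card_characters_quotient_torsion:
  assumes "subgroup N G"
  shows "card {\<chi> \<in> characters G. (\<forall>b\<in>N. \<chi> b = 1) \<and> (\<forall>x\<in>carrier G. \<chi> x ^ n = 1)} =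
    card {q \<in> carrier (G Mod N). q [^]\<^bsub>G Mod N\<^esub> n = \<one>\<^bsub>G Mod N\<^esub>}"
proof -
  interpret N: subgroup N G by fact
  interpret N: normal N G by (rule subgroup_imp_normal[OF assms])
  interpret Q: comm_group "G Mod N" by (rule abelian_FactGroup[OF assms])
  have carQ: "carrier (G Mod N) = (\<lambda>x. N #> x) ` carrier G"
    by (auto simp: FactGroup_def RCOSETS_def)
  interpret Q: finite_comm_group "G Mod N"
    by unfold_locales (simp add: carQ finite_carrier)
  let ?L = "{\<chi> \<in> characters G. (\<forall>b\<in>N. \<chi> b = 1) \<and> (\<forall>x\<in>carrier G. \<chi> x ^ n = 1)}"
  let ?R = "{\<chi> \<in> characters (G Mod N). \<forall>x\<in>carrier (G Mod N). \<chi> x ^ n = 1}"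
  let ?up = "\<lambda>\<psi> x. if x \<in> carrier G then \<psi> (N #> x) else (0::complex)"
  \<comment> \<open>Evaluation at an arbitrary representative; the choice has no effect on
    characters trivial on \<open>N\<close>.\<close>
  let ?down = "\<lambda>\<chi> q. if q \<in> carrier (G Mod N) then (\<chi> (SOME x. x \<in> q) :: complex) else 0"
  have some: "\<exists>z\<in>N. (SOME y. y \<in> N #> x) = z \<otimes> x" if "x \<in> carrier G" for x
  proof -
    have "(SOME y. y \<in> N #> x) \<in> N #> x"
      by (rule someI[of _ x]) (use that in \<open>simp add: rcos_self[OF _ assms]\<close>)
    thus ?thesis by (auto simp: r_coset_def)
  qed
  have down: "?down \<chi> (N #> x) = \<chi> x" if "\<chi> \<in> ?L" "x \<in> carrier G" for \<chi> x
    using some[OF that(2)] that by (auto simp: carQ character_mult)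
  have "bij_betw ?up ?R ?L"
  proof (intro bij_betw_byWitness[where f' = ?down] ballI subsetI)
    fix \<psi> assume psi: "\<psi> \<in> ?R"
    show "?down (?up \<psi>) = \<psi>"
    proof
      fix q
      show "?down (?up \<psi>) q = \<psi> q"
      proof (cases "q \<in> carrier (G Mod N)")
        case True
        then obtain x where x: "x \<in> carrier G" "q = N #> x" by (auto simp: carQ)
        from some[OF x(1)] obtain z where z: "z \<in> N" "(SOME y. y \<in> q) = z \<otimes> x" using x by auto
        have "N #> (z \<otimes> x) = N #> x"
          using z x coset_mult_assoc[OF N.subset, of z x] N.rcos_const[OF is_group z(1)] by simp
        moreover have "?down (?up \<psi>) q = ?up \<psi> (z \<otimes> x)" using True z(2) by simp
        ultimately show ?thesis using x z(1) by simp
      qed (use psi Q.character_outside in auto)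
    qed
  next
    fix \<chi> assume "\<chi> \<in> ?L"
    thus "?up (?down \<chi>) = \<chi>" using down by (auto simp: fun_eq_iff character_outside)
  next
    fix \<chi> assume "\<chi> \<in> ?up ` ?R"
    then obtain \<psi> where psi: "\<psi> \<in> ?R" "\<chi> = ?up \<psi>" by auto
    have one: "N #> \<one> = \<one>\<^bsub>G Mod N\<^esub>" by (simp add: coset_mult_one N.subset)
    have "N #> b = \<one>\<^bsub>G Mod N\<^esub>" if "b \<in> N" for b using that by (simp add: N.rcos_const)
    thus "\<chi> \<in> ?L" using psi one Q.character_one[of \<psi>] Q.character_mult[of \<psi>]
      by (auto simp: characters_def carQ N.rcos_sum[symmetric])
  next
    fix \<psi> assume "\<psi> \<in> ?down ` ?L"
    then obtain \<chi> where chi: "\<chi> \<in> ?L" "\<psi> = ?down \<chi>" by auto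
    have "\<psi> (N #> x) = \<chi> x" if "x \<in> carrier G" for x using down[OF chi(1) that] chi(2) by simp
    moreover have "\<psi> q = 0" if "q \<notin> carrier (G Mod N)" for q using chi that by simp
    moreover have "\<one>\<^bsub>G Mod N\<^esub> = N #> \<one>" by (simp add: coset_mult_one N.subset)
    ultimately show "\<psi> \<in> ?R" using chi(1)
      by (auto simp: characters_def carQ N.rcos_sum simp del: one_FactGroup)
  qed
  hence "card ?R = card ?L" by (rule bij_betw_same_card)
  thus ?thesis using Q.card_characters_torsion[of n] by simp
qed

end

section \<open>Prime-power roots of unity\<close>

interpretation of_rat_poly_hom: map_poly_idom_hom "of_rat :: rat \<Rightarrow> complex" ..

lemma eval_int_poly:
  fixes z :: complex and F H :: "int poly"
  shows "eval_poly of_int (F + H) z = eval_poly of_int F z + eval_poly of_int H z"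
    and "eval_poly of_int (F - H) z = eval_poly of_int F z - eval_poly of_int H z"
    and "eval_poly of_int (F * H) z = eval_poly of_int F z * eval_poly of_int H z"
    and "eval_poly of_int (1 :: int poly) z = 1"
    and "eval_poly of_int (smult c F) z = of_int c * eval_poly of_int F z"
    and "eval_poly of_int (monom c n :: int poly) z = of_int c * z ^ n"
  by (simp_all add: eval_poly_def of_int_poly_hom.hom_add of_int_poly_hom.hom_minus
      of_int_poly_hom.hom_mult of_int_hom.map_poly_hom_smult map_poly_monom poly_monom)

lemma eval_rat_poly:
  fixes z :: complex and F H :: "rat poly"
  shows "eval_poly of_rat (F + H) z = eval_poly of_rat F z + eval_poly of_rat H z"
    and "eval_poly of_rat (F - H) z = eval_poly of_rat F z - eval_poly of_rat H z"
    and "eval_poly of_rat (- F) z = - eval_poly of_rat F z"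
    and "eval_poly of_rat (F * H) z = eval_poly of_rat F z * eval_poly of_rat H z"
    and "eval_poly of_rat (1 :: rat poly) z = 1"
    and "eval_poly of_rat (smult c F) z = of_rat c * eval_poly of_rat F z"
    and "eval_poly of_rat (monom c n :: rat poly) z = of_rat c * z ^ n"
  by (simp_all add: eval_poly_def of_rat_poly_hom.hom_add of_rat_poly_hom.hom_minus
      of_rat_poly_hom.hom_mult of_rat_poly_hom.hom_uminus of_rat_hom.map_poly_hom_smult
      map_poly_monom poly_monom)

text \<open>Since the constant term is not divisible by the square of \<open>p\<close>, one factor
  has a constant term prime to \<open>p\<close>. The first coefficient of the other factor that
  \<open>p\<close> does not divide then produces such a coefficient of the product at the same
  index. This index must be the degree of the product, so the other factor carries the whole
  degree.\<close>

lemma eisenstein: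
  fixes F H :: "int poly"
  assumes p: "Factorial_Ring.prime (p::int)" and lead: "\<not> p dvd lead_coeff (F * H)"
    and low: "\<And>i. i < degree (F * H) \<Longrightarrow> p dvd coeff (F * H) i"
    and const: "\<not> p * p dvd coeff (F * H) 0" and deg: "degree (F * H) > 0"
  shows "degree F = 0 \<or> degree H = 0"
proof -
  have main: "degree F' = degree (F' * H') " if "F' * H' = F * H" "\<not> p dvd coeff H' 0" for F' H' :: "int poly"
  proof -
    have nz: "F' \<noteq> 0" "H' \<noteq> 0" using deg that by auto
    have "\<not> p dvd lead_coeff F'" using lead that(1) by (metis dvd_mult2 lead_coeff_mult)
    define i where "i = (LEAST i. \<not> p dvd coeff F' i)"
    have i: "\<not> p dvd coeff F' i" unfolding i_def
      by (rule LeastI[of _ "degree F'"]) (fact \<open>\<not> p dvd lead_coeff F'\<close>)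
    have j: "p dvd coeff F' j" if "j < i" for j using not_less_Least that unfolding i_def by blast
    have "i \<le> degree F'" using i by (metis dvd_0_right le_degree)
    have "coeff (F' * H') i = (\<Sum>j\<le>i. coeff F' j * coeff H' (i - j))" by (rule coeff_mult)
    also have "\<dots> = (\<Sum>j<i. coeff F' j * coeff H' (i - j)) + coeff F' i * coeff H' 0"
      by (simp add: lessThan_Suc_atMost[symmetric])
    finally have eq: "coeff (F' * H') i = \<dots>" .
    have "p dvd (\<Sum>j<i. coeff F' j * coeff H' (i - j))" by (intro dvd_sum) (simp add: j)
    moreover have "\<not> p dvd coeff F' i * coeff H' 0"
      using i that(2) p by (simp add: prime_dvd_mult_iff)
    ultimately have "\<not> p dvd coeff (F' * H') i" unfolding eq by (simp add: dvd_add_right_iff)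
    hence "i \<ge> degree (F' * H')" using low that(1) by (metis not_less)
    moreover have "degree F' \<le> degree (F' * H')" using nz by (simp add: degree_mult_eq)
    ultimately show ?thesis using \<open>i \<le> degree F'\<close> by simp
  qed
  have nz: "F \<noteq> 0" "H \<noteq> 0" using deg by auto
  have "\<not> (p dvd coeff F 0 \<and> p dvd coeff H 0)"
    using const by (auto simp: coeff_mult_0 intro: mult_dvd_mono)
  thus ?thesis
    using main[of F H] main[of H F] nz by (auto simp: mult.commute degree_mult_eq)
qed

text \<open>For prime \<open>p\<close> this is the cyclotomic polynomial of order
  \<open>p ^ Suc k\<close>.\<close>

definition cyclo_poly :: "nat \<Rightarrow> nat \<Rightarrow> int poly" where
  "cyclo_poly p k = (\<Sum>j<p. monom 1 (j * p ^ k))"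

lemma cyclo_poly_mult: "cyclo_poly p k * (monom 1 (p ^ k) - 1) = monom 1 (p ^ Suc k) - 1"
proof -
  have "cyclo_poly p k = (\<Sum>j<p. monom 1 (p ^ k) ^ j)"
    by (simp add: cyclo_poly_def monom_power mult.commute)
  hence "(monom 1 (p ^ k) - 1) * cyclo_poly p k = monom 1 (p ^ k) ^ p - 1"
    by (simp only: power_diff_1_eq)
  thus ?thesis by (simp add: monom_power mult.commute)
qed

text \<open>Iteration of the Frobenius congruence. Divisibility by a constant polynomial expresses
  congruence of integer polynomials modulo \<open>p\<close>.\<close>

lemma freshman_poly:
  assumes "Factorial_Ring.prime p"
  shows "[:int p:] dvd [:1, 1:] ^ (p ^ k) - (monom 1 (p ^ k) + 1)"
proof (induction k)
  case (Suc k)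
  have frob: "[:int p:] dvd (x + y) ^ p - (x ^ p + y ^ p)" for x y :: "int poly"
  proof -
    have p: "p > 0" using assms prime_gt_0_nat by blast
    have "(x + y) ^ p = (\<Sum>j\<le>p. of_nat (p choose j) * x ^ j * y ^ (p - j))" by (rule binomial_ring)
    also have "{..p} = insert 0 (insert p {1..<p})" using p by auto
    also have "(\<Sum>j\<in>\<dots>. of_nat (p choose j) * x ^ j * y ^ (p - j)) =
        x ^ p + y ^ p + (\<Sum>j\<in>{1..<p}. of_nat (p choose j) * x ^ j * y ^ (p - j))"
      using p by simp
    finally have "(x + y) ^ p - (x ^ p + y ^ p) =
        (\<Sum>j\<in>{1..<p}. of_nat (p choose j) * x ^ j * y ^ (p - j))" by simp
    also have "[:int p:] dvd \<dots>"
    proof (intro dvd_sum dvd_mult2)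
      fix j assume "j \<in> {1..<p}"
      hence "p dvd (p choose j)" using assms by (intro dvd_choose_prime) auto
      hence "of_nat p dvd (of_nat (p choose j) :: int poly)" by (auto elim!: dvdE)
      thus "[:int p:] dvd (of_nat (p choose j) :: int poly)" by (simp add: of_nat_poly)
    qed
    finally show ?thesis .
  qed
  obtain h where h: "[:1, 1:] ^ (p ^ k) = (monom 1 (p ^ k) + 1) + [:int p:] * h"
    using Suc by (metis dvdE add_diff_cancel_left' diff_add_cancel add.commute)
  let ?m = "monom 1 (p ^ k) :: int poly"
  have "[:1, 1 :: int:] ^ (p ^ Suc k) = ([:1, 1:] ^ (p ^ k)) ^ p"
    by (simp add: power_mult[symmetric] mult.commute)
  hence X: "[:1, 1:] ^ (p ^ Suc k) = (?m + 1 + [:int p:] * h) ^ p"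
    by (simp only: h)
  \<comment> \<open>First the multiple of \<open>p\<close> is split off, then the two remaining
    terms are separated; each split is one application of \<open>frob\<close>.\<close>
  have "[:1, 1:] ^ (p ^ Suc k) - (?m ^ p + 1) =
      ((?m + 1 + [:int p:] * h) ^ p - ((?m + 1) ^ p + ([:int p:] * h) ^ p)) + ([:int p:] * h) ^ p +
      ((?m + 1) ^ p - (?m ^ p + 1 ^ p))"
    unfolding X by simp
  moreover have "[:int p:] dvd (?m + 1 + [:int p:] * h) ^ p - ((?m + 1) ^ p + ([:int p:] * h) ^ p)"
    by (rule frob)
  moreover have "[:int p:] dvd ([:int p:] * h) ^ p"
    using assms prime_gt_0_nat by (metis dvd_power dvd_triv_left dvd_trans)
  moreover have "[:int p:] dvd (?m + 1) ^ p - (?m ^ p + 1 ^ p)" by (rule frob)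
  ultimately have "[:int p:] dvd [:1, 1:] ^ (p ^ Suc k) - (?m ^ p + 1)"
    by (simp only: dvd_add)
  thus ?case by (simp add: monom_power mult.commute)
qed (simp add: monom_Suc monom_0 one_pCons)

lemma degree_cyclo_poly:
  assumes "p > 0"
  shows "degree (cyclo_poly p k) = (p - 1) * p ^ k" "lead_coeff (cyclo_poly p k) = 1"
proof -
  have c: "coeff (cyclo_poly p k) i = (\<Sum>j<p. if j * p ^ k = i then 1 else 0)" for i
    by (simp add: cyclo_poly_def coeff_sum)
  have "coeff (cyclo_poly p k) ((p - 1) * p ^ k) = (\<Sum>j<p. if j = p - 1 then 1 else 0)"
    unfolding c using assms by (intro sum.cong HOL.refl) auto
  also have "\<dots> = 1" using assms by simp
  finally have 1: "coeff (cyclo_poly p k) ((p - 1) * p ^ k) = 1" .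
  have "coeff (cyclo_poly p k) i = 0" if "i > (p - 1) * p ^ k" for i
    unfolding c
  proof (intro sum.neutral ballI)
    fix j assume "j \<in> {..<p}"
    hence "j * p ^ k \<le> (p - 1) * p ^ k" by (intro mult_right_mono) auto
    thus "(if j * p ^ k = i then 1 else 0) = (0::int)" using that by auto
  qed
  hence "degree (cyclo_poly p k) \<le> (p - 1) * p ^ k" by (intro degree_le) auto
  moreover have "degree (cyclo_poly p k) \<ge> (p - 1) * p ^ k" by (rule le_degree) (use 1 in simp)
  ultimately show d: "degree (cyclo_poly p k) = (p - 1) * p ^ k" by simp
  thus "lead_coeff (cyclo_poly p k) = 1" using 1 by simp
qed

text \<open>At X + 1 the identity \<open>cyclo_poly_mult\<close> reduces modulo \<open>p\<close> to
  \<open>?\<Psi> * X ^ (p ^ k) = X ^ (p ^ Suc k)\<close>. Cancelling the monomial leaves the top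
  term only.\<close>

lemma cyclo_poly_shift_dvd:
  assumes "Factorial_Ring.prime p"
  shows "[:int p:] dvd pcompose (cyclo_poly p k) [:1, 1:] - monom 1 ((p - 1) * p ^ k)"
proof -
  let ?\<Psi> = "pcompose (cyclo_poly p k) [:1, 1:]"
  let ?m = "\<lambda>n. monom 1 n :: int poly"
  have mon: "pcompose (?m n) [:1, 1:] = [:1, 1:] ^ n" for n
    by (induction n) (simp_all add: monom_Suc pcompose_pCons pcompose_mult monom_0 one_pCons[symmetric])
  have p0: "p > 0" using assms prime_gt_0_nat by blast
  have "?\<Psi> * ([:1, 1:] ^ (p ^ k) - 1) = [:1, 1:] ^ (p ^ Suc k) - 1"
    using arg_cong[OF cyclo_poly_mult[of p k], of "\<lambda>q. pcompose q [:1, 1:]"]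
    by (simp only: pcompose_mult pcompose_diff mon pcompose_1)
  moreover obtain h where h: "[:1, 1:] ^ (p ^ k) - (?m (p ^ k) + 1) = [:int p:] * h"
    using freshman_poly[OF assms, of k] by (elim dvdE)
  hence "[:1, 1:] ^ (p ^ k) - 1 = ?m (p ^ k) + [:int p:] * h"
    by (simp only: diff_eq_eq add_ac)
  moreover obtain h' where "[:1, 1:] ^ (p ^ Suc k) - (?m (p ^ Suc k) + 1) = [:int p:] * h'"
    using freshman_poly[OF assms, of "Suc k"] by (elim dvdE)
  hence "[:1, 1:] ^ (p ^ Suc k) - 1 = ?m (p ^ Suc k) + [:int p:] * h'"
    by (simp only: diff_eq_eq add_ac)
  ultimately have 1: "?\<Psi> * (?m (p ^ k) + [:int p:] * h) = ?m (p ^ Suc k) + [:int p:] * h'"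
    by simp
  have "p ^ Suc k = p ^ k + (p - 1) * p ^ k" using p0 by (cases p) auto
  hence 2: "?m (p ^ Suc k) = ?m (p ^ k) * ?m ((p - 1) * p ^ k)"
    by (simp add: mult_monom)
  have "?m (p ^ k) * (?\<Psi> - ?m ((p - 1) * p ^ k)) = ?\<Psi> * (?m (p ^ k) + [:int p:] * h)
      - [:int p:] * (?\<Psi> * h) - ?m (p ^ k) * ?m ((p - 1) * p ^ k)"
    by (simp only: algebra_simps)
  also have "\<dots> = [:int p:] * (h' - ?\<Psi> * h)"
    unfolding 1 2[symmetric] by (simp only: algebra_simps)
  finally have "?m (p ^ k) * (?\<Psi> - ?m ((p - 1) * p ^ k)) = [:int p:] * (h' - ?\<Psi> * h)" .
  hence "[:int p:] dvd ?m (p ^ k) * (?\<Psi> - ?m ((p - 1) * p ^ k))" by (metis dvd_triv_left)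
  \<comment> \<open>The monomial is cancelled modulo \<open>p\<close> by reading off coefficients
    shifted by \<open>p ^ k\<close>.\<close>
  hence "int p dvd coeff (?m (p ^ k) * (?\<Psi> - ?m ((p - 1) * p ^ k))) (p ^ k + i)" for i
    by (simp add: const_poly_dvd_iff)
  hence "int p dvd coeff (?\<Psi> - ?m ((p - 1) * p ^ k)) i" for i
    by (simp add: coeff_monom_mult)
  thus ?thesis by (simp add: const_poly_dvd_iff)
qed

text \<open>Eisenstein's criterion after the substitution X + 1: modulo \<open>p\<close> only the
  leading term remains, and the constant term is the value at 1, which is \<open>p\<close>.\<close>

lemma cyclo_poly_irreducible:
  assumes "Factorial_Ring.prime p" "F * H = cyclo_poly p k"
  shows "degree F = 0 \<or> degree H = 0"
proof -
  let ?s = "\<lambda>q :: int poly. pcompose q [:1, 1:]"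
  have p: "p > 1" using assms prime_gt_1_nat by blast
  have eq: "?s F * ?s H = ?s (cyclo_poly p k)"
    using assms(2) by (simp flip: pcompose_mult)
  have deg: "degree (?s (cyclo_poly p k)) = (p - 1) * p ^ k"
    using degree_cyclo_poly[of p k] p by (simp add: degree_pcompose)
  have "lead_coeff (?s (cyclo_poly p k)) = 1"
    using degree_cyclo_poly[of p k] p by (subst lead_coeff_comp) auto
  moreover have "coeff (?s (cyclo_poly p k)) 0 = int p"
    by (simp add: coeff_pcompose_0 cyclo_poly_def poly_sum poly_monom)
  moreover have "int p dvd coeff (?s (cyclo_poly p k)) i" if "i < (p - 1) * p ^ k" for i
    using cyclo_poly_shift_dvd[OF assms(1), of k] that
    by (auto simp: const_poly_dvd_iff dest!: spec[of _ i])
  ultimately have "degree (?s F) = 0 \<or> degree (?s H) = 0"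
    using p assms(1)
    by (intro eisenstein[of "int p"]) (simp_all add: eq deg degree_cyclo_poly(1))
  thus ?thesis by (simp add: degree_pcompose)
qed

section \<open>Galois conjugation of vanishing sums of roots of unity\<close>

lemma eval_cyclo_poly:
  fixes z :: complex
  assumes "z ^ (p ^ Suc k) = 1" "z ^ (p ^ k) \<noteq> 1"
  shows "eval_poly of_int (cyclo_poly p k) z = 0"
proof -
  have "eval_poly of_int (cyclo_poly p k * (monom 1 (p ^ k) - 1)) z =
      eval_poly of_int (monom 1 (p ^ Suc k) - 1) z"
    by (simp only: cyclo_poly_mult)
  hence "eval_poly of_int (cyclo_poly p k) z * (z ^ (p ^ k) - 1) = z ^ (p ^ Suc k) - 1"
    by (simp only: eval_int_poly eval_int_poly eval_int_poly
        eval_int_poly of_int_1 mult_1_left)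
  thus ?thesis using assms by simp
qed

lemma primitive_root_power:
  fixes z :: complex
  assumes "z ^ (p ^ Suc k) = 1" "z ^ (p ^ k) \<noteq> 1" "Factorial_Ring.prime p" "\<not> p dvd r"
  shows "(z ^ r) ^ (p ^ Suc k) = 1" "(z ^ r) ^ (p ^ k) \<noteq> 1"
proof -
  show "(z ^ r) ^ (p ^ Suc k) = 1" using assms by (metis mult.commute power_mult power_one)
  show "(z ^ r) ^ (p ^ k) \<noteq> 1"
  proof
    assume 1: "(z ^ r) ^ (p ^ k) = 1"
    have "coprime r p" using assms by (metis coprime_commute prime_imp_coprime)
    moreover have "r > 0" using assms(4) by (intro Nat.gr0I) auto
    ultimately obtain a b where ab: "r * a = p * b + 1"
      using bezout_nat[of r p] by (auto simp: coprime_iff_gcd_eq_1)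
    have "z ^ (p ^ k) = (z ^ (p ^ k)) ^ (r * a) / ((z ^ (p ^ k)) ^ p) ^ b"
      using assms by (simp add: ab power_add power_mult flip: power_Suc2)
    also have "(z ^ (p ^ k)) ^ (r * a) = ((z ^ r) ^ (p ^ k)) ^ a"
      by (simp add: mult_ac flip: power_mult)
    also have "(z ^ (p ^ k)) ^ p = 1" using assms(1) by (simp add: mult.commute flip: power_mult)
    finally show False using 1 assms by simp
  qed
qed

text \<open>Let \<open>F0\<close> be a primitive integer polynomial of least degree that vanishes at
  \<open>z\<close>. By pseudo-division it divides a nonzero constant multiple of every polynomial
  vanishing at \<open>z\<close>, and by irreducibility the cyclotomic polynomial is a constant
  multiple of \<open>F0\<close>. So \<open>F0\<close> vanishes at \<open>z ^ r\<close> as well, and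
  \<open>F\<close> inherits this zero.\<close>

theorem galois_conjugate_zero_int:
  fixes z :: complex and F :: "int poly"
  assumes p: "Factorial_Ring.prime p" and z: "z ^ (p ^ Suc k) = 1" "z ^ (p ^ k) \<noteq> 1"
    and F: "eval_poly of_int F z = 0" and r: "\<not> p dvd r"
  shows "eval_poly of_int F (z ^ r) = 0"
proof -
  let ?P = "\<lambda>F :: int poly. F \<noteq> 0 \<and> eval_poly of_int F z = 0"
  have p0: "p > 0" using p prime_gt_0_nat by blast
  have cp: "?P (cyclo_poly p k)"
    using eval_cyclo_poly[OF z] degree_cyclo_poly(2)[OF p0, of k] by auto
  define F1 where "F1 = arg_min degree ?P"
  have F1: "?P F1" and min1: "\<And>H. ?P H \<Longrightarrow> degree F1 \<le> degree H"
    unfolding F1_def using arg_min_nat_lemma[of ?P "cyclo_poly p k" degree] cp by blast+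
  define F0 where "F0 = primitive_part F1"
  have "of_int (content F1) * eval_poly of_int F0 z = 0"
    using F1 by (simp only: eval_int_poly(5)[symmetric] F0_def content_times_primitive_part)
  hence F0: "?P F0" "content F0 = 1" using F1
    by (auto simp: F0_def)
  have min: "degree F0 \<le> degree H" if "?P H" for H using min1[OF that] by (simp add: F0_def)
  have div: "\<exists>a q. a \<noteq> 0 \<and> smult a H = F0 * q" if "eval_poly of_int H z = 0" for H :: "int poly"
  proof -
    obtain a q where aq: "a \<noteq> 0" "smult a H = F0 * q + pseudo_mod H F0"
      using pseudo_mod(1)[of F0 H] F0 by auto
    have "eval_poly of_int (smult a H) z = eval_poly of_int (F0 * q + pseudo_mod H F0) z"
      by (simp add: aq)
    hence "eval_poly of_int (pseudo_mod H F0) z = 0"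
      using that F0 by (simp add: eval_int_poly eval_int_poly eval_int_poly)
    hence "pseudo_mod H F0 = 0"
      using pseudo_mod(2)[of F0 H] F0 min[of "pseudo_mod H F0"] by auto
    thus ?thesis using aq by auto
  qed
  obtain a q where aq: "a \<noteq> 0" "smult a (cyclo_poly p k) = F0 * q"
    using div eval_cyclo_poly[OF z] by blast
  \<comment> \<open>Gauss's lemma: \<open>F0\<close> and the cyclotomic polynomial both have content
    1, so the constant \<open>a\<close> divides \<open>q\<close> and the factorisation takes place
    over the integers.\<close>
  have "content (cyclo_poly p k) dvd 1"
    using content_dvd_coeff[of "cyclo_poly p k" "degree (cyclo_poly p k)"]
    unfolding degree_cyclo_poly(2)[OF p0, of k] .
  hence "content (cyclo_poly p k) = 1" by (rule is_unit_content_iff[THEN iffD1])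
  hence "content q = normalize a"
    using arg_cong[OF aq(2), of content] F0 by (simp add: content_mult)
  hence "a dvd content q" by simp
  then obtain q' where q': "q = smult a q'"
    by (auto simp: const_poly_dvd_iff_dvd_content[symmetric] elim!: dvdE)
  have "smult a (cyclo_poly p k) = smult a (F0 * q')" using aq q' by simp
  hence fac: "F0 * q' = cyclo_poly p k" using aq(1) by (metis smult_cancel)
  have "degree F0 \<noteq> 0"
  proof
    assume "degree F0 = 0"
    then obtain c where c: "F0 = [:c:]" by (metis degree_eq_zeroE)
    thus False using F0 by (simp add: eval_poly_def)
  qed
  hence "degree q' = 0" using cyclo_poly_irreducible[OF p fac] by simp
  then obtain c where c: "q' = [:c:]" by (metis degree_eq_zeroE)
  have "c \<noteq> 0" using fac c cp by auto
  have "eval_poly of_int (F0 * q') (z ^ r) = 0"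
    unfolding fac by (rule eval_cyclo_poly) (use primitive_root_power[OF z p r] in auto)
  hence F0r: "eval_poly of_int F0 (z ^ r) = 0"
    using \<open>c \<noteq> 0\<close> c by (simp add: eval_int_poly)
  obtain a' q'' where aq': "a' \<noteq> 0" "smult a' F = F0 * q''" using div[OF F] by blast
  have "eval_poly of_int (smult a' F) (z ^ r) = 0"
    unfolding aq' using F0r by (simp add: eval_int_poly)
  thus ?thesis using aq'(1) by (simp add: eval_int_poly)
qed

lemma common_denominator:
  fixes c :: "'i \<Rightarrow> rat"
  assumes "finite I"
  obtains N :: int and m where "N > 0" "\<And>i. i \<in> I \<Longrightarrow> of_int N * c i = of_int (m i)"
proof -
  have "\<exists>N::int. N > 0 \<and> (\<forall>i\<in>I. \<exists>m. of_int N * c i = of_int m)"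
    using assms
  proof induction
    case (insert i I)
    then obtain N :: int where N: "N > 0" "\<forall>i\<in>I. \<exists>m. of_int N * c i = of_int m" by auto
    obtain a b where ab: "c i = of_int a / of_int b" "b > 0"
      by (metis quotient_of_div quotient_of_denom_pos surj_pair)
    have "\<exists>m. of_int (b * N) * c j = of_int m" if j: "j \<in> insert i I" for j
    proof (cases "j = i")
      case True
      thus ?thesis using ab by (intro exI[of _ "a * N"]) simp
    next
      case False
      then obtain m where "of_int N * c j = of_int m" using j N by auto
      thus ?thesis by (intro exI[of _ "b * m"]) (simp add: mult.assoc)
    qed
    thus ?case using N(1) ab(2) by (intro exI[of _ "b * N"]) simp
  qed (auto intro: exI[of _ 1])
  thus ?thesis using that by metis
qed

text \<open>This is the substitute for the Galois automorphism that sends \<open>z\<close> to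
  \<open>z ^ r\<close>: it transports vanishing rational combinations of powers of \<open>z\<close>,
  with denominators cleared first.\<close>

theorem galois_conjugate_zero:
  fixes z :: complex and c :: "'i \<Rightarrow> rat"
  assumes p: "Factorial_Ring.prime p" and z: "z ^ (p ^ Suc k) = 1" "z ^ (p ^ k) \<noteq> 1"
    and fin: "finite I" and 0: "(\<Sum>i\<in>I. of_rat (c i) * z ^ n i) = 0" and r: "\<not> p dvd r"
  shows "(\<Sum>i\<in>I. of_rat (c i) * (z ^ r) ^ n i) = 0"
proof -
  obtain N m where N: "N > 0" "\<And>i. i \<in> I \<Longrightarrow> of_int N * c i = of_int (m i)"
    using common_denominator[OF fin, of c] by blast
  define F where "F = (\<Sum>i\<in>I. monom (m i) (n i))"
  have ev: "eval_poly of_int F w = of_int N * (\<Sum>i\<in>I. of_rat (c i) * w ^ n i)" for w :: complex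
  proof -
    have "of_int (m i) = of_int N * (of_rat (c i) :: complex)" if "i \<in> I" for i
      using arg_cong[OF N(2)[OF that], of "of_rat :: rat \<Rightarrow> complex"] by (simp add: of_rat_mult)
    thus ?thesis unfolding F_def
      by (simp add: of_int_hom.eval_poly_sum eval_int_poly sum_distrib_left mult.assoc)
  qed
  have "eval_poly of_int F (z ^ r) = 0"
    by (rule galois_conjugate_zero_int[OF p z _ r]) (simp add: ev 0)
  thus ?thesis using N(1) by (simp add: ev)
qed

text \<open>If two of these powers agree, Bezout shows that the order of \<open>z\<close> divides
  the gcd of \<open>p ^ Suc k\<close> and a smaller positive number. This gcd is a lower power of
  \<open>p\<close>, which forces \<open>z ^ (p ^ k) = 1\<close>.\<close>

lemma primitive_root_inj:
  fixes z :: complex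
  assumes p: "Factorial_Ring.prime p" and z: "z ^ (p ^ Suc k) = 1" "z ^ (p ^ k) \<noteq> 1"
  shows "inj_on (\<lambda>n. z ^ n) {..<p ^ Suc k}"
proof -
  let ?d = "p ^ Suc k"
  have p0: "p > 0" using p prime_gt_0_nat by blast
  have z0: "z \<noteq> 0" using z p0 by (metis power_eq_0_iff zero_less_power zero_neq_one power_0_left not_gr0)
  show ?thesis
  proof (rule linorder_inj_onI')
    fix i j assume ij: "i \<in> {..<?d}" "j \<in> {..<?d}" "i < j"
    show "z ^ i \<noteq> z ^ j"
    proof
      assume "z ^ i = z ^ j"
      hence 1: "z ^ (j - i) = 1" using z0 ij by (simp add: power_diff)
      have "j - i > 0" "j - i < ?d" using ij by auto
      have "gcd (j - i) ?d dvd ?d" by simp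
      then obtain l where l: "l \<le> Suc k" "gcd (j - i) ?d = p ^ l"
        using divides_primepow_nat[OF p] by blast
      have "l \<noteq> Suc k" using l \<open>j - i > 0\<close> \<open>j - i < ?d\<close>
        by (metis gcd_le1_nat leD not_gr0)
      hence "p ^ l dvd p ^ k" using l by (intro le_imp_power_dvd) simp
      moreover obtain a b where "(j - i) * a = ?d * b + gcd (j - i) ?d"
        using bezout_nat[of "j - i" ?d] \<open>j - i > 0\<close> by auto
      hence "z ^ ((j - i) * a) = z ^ (?d * b + p ^ l)" using l by simp
      hence "z ^ (p ^ l) = 1" using 1 z by (simp only: power_add power_mult) simp
      ultimately have "z ^ (p ^ k) = 1" by (metis dvdE power_mult power_one)
      thus False using z by simp
    qed
  qed
qed

lemma primitive_root_cyclic: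
  fixes z w :: complex
  assumes p: "Factorial_Ring.prime p" and z: "z ^ (p ^ Suc k) = 1" "z ^ (p ^ k) \<noteq> 1"
    and w: "w ^ (p ^ Suc k) = 1"
  shows "\<exists>n. w = z ^ n"
proof -
  let ?d = "p ^ Suc k"
  have p0: "p > 0" using p prime_gt_0_nat by blast
  have inj: "inj_on (\<lambda>n. z ^ n) {..<?d}" by (rule primitive_root_inj[OF p z])
  have fin: "finite {w. w ^ ?d = (1::complex)}" using p0 by (intro finite_roots_unity) auto
  have "(\<lambda>n. z ^ n) ` {..<?d} = {w. w ^ ?d = 1}"
  proof (rule card_subset_eq[OF fin])
    have "(z ^ n) ^ ?d = 1" for n using z by (metis mult.commute power_mult power_one)
    thus "(\<lambda>n. z ^ n) ` {..<?d} \<subseteq> {w. w ^ ?d = 1}" by blast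
    show "card ((\<lambda>n. z ^ n) ` {..<?d}) = card {w. w ^ ?d = (1::complex)}"
      using card_image[OF inj] card_roots_unity_eq[of ?d] p0 by simp
  qed
  thus ?thesis using w by blast
qed

lemma sum_roots_period:
  fixes z :: complex
  assumes "z ^ n = 1" "n > 0"
  shows "(\<Sum>r<n. z ^ r) \<in> \<rat>"
proof (cases "z = 1")
  case False
  have "(\<Sum>r<n. z ^ r) = 0" using geometric_sum[OF False, of n] assms by simp
  thus ?thesis by simp
qed auto

text \<open>Representatives of the units modulo \<open>p ^ Suc k\<close>, that is, of the Galois
  group. Indexing by \<open>Suc k\<close> leaves out the order 1, at which no character is
  nontrivial.\<close>

definition units_below :: "nat \<Rightarrow> nat \<Rightarrow> nat set" where
  "units_below p k = {r. r < p ^ Suc k \<and> \<not> p dvd r}"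

text \<open>The sum over all residues minus the sum over the multiples of \<open>p\<close>. Both are
  geometric sums over a full period, hence 0 or the number of their terms.\<close>

lemma ramanujan_rational:
  fixes z :: complex
  assumes "z ^ (p ^ Suc k) = 1" "p > 0"
  shows "(\<Sum>r\<in>units_below p k. z ^ r) \<in> \<rat>"
proof -
  have "{..<p ^ Suc k} = units_below p k \<union> (\<lambda>s. p * s) ` {..<p ^ k}"
    using assms(2) by (auto simp: units_below_def)
  moreover have "units_below p k \<inter> (\<lambda>s. p * s) ` {..<p ^ k} = {}" by (auto simp: units_below_def)
  moreover have "finite (units_below p k)" by (simp add: units_below_def)
  ultimately have "(\<Sum>r<p ^ Suc k. z ^ r) = (\<Sum>r\<in>units_below p k. z ^ r) + (\<Sum>r\<in>(\<lambda>s. p * s) ` {..<p ^ k}. z ^ r)"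
    by (simp add: sum.union_disjoint)
  also have "(\<Sum>r\<in>(\<lambda>s. p * s) ` {..<p ^ k}. z ^ r) = (\<Sum>s<p ^ k. (z ^ p) ^ s)"
    using assms(2) by (subst sum.reindex) (auto simp: inj_on_def power_mult)
  finally have "(\<Sum>r\<in>units_below p k. z ^ r) = (\<Sum>r<p ^ Suc k. z ^ r) - (\<Sum>s<p ^ k. (z ^ p) ^ s)"
    by simp
  moreover have "(\<Sum>r<p ^ Suc k. z ^ r) \<in> \<rat>" using assms by (intro sum_roots_period) auto
  moreover have "(\<Sum>s<p ^ k. (z ^ p) ^ s) \<in> \<rat>"
    using assms by (intro sum_roots_period) (auto simp flip: power_mult)
  ultimately show ?thesis by simp
qed

section \<open>The cyclotomic field as the set of values of rational polynomials\<close>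

lemma complex_ring_simps:
  "carrier complex_ring = UNIV" "x \<otimes>\<^bsub>complex_ring\<^esub> y = x * y" "\<one>\<^bsub>complex_ring\<^esub> = 1"
  "\<zero>\<^bsub>complex_ring\<^esub> = 0" "x \<oplus>\<^bsub>complex_ring\<^esub> y = x + y"
  by (simp_all add: complex_ring_def)

lemma field_complex_ring: "Ring.field complex_ring"
proof (rule Ring.cring.cring_fieldI2)
  show "Ring.cring complex_ring"
    by (rule cringI, rule abelian_groupI, goal_cases)
      (auto simp: complex_ring_simps algebra_simps intro!: comm_monoidI exI[of _ "- _"] 
        intro: exI[of _ "-x" for x])
next
  show "\<zero>\<^bsub>complex_ring\<^esub> \<noteq> \<one>\<^bsub>complex_ring\<^esub>" by (simp add: complex_ring_simps)
next
  fix a assume "a \<in> carrier complex_ring" "a \<noteq> \<zero>\<^bsub>complex_ring\<^esub>"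
  thus "\<exists>b\<in>carrier complex_ring. a \<otimes>\<^bsub>complex_ring\<^esub> b = \<one>\<^bsub>complex_ring\<^esub>"
    by (intro bexI[of _ "inverse a"]) (auto simp: complex_ring_simps)
qed

lemma complex_ring_inverse:
  "\<ominus>\<^bsub>complex_ring\<^esub> x = - x" "x \<noteq> 0 \<Longrightarrow> inv\<^bsub>complex_ring\<^esub> x = inverse x"
proof -
  interpret C: Ring.field complex_ring by (rule field_complex_ring)
  show "\<ominus>\<^bsub>complex_ring\<^esub> x = - x"
    by (rule C.minus_equality) (auto simp: complex_ring_simps)
  show "inv\<^bsub>complex_ring\<^esub> x = inverse x" if "x \<noteq> 0"
    using that by (intro C.comm_inv_char) (auto simp: complex_ring_simps)
qed

text \<open>A nonzero value \<open>F(z)\<close> is inverted by a Bezout relation between \<open>F\<close> and a rational polynomial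
  of least degree vanishing at \<open>z\<close>.\<close>

lemma rat_poly_value_inverse:
  fixes z :: complex and F :: "rat poly"
  assumes P: "P0 \<noteq> 0" "eval_poly of_rat P0 z = 0" and F: "eval_poly of_rat F z \<noteq> 0"
  shows "\<exists>H :: rat poly. inverse (eval_poly of_rat F z) = eval_poly of_rat H z"
proof -
  let ?P = "\<lambda>F :: rat poly. F \<noteq> 0 \<and> eval_poly of_rat F z = 0"
  define P where "P = arg_min degree ?P"
  have P1: "?P P" and min: "\<And>H. ?P H \<Longrightarrow> degree P \<le> degree H"
    unfolding P_def using arg_min_nat_lemma[of ?P P0 degree] P by blast+
  define g where "g = gcd F P"
  obtain K where K: "P = g * K" unfolding g_def by (metis dvdE gcd_dvd2)
  obtain L where L: "F = g * L" unfolding g_def by (metis dvdE gcd_dvd1)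
  have g0: "eval_poly of_rat g z \<noteq> 0"
    using F unfolding L by (simp add: eval_rat_poly)
  \<comment> \<open>The common divisor \<open>g\<close> does not vanish at \<open>z\<close>, so its
    cofactor \<open>K\<close> does; minimality of \<open>P\<close> then makes \<open>g\<close>
    constant.\<close>
  have "eval_poly of_rat g z * eval_poly of_rat K z = 0"
    using P1 K by (metis eval_rat_poly)
  hence "?P K" using g0 K P1 by auto
  hence "degree P \<le> degree K" by (rule min)
  moreover have "degree P = degree g + degree K" using K P1 by (metis degree_mult_eq mult_eq_0_iff)
  ultimately have "degree g = 0" by simp
  then obtain e where e: "g = [:e:]" by (metis degree_eq_zeroE)
  obtain u v where uv: "u * F + v * P = g" unfolding g_def by (metis bezout_coefficients_fst_snd)
  have "eval_poly of_rat u z * eval_poly of_rat F z = of_rat e"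
    using arg_cong[OF uv, of "\<lambda>q. eval_poly of_rat q z"] P1 e
    by (simp only: eval_rat_poly) (cases "e = 0"; simp add: eval_poly_def map_poly_pCons)
  moreover have "e \<noteq> 0" using e g0 by auto
  ultimately have "inverse (eval_poly of_rat F z) = eval_poly of_rat (smult (inverse e) u) z"
    using F by (simp add: eval_rat_poly of_rat_divide field_simps)
  thus ?thesis by blast
qed

text \<open>The values of rational polynomials at the root of unity are already closed under
  inverses, with X^d - 1 as the annihilating polynomial.\<close>

lemma cyclotomic_field_poly:
  assumes "x \<in> cyclotomic_field d" "d > 0"
  shows "\<exists>F :: rat poly. x = eval_poly of_rat F (cis (2 * pi / real d))"
  using assms(1) unfolding cyclotomic_field_def
proof (induction rule: generate_field.induct)
  case one
  show ?case by (intro exI[of _ 1]) (simp add: complex_ring_simps eval_rat_poly)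
next
  case (incl h)
  thus ?case by (intro exI[of _ "monom 1 1"]) (simp add: eval_rat_poly)
next
  case (a_inv h)
  then obtain F :: "rat poly" where "h = eval_poly of_rat F (cis (2 * pi / real d))" by blast
  thus ?case by (intro exI[of _ "- F"]) (simp add: complex_ring_inverse eval_rat_poly)
next
  case (m_inv h)
  then obtain F :: "rat poly" where F: "h = eval_poly of_rat F (cis (2 * pi / real d))" by blast
  let ?P = "monom 1 d - 1 :: rat poly"
  have "coeff ?P d \<noteq> 0" using assms(2) by simp
  hence "?P \<noteq> 0" by (metis coeff_0)
  moreover have "eval_poly of_rat ?P (cis (2 * pi / real d)) = 0"
    using assms(2) by (simp add: eval_rat_poly eval_rat_poly DeMoivre)
  moreover have "h \<noteq> 0" using m_inv by (simp add: complex_ring_simps)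
  ultimately show ?case using rat_poly_value_inverse[of ?P "cis (2 * pi / real d)" F] F
    by (simp add: complex_ring_inverse)
next
  case (eng_add h1 h2)
  then obtain F H :: "rat poly" where "h1 = eval_poly of_rat F (cis (2 * pi / real d))"
    "h2 = eval_poly of_rat H (cis (2 * pi / real d))" by blast
  thus ?case by (intro exI[of _ "F + H"]) (simp add: complex_ring_simps eval_rat_poly)
next
  case (eng_mult h1 h2)
  then obtain F H :: "rat poly" where "h1 = eval_poly of_rat F (cis (2 * pi / real d))"
    "h2 = eval_poly of_rat H (cis (2 * pi / real d))" by blast
  thus ?case by (intro exI[of _ "F * H"]) (simp add: complex_ring_simps eval_rat_poly)
qed

lemma cyclotomic_field_closed:
  shows "x \<in> cyclotomic_field d \<Longrightarrow> y \<in> cyclotomic_field d \<Longrightarrow> x + y \<in> cyclotomic_field d"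
    and "x \<in> cyclotomic_field d \<Longrightarrow> y \<in> cyclotomic_field d \<Longrightarrow> x * y \<in> cyclotomic_field d"
    and "1 \<in> cyclotomic_field d" and "0 \<in> cyclotomic_field d"
    and "cis (2 * pi / real d) ^ n \<in> cyclotomic_field d"
    and "of_rat q \<in> cyclotomic_field d"
proof -
  interpret C: Ring.field complex_ring by (rule field_complex_ring)
  let ?K = "cyclotomic_field d"
  show add: "x + y \<in> ?K" if "x \<in> ?K" "y \<in> ?K" for x y
    using generate_field.eng_add[of x complex_ring _ y] that
    by (simp add: cyclotomic_field_def complex_ring_simps)
  show mult: "x * y \<in> ?K" if "x \<in> ?K" "y \<in> ?K" for x y
    using generate_field.eng_mult[of x complex_ring _ y] that
    by (simp add: cyclotomic_field_def complex_ring_simps)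
  show one: "1 \<in> ?K" using generate_field.one[of complex_ring]
    by (simp add: cyclotomic_field_def complex_ring_simps)
  have uminus: "- x \<in> ?K" if "x \<in> ?K" for x
    using generate_field.a_inv[of x complex_ring] that
    by (simp add: cyclotomic_field_def complex_ring_inverse)
  have inv: "inverse x \<in> ?K" if "x \<in> ?K" "x \<noteq> 0" for x
    using generate_field.m_inv[of x complex_ring] that
    by (simp add: cyclotomic_field_def complex_ring_inverse complex_ring_simps)
  show zero: "0 \<in> ?K" using add[OF one uminus[OF one]] by simp
  have z: "cis (2 * pi / real d) \<in> ?K" by (simp add: cyclotomic_field_def generate_field.incl)
  show "cis (2 * pi / real d) ^ n \<in> ?K" by (induction n) (auto intro: one mult z)
  have nat: "of_nat n \<in> ?K" for n by (induction n) (auto intro: zero one add)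
  have int: "of_int n \<in> ?K" for n
    by (cases n rule: int_cases2) (auto intro: nat uminus)
  obtain a b where ab: "q = of_int a / of_int b" "b > 0"
    by (metis quotient_of_div quotient_of_denom_pos surj_pair)
  have "of_rat q = of_int a * inverse (of_int b :: complex)"
    by (simp add: ab of_rat_mult of_rat_inverse divide_inverse)
  thus "of_rat q \<in> ?K" using int[of a] int[of b] inv[of "of_int b"] mult ab(2) by simp
qed

section \<open>Presented groups\<close>

lemma presentation_eq_words:
  "presentation_eq S R u v \<Longrightarrow> u \<in> words S \<and> v \<in> words S"
  by (induction rule: presentation_eq.induct) auto

lemma presentation_eq_append:
  assumes "presentation_eq S R u v" "x \<in> words S" "y \<in> words S"
  shows "presentation_eq S R (x @ u @ y) (x @ v @ y)"
  using assms
proof (induction rule: presentation_eq.induct)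
  case (refl w)
  thus ?case by (intro presentation_eq.refl) auto
next
  case (cancel u v a b)
  thus ?case using presentation_eq.cancel[of "x @ u" S "v @ y" a R b] by simp
next
  case (relator u v r)
  thus ?case using presentation_eq.relator[of "x @ u" S "v @ y" r R] by simp
qed (auto intro: presentation_eq.intros)

definition word_class :: "'a set \<Rightarrow> 'a word set \<Rightarrow> 'a word \<Rightarrow> 'a word set" where
  "word_class S R u = {w. presentation_eq S R u w}"

lemma word_class_eqI: "presentation_eq S R u v \<Longrightarrow> word_class S R u = word_class S R v"
  by (auto simp: word_class_def intro: presentation_eq.trans presentation_eq.sym)

lemma word_class_eqD:
  assumes "word_class S R u = word_class S R v" "v \<in> words S"
  shows "presentation_eq S R u v"
proof -
  have "v \<in> word_class S R v" using assms by (simp add: word_class_def presentation_eq.refl)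
  thus ?thesis using assms by (auto simp: word_class_def)
qed

lemma carrier_presented_group: "carrier (presented_group S R) = word_class S R ` words S"
  by (auto simp: presented_group_def quotient_def word_class_def)

lemma one_presented_group: "\<one>\<^bsub>presented_group S R\<^esub> = word_class S R []"
  by (simp add: presented_group_def word_class_def)

lemma mult_presented_group:
  assumes "u \<in> words S" "v \<in> words S"
  shows "word_class S R u \<otimes>\<^bsub>presented_group S R\<^esub> word_class S R v = word_class S R (u @ v)"
proof -
  have "presentation_eq S R (u @ v) w"
    if "presentation_eq S R u u'" "presentation_eq S R v v'" "presentation_eq S R (u' @ v') w" for u' v' w
  proof -
    have "presentation_eq S R ([] @ u @ v) ([] @ u' @ v)"
      using that assms by (intro presentation_eq_append) auto
    moreover have "presentation_eq S R (u' @ v @ []) (u' @ v' @ [])"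
      using that presentation_eq_words[OF that(1)] by (intro presentation_eq_append) auto
    ultimately show ?thesis using that(3) by (auto intro: presentation_eq.trans)
  qed
  thus ?thesis using assms
    by (auto simp: presented_group_def word_class_def intro: presentation_eq.refl)
qed

lemma inv_word_words: "u \<in> words S \<Longrightarrow> inv_word u \<in> words S"
  by (auto simp: inv_word_def)

lemma inv_word_left:
  assumes "u \<in> words S"
  shows "presentation_eq S R (inv_word u @ u) []"
  using assms
proof (induction u)
  case Nil
  thus ?case by (auto simp: inv_word_def intro: presentation_eq.refl)
next
  case (Cons l u)
  obtain x b where l: "l = (x, b)" by (cases l)
  have "presentation_eq S R (inv_word u @ [(x, \<not> b), (x, \<not> \<not> b)] @ u) (inv_word u @ u)"
    using Cons l by (intro presentation_eq.cancel inv_word_words) auto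
  thus ?case using Cons l by (auto simp: inv_word_def intro: presentation_eq.trans)
qed

lemma group_presented_group: "group (presented_group S R)"
proof (rule groupI)
  fix x y z
  assume "x \<in> carrier (presented_group S R)" "y \<in> carrier (presented_group S R)"
    "z \<in> carrier (presented_group S R)"
  then obtain u v w where uvw: "u \<in> words S" "x = word_class S R u" "v \<in> words S" "y = word_class S R v"
    "w \<in> words S" "z = word_class S R w" by (auto simp: carrier_presented_group simp del: in_lists_conv_set)
  have app: "u @ v \<in> words S" "v @ w \<in> words S" using uvw by auto
  show "x \<otimes>\<^bsub>presented_group S R\<^esub> y \<otimes>\<^bsub>presented_group S R\<^esub> z =
      x \<otimes>\<^bsub>presented_group S R\<^esub> (y \<otimes>\<^bsub>presented_group S R\<^esub> z)"
    using uvw app by (simp add: mult_presented_group del: in_lists_conv_set append_in_lists_conv)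
next
  fix x y
  assume "x \<in> carrier (presented_group S R)" "y \<in> carrier (presented_group S R)"
  then obtain u v where uv: "u \<in> words S" "x = word_class S R u" "v \<in> words S" "y = word_class S R v"
    by (auto simp: carrier_presented_group simp del: in_lists_conv_set)
  thus "x \<otimes>\<^bsub>presented_group S R\<^esub> y \<in> carrier (presented_group S R)"
    by (simp add: mult_presented_group carrier_presented_group del: in_lists_conv_set)
next
  fix x assume "x \<in> carrier (presented_group S R)"
  then obtain u where u: "u \<in> words S" "x = word_class S R u"
    by (auto simp: carrier_presented_group simp del: in_lists_conv_set)
  have "[] \<in> words S" by simp
  from mult_presented_group[OF this u(1)]
  show "\<one>\<^bsub>presented_group S R\<^esub> \<otimes>\<^bsub>presented_group S R\<^esub> x = x"
    using u by (simp add: one_presented_group)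
next
  fix x assume "x \<in> carrier (presented_group S R)"
  then obtain u where u: "u \<in> words S" "x = word_class S R u" by (auto simp: carrier_presented_group)
  have "word_class S R (inv_word u) \<otimes>\<^bsub>presented_group S R\<^esub> x = \<one>\<^bsub>presented_group S R\<^esub>"
    using u inv_word_words[OF u(1)] inv_word_left[OF u(1), of R]
    by (simp add: mult_presented_group one_presented_group word_class_eqI)
  thus "\<exists>y\<in>carrier (presented_group S R). y \<otimes>\<^bsub>presented_group S R\<^esub> x = \<one>\<^bsub>presented_group S R\<^esub>"
    using u inv_word_words[OF u(1)] by (auto simp: carrier_presented_group)
qed (simp add: carrier_presented_group one_presented_group del: in_lists_conv_set)

context
  fixes S :: "'a set" and R :: "'a word set"
begin

interpretation P: group "presented_group S R" by (rule group_presented_group)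

abbreviation "cls \<equiv> word_class S R"

lemma cls_closed: "u \<in> words S \<Longrightarrow> cls u \<in> carrier (presented_group S R)"
  by (auto simp: carrier_presented_group)

lemma inv_cls: "u \<in> words S \<Longrightarrow> inv\<^bsub>presented_group S R\<^esub> (cls u) = cls (inv_word u)"
  using inv_word_left[of u S R]
  by (intro P.inv_equality)
    (auto simp: mult_presented_group one_presented_group word_class_eqI inv_word_words cls_closed)

lemma pow_word_words: "u \<in> words S \<Longrightarrow> pow_word u n \<in> words S"
  by (auto simp: pow_word_def)

lemma cls_pow_word: "u \<in> words S \<Longrightarrow> cls (pow_word u n) = cls u [^]\<^bsub>presented_group S R\<^esub> n"
proof (induction n)
  case (Suc n)
  have "cls (pow_word u (Suc n)) = cls (u @ pow_word u n)" by (simp add: pow_word_def)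
  also have "\<dots> = cls u \<otimes>\<^bsub>presented_group S R\<^esub> cls (pow_word u n)"
    using Suc.prems by (simp only: mult_presented_group pow_word_words)
  also have "\<dots> = cls u [^]\<^bsub>presented_group S R\<^esub> Suc n"
    unfolding Suc.IH[OF Suc.prems] using P.nat_pow_Suc2[OF cls_closed[OF Suc.prems], of n] by (rule HOL.sym)
  finally show ?case .
qed (simp add: pow_word_def one_presented_group)

lemma cls_relator:
  assumes "r \<in> R" "r \<in> words S"
  shows "cls r = \<one>\<^bsub>presented_group S R\<^esub>"
  using presentation_eq.relator[of "[]" S "[]" r R] assms
  by (simp add: one_presented_group word_class_eqI)

lemma cls_comm_word:
  assumes "u \<in> words S" "v \<in> words S"
  shows "cls (comm_word u v) = commutator (presented_group S R) (cls u) (cls v)"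
  using assms
  by (simp add: comm_word_def commutator_def inv_cls mult_presented_group inv_word_words)

lemma presented_group_induct:
  assumes "h \<in> carrier (presented_group S R)" and "P \<one>\<^bsub>presented_group S R\<^esub>"
    and "\<And>h x. h \<in> carrier (presented_group S R) \<Longrightarrow> P h \<Longrightarrow> x \<in> S \<Longrightarrow>
      P (h \<otimes>\<^bsub>presented_group S R\<^esub> cls [(x, True)])"
    and "\<And>h x. h \<in> carrier (presented_group S R) \<Longrightarrow> P h \<Longrightarrow> x \<in> S \<Longrightarrow>
      P (h \<otimes>\<^bsub>presented_group S R\<^esub> inv\<^bsub>presented_group S R\<^esub> cls [(x, True)])"
  shows "P h"
proof -
  obtain u where u: "u \<in> words S" "h = cls u" using assms(1) by (auto simp: carrier_presented_group)
  have "P (cls u)" using u(1)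
  proof (induction u rule: rev_induct)
    case Nil
    thus ?case using assms(2) by (simp add: one_presented_group)
  next
    case (snoc l u)
    obtain x b where l: "l = (x, b)" "x \<in> S" using snoc by (cases l) auto
    have ul: "u \<in> words S" using snoc by auto
    have "cls (u @ [l]) = cls u \<otimes>\<^bsub>presented_group S R\<^esub> cls [l]"
      using ul l by (simp add: mult_presented_group)
    moreover have "cls [(x, False)] = inv\<^bsub>presented_group S R\<^esub> cls [(x, True)]"
      using l by (simp add: inv_cls inv_word_def)
    ultimately show ?case
      using assms(3,4)[OF cls_closed[OF ul] snoc.IH[OF ul] l(2)] l(1) by (cases b) auto
  qed
  thus ?thesis using u by simp
qed

end

section \<open>Nontriviality of \<open>\<alpha>\<^sub>4\<close>\<close>

definition word_act :: "('a \<times> bool \<Rightarrow> 'x \<Rightarrow> 'x) \<Rightarrow> 'a word \<Rightarrow> 'x \<Rightarrow> 'x" where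
  "word_act f w = foldr (\<lambda>l h. f l \<circ> h) w id"

lemma word_act_simps [simp]:
  "word_act f [] z = z" "word_act f (l # w) z = f l (word_act f w z)"
  by (simp_all add: word_act_def)

lemma word_act_append [simp]: "word_act f (u @ v) z = word_act f u (word_act f v z)"
  by (induction u) auto

text \<open>An action of the presented group on \<open>D\<close>, given by its letters. A word is
  nontrivial in the group as soon as it moves a single point of \<open>D\<close>.\<close>

lemma word_act_presentation_eq:
  assumes "presentation_eq S R u v"
    and closed: "\<And>l z. l \<in> S \<times> UNIV \<Longrightarrow> z \<in> D \<Longrightarrow> f l z \<in> D"
    and inv: "\<And>x b z. x \<in> S \<Longrightarrow> z \<in> D \<Longrightarrow> f (x, b) (f (x, \<not> b) z) = z"
    and rel: "\<And>r z. r \<in> R \<Longrightarrow> z \<in> D \<Longrightarrow> word_act f r z = z"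
    and "z \<in> D"
  shows "word_act f u z = word_act f v z"
proof -
  have cl: "word_act f w z \<in> D" if "w \<in> words S" "z \<in> D" for w z
    using that closed by (induction w) auto
  show ?thesis
    using assms(1) \<open>z \<in> D\<close>
    by (induction arbitrary: z rule: presentation_eq.induct) (auto simp: inv rel cl)
qed

text \<open>A permutation action on \<open>{0..<p} \<times> {0..<q}\<close> in which \<open>\<alpha>\<close> shifts the first coordinate and
  \<open>\<alpha>\<^sub>i\<close> adds \<open>e i n\<close> to the second one over \<open>n\<close>. The relation \<open>[\<alpha>\<^sub>i, \<alpha>] = \<alpha>\<^sub>i\<^sub>+\<^sub>1\<close> says that \<open>e (i + 1)\<close> is
  the difference of \<open>e i\<close>; the action shows that \<open>\<alpha>\<^sub>4\<close> is nontrivial.\<close>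

definition phi9_act :: "int \<Rightarrow> int \<Rightarrow> (nat \<Rightarrow> int \<Rightarrow> int) \<Rightarrow> nat \<times> bool \<Rightarrow> int \<times> int \<Rightarrow> int \<times> int" where
  "phi9_act p q e l z = (case l of (i, b) \<Rightarrow> case z of (n, c) \<Rightarrow>
     if i = 0 then ((if b then n + 1 else n - 1) mod p, c)
     else (n, (if b then c + e i n else c - e i n) mod q))"

text \<open>The action is that of the wreath product of Z/q by Z/p. Words in the \<alpha>_i
  translate the second coordinate by a function of the first, which \<open>tr\<close> records, and
  conjugation by \<alpha> shifts the argument of that function. Thus the relators turn into the
  congruences \<open>diff\<close> and \<open>pow\<close>, while \<open>e4\<close> makes
  \<open>\<alpha>\<^sub>4\<close> move the point (0, 0).\<close>

lemma phi9_alpha_4_nontrivial_if: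
  fixes e :: "nat \<Rightarrow> int \<Rightarrow> int"
  assumes p: "p > 0" and q: "q > 0"
    and diff: "\<And>i n. i \<in> {1..4} \<Longrightarrow> 0 \<le> n \<Longrightarrow> n < int p \<Longrightarrow>
      (e i ((n + 1) mod int p) - e i n - e (i + 1) n) mod q = 0"
    and pow: "\<And>j n. j \<in> {1..4} \<Longrightarrow> 0 \<le> n \<Longrightarrow> n < int p \<Longrightarrow>
      (\<Sum>k\<leftarrow>[1..<p + 1]. int (p choose k) * e (j + k - 1) n) mod q = 0"
    and e5: "\<And>i. i > 4 \<Longrightarrow> e i = (\<lambda>_. 0)"
    and e4: "e 4 0 mod q \<noteq> 0"
  shows "\<not> presentation_eq {0..4} (phi9_relators p) (phi9_alpha_i 4) []"
proof
  let ?f = "phi9_act (int p) q e" and ?X = "{0..<int p} \<times> {0..<q}"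
  define tr where "tr w h \<longleftrightarrow> (\<forall>n c. (n, c) \<in> ?X \<longrightarrow> word_act ?f w (n, c) = (n, (c + h n) mod q))"
    for w h
  have trD: "word_act ?f w (n, c) = (n, (c + h n) mod q)" if "tr w h" "(n, c) \<in> ?X" for w h n c
    using that by (auto simp: tr_def)
  have tr_append: "tr (u @ v) (\<lambda>n. h n + g n)" if "tr u h" "tr v g" for u v h g
    unfolding tr_def
  proof (intro allI impI)
    fix n c assume nc: "(n, c) \<in> ?X"
    have "(n, (c + g n) mod q) \<in> ?X" using nc q by auto
    thus "word_act ?f (u @ v) (n, c) = (n, (c + (h n + g n)) mod q)"
      using trD[OF that(1)] trD[OF that(2) nc] by (simp add: mod_simps add_ac)
  qed
  have tr_nil: "tr [] (\<lambda>_. 0)" by (auto simp: tr_def)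
  have tr_pow: "tr (pow_word w k) (\<lambda>n. int k * h n)" if "tr w h" for w h k
  proof (induction k)
    case (Suc k)
    thus ?case using tr_append[OF that Suc] by (simp add: pow_word_def algebra_simps)
  qed (use tr_nil in \<open>simp add: pow_word_def\<close>)
  have tr_alpha: "tr (phi9_alpha_i i) (e i)" if "i \<ge> 1" for i
    using that e5 by (auto simp: tr_def phi9_alpha_i_def phi9_act_def)
  have tr_alpha_inv: "tr (inv_word (phi9_alpha_i i)) (\<lambda>n. - e i n)" if "i \<ge> 1" for i
    using that e5 by (auto simp: tr_def phi9_alpha_i_def phi9_act_def inv_word_def)
  have tr_id: "word_act ?f w z = z" if "tr w h" "z \<in> ?X" "\<And>n. 0 \<le> n \<Longrightarrow> n < int p \<Longrightarrow> h n mod q = 0" for w h z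
  proof -
    obtain n c where z: "z = (n, c)" by (cases z)
    have "(c + h n) mod q = (c + h n mod q) mod q" by (simp add: mod_simps)
    also have "\<dots> = c" using that(2) that(3)[of n] z by auto
    finally show ?thesis using trD[OF that(1)] that(2) z by auto
  qed
  have tr_conj: "tr (inv_word phi9_alpha @ phi9_alpha_i i @ phi9_alpha) (\<lambda>n. e i ((n + 1) mod int p))"
    if "i \<ge> 1" for i
    unfolding tr_def
  proof (intro allI impI)
    fix n c assume nc: "(n, c) \<in> ?X"
    have "word_act ?f phi9_alpha (n, c) = ((n + 1) mod int p, c)"
      by (simp add: phi9_alpha_def phi9_act_def)
    moreover have "((n + 1) mod int p, c) \<in> ?X" using nc p by auto
    moreover have "((n + 1) mod int p - 1) mod int p = n"
      using nc by (simp add: mod_simps)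
    hence "word_act ?f (inv_word phi9_alpha) ((n + 1) mod int p, d) = (n, d)" for d
      by (simp add: phi9_alpha_def phi9_act_def inv_word_def)
    ultimately show "word_act ?f (inv_word phi9_alpha @ phi9_alpha_i i @ phi9_alpha) (n, c) =
        (n, (c + e i ((n + 1) mod int p)) mod q)"
      using trD[OF tr_alpha[OF that]] by simp
  qed
  have tr_comm: "tr (comm_word (phi9_alpha_i i) phi9_alpha) (\<lambda>n. - e i n + e i ((n + 1) mod int p))"
    if "i \<ge> 1" for i
    using tr_append[OF tr_alpha_inv tr_conj, OF that that] by (simp add: comm_word_def)
  have tr_concat: "tr (concat (map (\<lambda>k. pow_word (phi9_alpha_i (j + k - 1)) (p choose k)) ks))
      (\<lambda>n. \<Sum>k\<leftarrow>ks. int (p choose k) * e (j + k - 1) n)" if "j \<ge> 1" "\<forall>k\<in>set ks. k \<ge> 1" for j ks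
    using that
  proof (induction ks)
    case (Cons k ks)
    hence "tr (pow_word (phi9_alpha_i (j + k - 1)) (p choose k)) (\<lambda>n. int (p choose k) * e (j + k - 1) n)"
      by (intro tr_pow tr_alpha) auto
    thus ?case using tr_append[OF _ Cons.IH] Cons.prems by simp
  qed (simp add: tr_nil)
  have shift: "word_act ?f (pow_word phi9_alpha k) (n, c) = ((n + int k) mod int p, c)"
    if "0 \<le> n" "n < int p" for k n c
    using that by (induction k) (auto simp: pow_word_def phi9_alpha_def phi9_act_def mod_simps add_ac)
  have rel: "word_act ?f r z = z" if "r \<in> phi9_relators p" "z \<in> ?X" for r z
  proof -
    from that(1) consider
        i where "r = comm_word (phi9_alpha_i i) phi9_alpha @ inv_word (phi9_alpha_i (i + 1))" "i \<in> {1..3}"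
      | "r = comm_word (phi9_alpha_i 4) phi9_alpha"
      | i j where "r = comm_word (phi9_alpha_i i) (phi9_alpha_i j)" "i \<in> {1..4}" "j \<in> {1..4}"
      | "r = pow_word phi9_alpha p"
      | j where "r = phi9_power_word p j" "j \<in> {1..4}"
      unfolding phi9_relators_def by blast
    thus ?thesis
    proof cases
      case 1
      have "tr r (\<lambda>n. (- e i n + e i ((n + 1) mod int p)) + - e (i + 1) n)"
        unfolding 1 by (intro tr_append tr_comm tr_alpha_inv) (use 1 in auto)
      thus ?thesis by (rule tr_id[OF _ that(2)]) (use diff[of i] 1 in \<open>simp add: algebra_simps\<close>)
    next
      case 2
      have "tr r (\<lambda>n. - e 4 n + e 4 ((n + 1) mod int p))"
        unfolding 2 by (intro tr_comm) auto
      thus ?thesis by (rule tr_id[OF _ that(2)]) (use diff[of 4] e5 in \<open>simp add: algebra_simps\<close>)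
    next
      case 3
      have "tr r (\<lambda>n. - e i n + (- e j n + (e i n + e j n)))"
        unfolding 3 comm_word_def by (intro tr_append tr_alpha tr_alpha_inv) (use 3 in auto)
      thus ?thesis by (rule tr_id[OF _ that(2)]) auto
    next
      case 4
      thus ?thesis using shift[of "fst z" p "snd z"] that(2) by auto
    next
      case 5
      have "tr r (\<lambda>n. \<Sum>k\<leftarrow>[1..<p + 1]. int (p choose k) * e (j + k - 1) n)"
        unfolding 5 phi9_power_word_def by (rule tr_concat) (use 5 in auto)
      thus ?thesis by (rule tr_id[OF _ that(2)]) (use pow[of j] 5 in auto)
    qed
  qed
  assume "presentation_eq {0..4} (phi9_relators p) (phi9_alpha_i 4) []"
  hence "word_act ?f (phi9_alpha_i 4) (0, 0) = word_act ?f [] (0, 0)"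
  proof (rule word_act_presentation_eq[where D = ?X])
    fix l :: "nat \<times> bool" and z assume "l \<in> {0..4} \<times> UNIV" "z \<in> ?X"
    thus "?f l z \<in> ?X" using p q by (auto simp: phi9_act_def)
  next
    fix x b z assume "x \<in> {0..4::nat}" "z \<in> ?X"
    thus "?f (x, b) (?f (x, \<not> b) z) = z" by (auto simp: phi9_act_def mod_simps)
  qed (use p q rel in auto)
  thus False using trD[OF tr_alpha[of 4], of 0 0] e4 p q by simp
qed

text \<open>The function of \<open>\<alpha>\<^sub>4\<close> is the third difference of that of
  \<open>\<alpha>\<^sub>1\<close>. On 3-periodic functions the third difference vanishes modulo 3,
  so \<open>p = 3\<close> is treated separately with modulus 9; for \<open>p \<ge> 5\<close> the
  modulus \<open>p\<close> is enough.\<close>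

lemma phi9_alpha_4_nontrivial:
  assumes "Factorial_Ring.prime p" "odd p"
  shows "\<not> presentation_eq {0..4} (phi9_relators p) (phi9_alpha_i 4) []"
proof (cases "p = 3")
  case True
  (* iterated differences modulo 9 of the 3-periodic sequence 1, -1, 0, whose sum vanishes *)
  define e :: "nat \<Rightarrow> int \<Rightarrow> int" where
    "e = (\<lambda>i n. if i = 1 then (if n = 0 then 1 else if n = 1 then - 1 else 0)
       else if i = 2 then (if n = 0 then - 2 else 1)
       else if i = 3 then (if n = 0 then 3 else if n = 1 then 0 else - 3)
       else if i = 4 then - 3 else 0)"
  have n3: "n = 0 \<or> n = 1 \<or> n = 2" if "0 \<le> n" "n < int p" for n
    using that True by auto
  have i4: "i = 1 \<or> i = 2 \<or> i = 3 \<or> i = 4" if "i \<in> {1..4}" for i :: nat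
    using that by auto
  have choose3: "3 choose 2 = (3::nat)" by (simp add: numeral_eq_Suc)
  have list: "[1..<p + 1] = [1, 2, 3]" by (simp add: True upt_rec)
  show ?thesis
  proof (rule phi9_alpha_4_nontrivial_if[where q = 9 and e = e])
    fix i n assume "i \<in> {1..4::nat}" "0 \<le> n" "n < int p"
    hence "n = 0 \<or> n = 1 \<or> n = 2" "i = 1 \<or> i = 2 \<or> i = 3 \<or> i = 4" using n3 i4 by blast+
    thus "(e i ((n + 1) mod int p) - e i n - e (i + 1) n) mod 9 = 0"
      by (elim disjE) (simp_all add: e_def True)
  next
    fix j n assume "j \<in> {1..4::nat}" "0 \<le> n" "n < int p"
    hence "n = 0 \<or> n = 1 \<or> n = 2" "j = 1 \<or> j = 2 \<or> j = 3 \<or> j = 4" using n3 i4 by blast+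
    thus "(\<Sum>k\<leftarrow>[1..<p + 1]. int (p choose k) * e (j + k - 1) n) mod 9 = 0"
      unfolding list by (elim disjE) (simp_all add: e_def True choose3)
  qed (auto simp: True e_def)
next
  case False
  have p5: "p \<ge> 5"
  proof (rule ccontr)
    assume "\<not> p \<ge> 5"
    hence "p \<in> {0, 1, 2, 3, 4}" by auto
    thus False using assms False by (auto simp: not_prime_0 not_prime_1)
  qed
  \<comment> \<open>Binomial coefficients as polynomials in \<open>n\<close>: by Pascal's rule the
    difference lowers the degree by one, and the sequence ends with the constant 1 for
    \<open>\<alpha>\<^sub>4\<close>.\<close>
  define e :: "nat \<Rightarrow> int \<Rightarrow> int" where
    "e = (\<lambda>i n. if i \<le> 4 then int (nat n choose (4 - i)) else 0)"
  have dvd: "int p dvd int (p choose k)" if "0 < k" "k < p" for k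
    using dvd_choose_prime[of k p] assms(1) that p5 by simp
  show ?thesis
  proof (rule phi9_alpha_4_nontrivial_if[where q = "int p" and e = e])
    fix i n assume i: "i \<in> {1..4::nat}" and n: "0 \<le> n" "n < int p"
    define m where "m = nat n"
    have m: "n = int m" "m < p" using n by (auto simp: m_def)
    have pascal: "int (Suc m choose (4 - i)) = int (m choose (4 - i)) + e (i + 1) n"
    proof (cases "i = 4")
      case False
      then obtain r where r: "4 - i = Suc r" "4 - (i + 1) = r" using i by (cases "4 - i") auto
      thus ?thesis using i False by (simp add: e_def m)
    qed (simp add: e_def)
    show "(e i ((n + 1) mod int p) - e i n - e (i + 1) n) mod int p = 0"
    proof (cases "Suc m = p")
      case False
      hence "(n + 1) mod int p = int (Suc m)" using m by simp
      moreover have "e i (int (Suc m)) = int (Suc m choose (4 - i))" "e i n = int (m choose (4 - i))"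
        using i unfolding e_def m nat_int by auto
      ultimately show ?thesis using pascal by simp
    next
      case True
      hence "n + 1 = int p" using m by simp
      hence "(n + 1) mod int p = 0" by simp
      moreover have "e i n + e (i + 1) n = int (p choose (4 - i))"
        using pascal True i by (simp add: e_def m)
      \<comment> \<open>The wrap-around from \<open>p - 1\<close> to 0 is harmless because
        \<open>p\<close> divides its binomial coefficients; for \<open>i = 4\<close> the function is
        constant.\<close>
      moreover have "int p dvd e i 0 - int (p choose (4 - i))"
        using i dvd[of "4 - i"] p5 by (cases "i = 4") (auto simp: e_def binomial_eq_0)
      ultimately show ?thesis by (simp add: diff_diff_eq mod_eq_0_iff_dvd)
    qed
  next
    fix j n assume j: "j \<in> {1..4::nat}"
    have "int p dvd int (p choose k) * e (j + k - 1) n" if "k \<in> set [1..<p + 1]" for k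
    proof (cases "k = p")
      case True
      thus ?thesis using j p5 by (auto simp: e_def)
    next
      case False
      thus ?thesis using that dvd[of k] by (intro dvd_mult2) auto
    qed
    hence "int p dvd (\<Sum>k\<leftarrow>ks. int (p choose k) * e (j + k - 1) n)"
      if "set ks \<subseteq> set [1..<p + 1]" for ks
      using that by (induction ks) (auto intro!: dvd_add simp del: set_upt)
    thus "(\<Sum>k\<leftarrow>[1..<p + 1]. int (p choose k) * e (j + k - 1) n) mod int p = 0"
      by (simp only: mod_eq_0_iff_dvd HOL.simp_thms subset_refl)
  qed (use p5 in \<open>auto simp: e_def\<close>)
qed

section \<open>The structure of the presented group\<close>

context group
begin

lemma pow_commute:
  assumes "a \<in> carrier G" "b \<in> carrier G" "a \<otimes> b = b \<otimes> a"
  shows "a [^] (n::nat) \<otimes> b = b \<otimes> a [^] n"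
proof (induction n)
  case (Suc n)
  have "a [^] Suc n \<otimes> b = a [^] n \<otimes> (b \<otimes> a)" using assms by (simp add: m_assoc)
  also have "\<dots> = b \<otimes> a [^] Suc n" using assms Suc by (simp flip: m_assoc)
  finally show ?case .
qed (use assms in simp)

lemma pow_commute2:
  assumes "a \<in> carrier G" "b \<in> carrier G" "a \<otimes> b = b \<otimes> a"
  shows "a [^] (n::nat) \<otimes> b [^] (k::nat) = b [^] k \<otimes> a [^] n"
  using pow_commute[of "b" "a [^] n" k] pow_commute[OF assms, of n] assms by simp

lemma left_commute:
  assumes "a \<in> carrier G" "b \<in> carrier G" "c \<in> carrier G" "a \<otimes> b = b \<otimes> a"
  shows "a \<otimes> (b \<otimes> c) = b \<otimes> (a \<otimes> c)"
  using assms by (simp flip: m_assoc)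

lemma pow_conj_step:
  assumes "x \<in> carrier G" "y \<in> carrier G" "y' \<in> carrier G"
    and "y \<otimes> x = x \<otimes> (y \<otimes> y')" "y \<otimes> y' = y' \<otimes> y"
  shows "y [^] (n::nat) \<otimes> x = x \<otimes> (y [^] n \<otimes> y' [^] n)"
proof -
  have "y [^] n \<otimes> x = x \<otimes> (y \<otimes> y') [^] n"
  proof (induction n)
    case (Suc n)
    have "y [^] Suc n \<otimes> x = y [^] n \<otimes> x \<otimes> (y \<otimes> y')"
      using assms by (simp add: m_assoc)
    also have "\<dots> = x \<otimes> (y \<otimes> y') [^] Suc n"
      unfolding Suc using assms by (simp add: m_assoc)
    finally show ?case .
  qed (use assms in simp)
  thus ?thesis using pow_mult_distrib[OF assms(5) assms(2,3), of n] by simp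
qed

lemma center_subset: "z \<in> center G \<Longrightarrow> z \<in> carrier G"
  by (auto simp: center_def centralizer_def)

lemma center_commute: "z \<in> center G \<Longrightarrow> a \<in> carrier G \<Longrightarrow> z \<otimes> a = a \<otimes> z"
  by (auto simp: center_def centralizer_def)

lemma subgroup_centralizer:
  assumes "T \<subseteq> carrier G"
  shows "subgroup (centralizer G T) G"
proof
  fix x y assume xy: "x \<in> centralizer G T" "y \<in> centralizer G T"
  show "x \<otimes> y \<in> centralizer G T"
    unfolding centralizer_def
  proof safe
    fix s assume s: "s \<in> T"
    hence "s \<in> carrier G" using assms by auto
    thus "x \<otimes> y \<otimes> s = s \<otimes> (x \<otimes> y)" using xy s unfolding centralizer_def
      by (simp add: m_assoc) (simp flip: m_assoc)
  qed (use xy in \<open>auto simp: centralizer_def\<close>)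
next
  fix x assume x: "x \<in> centralizer G T"
  show "inv x \<in> centralizer G T"
    unfolding centralizer_def
  proof safe
    fix s assume s: "s \<in> T"
    hence sc: "s \<in> carrier G" using assms by auto
    have xc: "x \<in> carrier G" "x \<otimes> s = s \<otimes> x" using x s by (auto simp: centralizer_def)
    have "inv x \<otimes> s = inv x \<otimes> (s \<otimes> x) \<otimes> inv x" using xc(1) sc by (simp add: m_assoc)
    also have "\<dots> = s \<otimes> inv x" unfolding xc(2)[symmetric] using xc(1) sc by (simp flip: m_assoc)
    finally show "inv x \<otimes> s = s \<otimes> inv x" .
  qed (use x in \<open>auto simp: centralizer_def\<close>)
qed (use assms in \<open>auto simp: centralizer_def\<close>)

lemma subgroup_center: "subgroup (center G) G"
  unfolding center_def by (rule subgroup_centralizer) simp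

lemma normal_center: "center G \<lhd> G"
proof (rule normal_invI[OF subgroup_center])
  fix x h assume "x \<in> carrier G" "h \<in> center G"
  thus "x \<otimes> h \<otimes> inv x \<in> center G"
    by (metis center_commute center_subset inv_solve_right m_closed)
qed

lemma commutator_closed: "x \<in> carrier G \<Longrightarrow> y \<in> carrier G \<Longrightarrow> commutator G x y \<in> carrier G"
  by (simp add: commutator_def)

lemma commutator_swap:
  assumes "x \<in> carrier G" "y \<in> carrier G"
  shows "x \<otimes> y = y \<otimes> (x \<otimes> commutator G x y)"
  using assms unfolding commutator_def by (simp flip: m_assoc)

lemma commutator_eq_iff:
  assumes "x \<in> carrier G" "y \<in> carrier G" "c \<in> carrier G"
  shows "commutator G x y = c \<longleftrightarrow> x \<otimes> y = y \<otimes> (x \<otimes> c)"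
  using commutator_swap[OF assms(1,2)] commutator_closed[OF assms(1,2)] assms by simp

lemma commutator_eq_one_iff:
  assumes "x \<in> carrier G" "y \<in> carrier G"
  shows "commutator G x y = \<one> \<longleftrightarrow> x \<otimes> y = y \<otimes> x"
  using assms by (simp add: commutator_eq_iff)

end

text \<open>The features of \<open>\<Phi>\<^sub>9(1\<^sup>5)\<close> that are transported along an isoclinism.\<close>

definition phi9_frame :: "('a, 'b) monoid_scheme \<Rightarrow> nat \<Rightarrow> 'a \<Rightarrow> 'a \<Rightarrow> 'a \<Rightarrow> 'a \<Rightarrow> 'a \<Rightarrow> bool" where
  "phi9_frame H p x y1 y2 y3 y4 \<longleftrightarrow>
     x \<in> carrier H \<and> y1 \<in> carrier H \<and> y2 \<in> carrier H \<and> y3 \<in> carrier H \<and> y4 \<in> center H \<and>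
     commutator H y1 x = y2 \<and> commutator H y2 x = y3 \<and> commutator H y3 x = y4 \<and> y4 \<noteq> \<one>\<^bsub>H\<^esub> \<and>
     commutator H y1 y2 = \<one>\<^bsub>H\<^esub> \<and> commutator H y1 y3 = \<one>\<^bsub>H\<^esub> \<and> commutator H y2 y3 = \<one>\<^bsub>H\<^esub> \<and>
     x [^]\<^bsub>H\<^esub> p \<in> center H \<and> y3 [^]\<^bsub>H\<^esub> p \<in> center H \<and> y2 [^]\<^bsub>H\<^esub> p \<in> center H \<and>
     (\<exists>e::nat. \<exists>z\<in>center H. y1 [^]\<^bsub>H\<^esub> p = y3 [^]\<^bsub>H\<^esub> e \<otimes>\<^bsub>H\<^esub> z) \<and>
     (\<forall>h\<in>carrier H. \<exists>(i::nat) (a::nat) (b::nat) (c::nat). \<exists>z\<in>center H.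
        h = x [^]\<^bsub>H\<^esub> i \<otimes>\<^bsub>H\<^esub> (y1 [^]\<^bsub>H\<^esub> a \<otimes>\<^bsub>H\<^esub> (y2 [^]\<^bsub>H\<^esub> b \<otimes>\<^bsub>H\<^esub> (y3 [^]\<^bsub>H\<^esub> c \<otimes>\<^bsub>H\<^esub> z))))"

text \<open>The power hypotheses are the power relators of the presentation: \<open>p * d\<close>
  stands for p choose 2, \<open>e1\<close> for p choose 3, and \<open>f1\<close>, \<open>f2\<close>,
  \<open>f3\<close> collect the tails. Read from the last relator upwards they make the
  \<open>p\<close>-th powers of \<open>y3\<close> and \<open>y2\<close> central; that of
  \<open>y1\<close> keeps a factor from \<open>y3\<close>, which cannot be dropped for
  \<open>p = 3\<close>. The normal forms exhaust the group because right multiplication by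
  generators and their inverses preserves them.\<close>

lemma (in group) phi9_frame_intro:
  fixes d e1 f1 f2 f3 :: nat
  assumes carr: "x \<in> carrier G" "y1 \<in> carrier G" "y2 \<in> carrier G" "y3 \<in> carrier G" "y4 \<in> carrier G"
    and comm: "commutator G y1 x = y2" "commutator G y2 x = y3" "commutator G y3 x = y4"
      "commutator G y4 x = \<one>"
    and comm1: "commutator G y1 y2 = \<one>" "commutator G y1 y3 = \<one>" "commutator G y1 y4 = \<one>"
      "commutator G y2 y3 = \<one>" "commutator G y2 y4 = \<one>" "commutator G y3 y4 = \<one>"
    and ne: "y4 \<noteq> \<one>" and p0: "p > 0"
    and powx: "x [^] p = \<one>"
    and pow1: "y1 [^] p \<otimes> (y2 [^] (p * d) \<otimes> (y3 [^] e1 \<otimes> y4 [^] f1)) = \<one>"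
    and pow2: "y2 [^] p \<otimes> (y3 [^] (p * d) \<otimes> y4 [^] f2) = \<one>"
    and pow3: "y3 [^] p \<otimes> y4 [^] f3 = \<one>"
    and gen: "\<And>P h. h \<in> carrier G \<Longrightarrow> P \<one> \<Longrightarrow>
       (\<And>h g. h \<in> carrier G \<Longrightarrow> P h \<Longrightarrow> g \<in> {x, y1, y2, y3, y4} \<Longrightarrow> P (h \<otimes> g)) \<Longrightarrow>
       (\<And>h g. h \<in> carrier G \<Longrightarrow> P h \<Longrightarrow> g \<in> {x, y1, y2, y3, y4} \<Longrightarrow> P (h \<otimes> inv g)) \<Longrightarrow> P h"
  shows "phi9_frame G p x y1 y2 y3 y4"
proof -
  interpret Z: subgroup "center G" G by (rule subgroup_center)
  have yc: "y1 \<otimes> y2 = y2 \<otimes> y1" "y1 \<otimes> y3 = y3 \<otimes> y1" "y1 \<otimes> y4 = y4 \<otimes> y1"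
    "y2 \<otimes> y3 = y3 \<otimes> y2" "y2 \<otimes> y4 = y4 \<otimes> y2" "y3 \<otimes> y4 = y4 \<otimes> y3" "y4 \<otimes> x = x \<otimes> y4"
    using comm1 comm(4) carr by (simp_all add: commutator_eq_one_iff)
  have xc: "y1 \<otimes> x = x \<otimes> (y1 \<otimes> y2)" "y2 \<otimes> x = x \<otimes> (y2 \<otimes> y3)" "y3 \<otimes> x = x \<otimes> (y3 \<otimes> y4)"
    using comm carr by (simp_all add: commutator_eq_iff)
  have y4Z: "y4 \<in> center G"
  proof -
    have "h \<in> centralizer G {y4}" if "h \<in> carrier G" for h
    proof -
      interpret C: subgroup "centralizer G {y4}" G by (rule subgroup_centralizer) (use carr in auto)
      have g: "g \<in> centralizer G {y4}" if "g \<in> {x, y1, y2, y3, y4}" for g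
        using that yc(3,5-7) carr unfolding centralizer_def by (elim insertE emptyE) simp_all
      show ?thesis
        by (rule gen[OF that, of "\<lambda>h. h \<in> centralizer G {y4}"])
          (simp_all only: C.one_closed C.m_closed C.m_inv_closed g)
    qed
    hence "y4 \<otimes> h = h \<otimes> y4" if "h \<in> carrier G" for h
      using that by (simp add: centralizer_def)
    thus ?thesis using carr(5) unfolding center_def centralizer_def by blast
  qed
  have y4p: "y4 [^] (n::nat) \<in> center G" for n
    by (induction n) (auto intro: y4Z)
  have inv_of: "a \<in> center G" if "a \<otimes> b = \<one>" "a \<in> carrier G" "b \<in> center G" for a b
    using that by (metis Z.m_inv_closed Z.mem_carrier inv_equality)
  have y3p: "y3 [^] p \<in> center G" using inv_of[OF pow3] carr y4p by simp
  have y3pd: "y3 [^] (p * d) \<in> center G"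
  proof -
    have "(y3 [^] p) [^] n \<in> center G" for n :: nat by (induction n) (auto intro: y3p)
    thus ?thesis using carr by (simp add: nat_pow_pow)
  qed
  have y2p: "y2 [^] p \<in> center G" using inv_of[OF pow2] carr y4p y3pd by simp
  have y2pd: "y2 [^] (p * d) \<in> center G"
  proof -
    have "(y2 [^] p) [^] n \<in> center G" for n :: nat by (induction n) (auto intro: y2p)
    thus ?thesis using carr by (simp add: nat_pow_pow)
  qed
  \<comment> \<open>Inverses become positive powers times inverses of \<open>p\<close>-th powers, so
    normal forms with natural exponents suffice.\<close>
  have y3inv: "inv y3 = y3 [^] (p - 1) \<otimes> inv (y3 [^] p)" 
    and y2inv: "inv y2 = y2 [^] (p - 1) \<otimes> inv (y2 [^] p)"
    and y1inv: "inv y1 = y1 [^] (p - 1) \<otimes> inv (y1 [^] p)"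
  proof -
    have "inv y = y [^] (p - 1) \<otimes> inv (y [^] p)" if "y \<in> carrier G" for y
    proof -
      have "y [^] p = y \<otimes> y [^] (p - 1)" using that p0 by (metis Suc_diff_1 nat_pow_Suc2)
      thus ?thesis using that by (simp add: inv_mult_group flip: m_assoc)
    qed
    thus "inv y3 = y3 [^] (p - 1) \<otimes> inv (y3 [^] p)" "inv y2 = y2 [^] (p - 1) \<otimes> inv (y2 [^] p)"
      "inv y1 = y1 [^] (p - 1) \<otimes> inv (y1 [^] p)" by (simp_all only: carr)
  qed
  have y1p: "y1 [^] p = inv (y3 [^] e1) \<otimes> inv (y2 [^] (p * d) \<otimes> y4 [^] f1)"
  proof -
    have z: "y2 [^] (p * d) \<otimes> y4 [^] f1 \<in> center G" using y2pd y4p by simp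
    have "y2 [^] (p * d) \<otimes> (y3 [^] e1 \<otimes> y4 [^] f1) = (y2 [^] (p * d) \<otimes> y4 [^] f1) \<otimes> y3 [^] e1"
      using carr y4p center_commute[of "y4 [^] f1" "y3 [^] e1"] by (simp add: m_assoc)
    hence "y1 [^] p = inv ((y2 [^] (p * d) \<otimes> y4 [^] f1) \<otimes> y3 [^] e1)"
      using pow1 carr by (metis inv_equality m_closed nat_pow_closed)
    thus ?thesis using carr by (simp add: inv_mult_group)
  qed
  define W where "W = {h. \<exists>(i::nat) (a::nat) (b::nat) (c::nat). \<exists>z\<in>center G.
    h = x [^] i \<otimes> (y1 [^] a \<otimes> (y2 [^] b \<otimes> (y3 [^] c \<otimes> z)))}"
  \<comment> \<open>Right multipliers that preserve \<open>W\<close>. They are closed under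
    products, so it remains to find the generators and their inverses among them.\<close>
  define K where "K = {g \<in> carrier G. \<forall>h\<in>W. h \<otimes> g \<in> W}"
  have Wc: "h \<in> carrier G" if "h \<in> W" for h
    using that carr by (auto simp: W_def)
  have Kmult: "g \<otimes> g' \<in> K" if "g \<in> K" "g' \<in> K" for g g'
    using that Wc by (auto simp: K_def simp flip: m_assoc)
  have "\<one> \<in> K" using Wc by (auto simp: K_def)
  hence Kpow: "g [^] (n::nat) \<in> K" if "g \<in> K" for g n
    using that Kmult by (induction n) auto
  have KZ: "z \<in> K" if "z \<in> center G" for z
  proof -
    have "x [^] i \<otimes> (y1 [^] a \<otimes> (y2 [^] b \<otimes> (y3 [^] c \<otimes> z'))) \<otimes> z \<in> W"
      if "z' \<in> center G" for i a b c :: nat and z'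
      unfolding W_def
    proof (safe intro!: exI bexI)
      show "x [^] i \<otimes> (y1 [^] a \<otimes> (y2 [^] b \<otimes> (y3 [^] c \<otimes> z'))) \<otimes> z =
        x [^] i \<otimes> (y1 [^] a \<otimes> (y2 [^] b \<otimes> (y3 [^] c \<otimes> (z' \<otimes> z))))"
        using carr that \<open>z \<in> center G\<close> by (simp add: m_assoc)
    qed (use that \<open>z \<in> center G\<close> in auto)
    thus ?thesis using that by (auto simp: K_def W_def)
  qed
  have K3: "y3 \<in> K"
  proof -
    have "x [^] i \<otimes> (y1 [^] a \<otimes> (y2 [^] b \<otimes> (y3 [^] c \<otimes> z))) \<otimes> y3 \<in> W"
      if "z \<in> center G" for i a b c :: nat and z
      unfolding W_def
    proof (safe intro!: exI bexI)
      show "x [^] i \<otimes> (y1 [^] a \<otimes> (y2 [^] b \<otimes> (y3 [^] c \<otimes> z))) \<otimes> y3 =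
        x [^] i \<otimes> (y1 [^] a \<otimes> (y2 [^] b \<otimes> (y3 [^] Suc c \<otimes> z)))"
        using carr that by (simp add: m_assoc center_commute)
    qed (use that in auto)
    thus ?thesis using carr by (auto simp: K_def W_def)
  qed
  have K2: "y2 \<in> K"
  proof -
    have "x [^] i \<otimes> (y1 [^] a \<otimes> (y2 [^] b \<otimes> (y3 [^] c \<otimes> z))) \<otimes> y2 \<in> W"
      if "z \<in> center G" for i a b c :: nat and z
      unfolding W_def
    proof (safe intro!: exI bexI)
      show "x [^] i \<otimes> (y1 [^] a \<otimes> (y2 [^] b \<otimes> (y3 [^] c \<otimes> z))) \<otimes> y2 =
        x [^] i \<otimes> (y1 [^] a \<otimes> (y2 [^] Suc b \<otimes> (y3 [^] c \<otimes> z)))"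
        using carr that left_commute[OF _ _ _ pow_commute[of y3 y2 c]] yc
        by (simp add: m_assoc center_commute)
    qed (use that in auto)
    thus ?thesis using carr by (auto simp: K_def W_def)
  qed
  have K1: "y1 \<in> K"
  proof -
    have "x [^] i \<otimes> (y1 [^] a \<otimes> (y2 [^] b \<otimes> (y3 [^] c \<otimes> z))) \<otimes> y1 \<in> W"
      if "z \<in> center G" for i a b c :: nat and z
      unfolding W_def
    proof (safe intro!: exI bexI)
      show "x [^] i \<otimes> (y1 [^] a \<otimes> (y2 [^] b \<otimes> (y3 [^] c \<otimes> z))) \<otimes> y1 =
        x [^] i \<otimes> (y1 [^] Suc a \<otimes> (y2 [^] b \<otimes> (y3 [^] c \<otimes> z)))"
        using carr that left_commute[OF _ _ _ pow_commute[of y3 y1 c]]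
          left_commute[OF _ _ _ pow_commute[of y2 y1 b]] yc
        by (simp add: m_assoc center_commute)
    qed (use that in auto)
    thus ?thesis using carr by (auto simp: K_def W_def)
  qed
  have Kx: "x \<in> K"
  proof -
    have "x [^] i \<otimes> (y1 [^] a \<otimes> (y2 [^] b \<otimes> (y3 [^] c \<otimes> z))) \<otimes> x \<in> W"
      if z: "z \<in> center G" for i a b c :: nat and z
      unfolding W_def
    proof (safe intro!: exI bexI)
      have c1: "y1 [^] a \<otimes> (x \<otimes> w) = x \<otimes> (y1 [^] a \<otimes> (y2 [^] a \<otimes> w))"
       and c2: "y2 [^] b \<otimes> (x \<otimes> w) = x \<otimes> (y2 [^] b \<otimes> (y3 [^] b \<otimes> w))"
       and c3: "y3 [^] c \<otimes> (x \<otimes> w) = x \<otimes> (y3 [^] c \<otimes> (y4 [^] c \<otimes> w))" if "w \<in> carrier G" for w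
        using pow_conj_step[of x y1 y2 a] pow_conj_step[of x y2 y3 b] pow_conj_step[of x y3 y4 c]
          that carr xc yc by (simp_all flip: m_assoc)
      have c4: "y3 [^] b \<otimes> (y3 [^] c \<otimes> w) = y3 [^] (b + c) \<otimes> w"
        and c5: "y2 [^] a \<otimes> (y2 [^] b \<otimes> w) = y2 [^] (a + b) \<otimes> w" if "w \<in> carrier G" for w
        using carr that by (simp_all add: nat_pow_mult flip: m_assoc)
      \<comment> \<open>Each \<open>y\<close> that \<open>x\<close> passes leaves its commutator
        behind, which raises the next exponent; the last of them is central.\<close>
      show "x [^] i \<otimes> (y1 [^] a \<otimes> (y2 [^] b \<otimes> (y3 [^] c \<otimes> z))) \<otimes> x =
        x [^] Suc i \<otimes> (y1 [^] a \<otimes> (y2 [^] (a + b) \<otimes> (y3 [^] (b + c) \<otimes> (y4 [^] c \<otimes> z))))"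
        using carr z by (simp add: m_assoc center_commute[OF z] c1 c2 c3 c4 c5)
      show "y4 [^] c \<otimes> z \<in> center G" using z y4p by simp
    qed
    thus ?thesis using carr by (auto simp: K_def W_def)
  qed
  have Ki3: "inv y3 \<in> K" unfolding y3inv by (intro Kmult Kpow K3 KZ Z.m_inv_closed y3p)
  have Ki2: "inv y2 \<in> K" unfolding y2inv by (intro Kmult Kpow K2 KZ Z.m_inv_closed y2p)
  have Ki1: "inv y1 \<in> K"
  proof -
    have z: "y2 [^] (p * d) \<otimes> y4 [^] f1 \<in> center G" using y2pd y4p by simp
    have "inv (y1 [^] p) = (y2 [^] (p * d) \<otimes> y4 [^] f1) \<otimes> y3 [^] e1"
      unfolding y1p using carr by (simp add: inv_mult_group)
    moreover have "\<dots> \<in> K" by (intro Kmult Kpow K3 KZ z)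
    ultimately show ?thesis unfolding y1inv by (auto intro!: Kmult Kpow K1)
  qed
  have Kix: "inv x \<in> K"
  proof -
    have "x [^] (p - 1) \<otimes> x = \<one>" using powx p0 carr by (metis Suc_diff_1 nat_pow_Suc)
    hence "inv x = x [^] (p - 1)" using carr by (metis inv_equality nat_pow_closed)
    thus ?thesis using Kpow[OF Kx] by simp
  qed
  have "\<one> \<in> W" unfolding W_def
    by (intro CollectI exI[of _ 0] bexI[of _ \<one>]) auto
  have span: "h \<in> W" if "h \<in> carrier G" for h
    using that
  proof (rule gen)
    fix h g assume hg: "h \<in> W" "g \<in> {x, y1, y2, y3, y4}"
    have "g \<in> K" "inv g \<in> K" using hg(2) K1 K2 K3 Kx Ki1 Ki2 Ki3 Kix KZ[OF y4Z] KZ[OF Z.m_inv_closed[OF y4Z]] by auto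
    thus "h \<otimes> g \<in> W" "h \<otimes> inv g \<in> W" using hg(1) by (auto simp: K_def)
  qed fact
  \<comment> \<open>The factor \<open>inv (y3 [^] e1)\<close> is a positive power of
    \<open>y3\<close> up to a central element.\<close>
  have "\<exists>e::nat. \<exists>z\<in>center G. y1 [^] p = y3 [^] e \<otimes> z"
  proof -
    have "inv (y3 [^] e1) = (inv y3) [^] e1" using carr by (simp add: nat_pow_inv)
    also have "\<dots> = (y3 [^] (p - 1)) [^] e1 \<otimes> (inv (y3 [^] p)) [^] e1"
      unfolding y3inv using carr center_commute[OF Z.m_inv_closed[OF y3p], of "y3 [^] (p - 1)"]
      by (subst pow_mult_distrib) auto
    also have "\<dots> = y3 [^] ((p - 1) * e1) \<otimes> (inv (y3 [^] p)) [^] e1"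
      using carr by (simp add: nat_pow_pow)
    finally have "y1 [^] p = y3 [^] ((p - 1) * e1) \<otimes> ((inv (y3 [^] p)) [^] e1 \<otimes> inv (y2 [^] (p * d) \<otimes> y4 [^] f1))"
      unfolding y1p using carr by (simp add: m_assoc)
    moreover have "(inv (y3 [^] p)) [^] n \<in> center G" for n :: nat
      by (induction n) (auto intro: y3p)
    hence "(inv (y3 [^] p)) [^] e1 \<otimes> inv (y2 [^] (p * d) \<otimes> y4 [^] f1) \<in> center G"
      using y2pd y4p by (intro Z.m_closed Z.m_inv_closed) auto
    ultimately show ?thesis by blast
  qed
  thus ?thesis unfolding phi9_frame_def
    using carr comm comm1 ne y4Z powx y3p y2p span by (auto simp: W_def)
qed

lemma phi9_group_frame:
  assumes "Factorial_Ring.prime p" "odd p"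
  shows "\<exists>x y1 y2 y3 y4. phi9_frame (phi9_group p) p x y1 y2 y3 y4"
proof -
  let ?S = "{0..4::nat}" and ?R = "phi9_relators p"
  let ?H = "presented_group ?S ?R" and ?c = "word_class ?S ?R"
  interpret H: group ?H by (rule group_presented_group)
  define y where "y i = ?c (phi9_alpha_i i)" for i
  define x where "x = ?c phi9_alpha"
  have p3: "p \<ge> 3"
  proof -
    have "p \<noteq> 0" "p \<noteq> 1" "p \<noteq> 2" using assms by auto
    thus ?thesis by linarith
  qed
  have wi: "phi9_alpha_i i \<in> words ?S" for i by (auto simp: phi9_alpha_i_def)
  have wa: "phi9_alpha \<in> words ?S" by (auto simp: phi9_alpha_def)
  have carr: "x \<in> carrier ?H" "y i \<in> carrier ?H" for i
    unfolding x_def y_def by (intro cls_closed wi wa)+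
  have wc: "comm_word u v \<in> words ?S" if "u \<in> words ?S" "v \<in> words ?S" for u v
    using that inv_word_words[OF that(1)] inv_word_words[OF that(2)] by (auto simp: comm_word_def)
  have comm: "commutator ?H (y i) x = y (i + 1)" if "i \<in> {1..3}" for i
  proof -
    let ?r = "comm_word (phi9_alpha_i i) phi9_alpha @ inv_word (phi9_alpha_i (i + 1))"
    have "?r \<in> ?R" using that unfolding phi9_relators_def by blast
    moreover have w: "comm_word (phi9_alpha_i i) phi9_alpha \<in> words ?S"
      "inv_word (phi9_alpha_i (i + 1)) \<in> words ?S"
      by (intro wc wi wa inv_word_words)+
    ultimately have "?c ?r = \<one>\<^bsub>?H\<^esub>" by (intro cls_relator) auto
    moreover have "?c ?r = commutator ?H (y i) x \<otimes>\<^bsub>?H\<^esub> inv\<^bsub>?H\<^esub> (y (i + 1))"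
      unfolding mult_presented_group[OF w, symmetric] cls_comm_word[OF wi wa] inv_cls[OF wi]
        x_def y_def by (rule HOL.refl)
    ultimately show ?thesis using carr H.commutator_closed[OF carr(2,1)]
      by (metis H.inv_closed H.inv_equality H.inv_inv)
  qed
  have comm4: "commutator ?H (y 4) x = \<one>\<^bsub>?H\<^esub>"
  proof -
    have "comm_word (phi9_alpha_i 4) phi9_alpha \<in> ?R" unfolding phi9_relators_def by blast
    thus ?thesis using cls_relator[OF _ wc[OF wi wa]] by (simp add: x_def y_def cls_comm_word wi wa)
  qed
  have commy: "commutator ?H (y i) (y j) = \<one>\<^bsub>?H\<^esub>" if "i \<in> {1..4}" "j \<in> {1..4}" for i j
  proof -
    have "comm_word (phi9_alpha_i i) (phi9_alpha_i j) \<in> ?R" using that unfolding phi9_relators_def by blast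
    thus ?thesis using cls_relator[OF _ wc[OF wi wi]] by (simp add: y_def cls_comm_word wi)
  qed
  have powx: "x [^]\<^bsub>?H\<^esub> p = \<one>\<^bsub>?H\<^esub>"
  proof -
    have "pow_word phi9_alpha p \<in> ?R" unfolding phi9_relators_def by blast
    thus ?thesis using cls_relator[OF _ pow_word_words[OF wa]] by (simp add: x_def cls_pow_word wa)
  qed
  have ybig: "y i = \<one>\<^bsub>?H\<^esub>" if "i > 4" for i
    using that by (simp add: y_def phi9_alpha_i_def one_presented_group)
  let ?w = "\<lambda>j ks. concat (map (\<lambda>k. pow_word (phi9_alpha_i (j + k - 1)) (p choose k)) ks)"
  have ww: "?w j ks \<in> words ?S" for j ks
    using wi pow_word_words[of _ ?S] by (induction ks) (auto simp del: in_lists_conv_set)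
  have w_Cons: "?c (?w j (k # ks)) = y (j + k - 1) [^]\<^bsub>?H\<^esub> (p choose k) \<otimes>\<^bsub>?H\<^esub> ?c (?w j ks)" for j k ks
    unfolding y_def cls_pow_word[OF wi, symmetric]
      mult_presented_group[OF pow_word_words[OF wi] ww] by simp
  \<comment> \<open>Letters with index beyond 4 are trivial, so a tail that starts at index 4 or
    later is a power of \<open>y 4\<close>.\<close>
  have w_tail: "\<exists>n::nat. ?c (?w j ks) = y 4 [^]\<^bsub>?H\<^esub> n" if "\<forall>k\<in>set ks. j + k - 1 \<ge> 4" for j ks
    using that
  proof (induction ks)
    case Nil
    show ?case by (rule exI[of _ 0]) (simp add: one_presented_group)
  next
    case (Cons k ks)
    then obtain n :: nat where n: "?c (?w j ks) = y 4 [^]\<^bsub>?H\<^esub> n" by auto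
    show ?case
    proof (cases "j + k - 1 = 4")
      case True
      have "?c (?w j (k # ks)) = y 4 [^]\<^bsub>?H\<^esub> ((p choose k) + n)"
        unfolding w_Cons n True by (rule H.nat_pow_mult[OF carr(2)])
      thus ?thesis by blast
    next
      case False
      hence "y (j + k - 1) = \<one>\<^bsub>?H\<^esub>" using Cons.prems by (intro ybig) auto
      hence "?c (?w j (k # ks)) = y 4 [^]\<^bsub>?H\<^esub> n"
        unfolding w_Cons n using carr by simp
      thus ?thesis by blast
    qed
  qed
  have pw: "?c (?w j [1..<p + 1]) = \<one>\<^bsub>?H\<^esub>" if "j \<in> {1..4}" for j
  proof -
    have "?w j [1..<p + 1] \<in> ?R" using that unfolding phi9_relators_def phi9_power_word_def by blast
    thus ?thesis by (rule cls_relator) (rule ww)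
  qed
  \<comment> \<open>Divisibility of p choose 2 by \<open>p\<close> uses that \<open>p\<close> is
    odd.\<close>
  obtain d where d: "p choose 2 = p * d"
    using dvd_choose_prime[of 2 p] assms(1) p3 by (auto elim: dvdE)
  \<comment> \<open>At most three factors of a power word precede the tail, and
    \<open>p \<ge> 3\<close> guarantees that the indices 1, 2 and 3 occur.\<close>
  have l1: "[1..<p + 1] = 1 # [2..<p + 1]" "[2..<p + 1] = 2 # [3..<p + 1]" "[3..<p + 1] = 3 # [4..<p + 1]"
    using p3 by (auto simp: upt_rec numeral_eq_Suc)
  obtain f1 :: nat where f1: "?c (?w 1 [4..<p + 1]) = y 4 [^]\<^bsub>?H\<^esub> f1"
    using w_tail[of "[4..<p + 1]" 1] by auto
  obtain f2 :: nat where f2: "?c (?w 2 [3..<p + 1]) = y 4 [^]\<^bsub>?H\<^esub> f2"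
    using w_tail[of "[3..<p + 1]" 2] by auto
  obtain f3 :: nat where f3: "?c (?w 3 [2..<p + 1]) = y 4 [^]\<^bsub>?H\<^esub> f3"
    using w_tail[of "[2..<p + 1]" 3] by auto
  have i: "1 + 1 - 1 = (1::nat)" "1 + 2 - 1 = (2::nat)" "1 + 3 - 1 = (3::nat)" "2 + 1 - 1 = (2::nat)"
    "2 + 2 - 1 = (3::nat)" "3 + 1 - 1 = (3::nat)" by simp_all
  have pow1: "y 1 [^]\<^bsub>?H\<^esub> p \<otimes>\<^bsub>?H\<^esub> (y 2 [^]\<^bsub>?H\<^esub> (p * d) \<otimes>\<^bsub>?H\<^esub>
      (y 3 [^]\<^bsub>?H\<^esub> (p choose 3) \<otimes>\<^bsub>?H\<^esub> y 4 [^]\<^bsub>?H\<^esub> f1)) = \<one>\<^bsub>?H\<^esub>"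
    using pw[of 1] unfolding l1(1) w_Cons unfolding l1(2) w_Cons unfolding l1(3) w_Cons f1 d i by simp
  have pow2: "y 2 [^]\<^bsub>?H\<^esub> p \<otimes>\<^bsub>?H\<^esub> (y 3 [^]\<^bsub>?H\<^esub> (p * d) \<otimes>\<^bsub>?H\<^esub> y 4 [^]\<^bsub>?H\<^esub> f2) = \<one>\<^bsub>?H\<^esub>"
    using pw[of 2] unfolding l1(1) w_Cons unfolding l1(2) w_Cons f2 d i by simp
  have pow3: "y 3 [^]\<^bsub>?H\<^esub> p \<otimes>\<^bsub>?H\<^esub> y 4 [^]\<^bsub>?H\<^esub> f3 = \<one>\<^bsub>?H\<^esub>"
    using pw[of 3] unfolding l1(1) w_Cons f3 i by simp
  have y4: "y 4 \<noteq> \<one>\<^bsub>?H\<^esub>"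
    using phi9_alpha_4_nontrivial[OF assms] word_class_eqD[of ?S ?R "phi9_alpha_i 4" "[]"]
    by (auto simp: y_def one_presented_group)
  have letters: "?c [(i, True)] \<in> {x, y 1, y 2, y 3, y 4}" if "i \<in> {0..4}" for i
  proof -
    from that consider "i = 0" | "i = 1" | "i = 2" | "i = 3" | "i = 4" by fastforce
    thus ?thesis by cases (auto simp: x_def y_def phi9_alpha_def phi9_alpha_i_def)
  qed
  have "phi9_frame ?H p x (y 1) (y 2) (y 3) (y 4)"
  proof (rule H.phi9_frame_intro[OF carr(1) carr(2) carr(2) carr(2) carr(2)])
    fix P h assume h: "h \<in> carrier ?H" and one: "P \<one>\<^bsub>?H\<^esub>"
      and step: "\<And>h g. h \<in> carrier ?H \<Longrightarrow> P h \<Longrightarrow> g \<in> {x, y 1, y 2, y 3, y 4} \<Longrightarrow> P (h \<otimes>\<^bsub>?H\<^esub> g)"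
      "\<And>h g. h \<in> carrier ?H \<Longrightarrow> P h \<Longrightarrow> g \<in> {x, y 1, y 2, y 3, y 4} \<Longrightarrow> P (h \<otimes>\<^bsub>?H\<^esub> inv\<^bsub>?H\<^esub> g)"
    show "P h"
      by (rule presented_group_induct[OF h, of P]) (use one step letters in auto)
  next
    show "commutator ?H (y 1) x = y 2" "commutator ?H (y 2) x = y 3" "commutator ?H (y 3) x = y 4"
      using comm[of 1] comm[of 2] comm[of 3] by (simp_all add: numeral_eq_Suc)
  qed (rule pow1 pow2 pow3 powx comm4 y4 commy HOL.refl | use p3 in simp)+
  thus ?thesis unfolding phi9_group_def by blast
qed

section \<open>Transport along an isoclinism\<close>

text \<open>\<open>derived_set\<close> uses the convention x y x^-1 y^-1, so inverse arguments have
  to be inserted.\<close>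

lemma (in group) commutator_derived:
  assumes "x \<in> carrier G" "y \<in> carrier G"
  shows "commutator G x y \<in> derived G (carrier G)"
  unfolding derived_def
proof (rule generate.incl)
  have "commutator G x y = inv x \<otimes> inv y \<otimes> inv (inv x) \<otimes> inv (inv y)"
    using assms by (simp add: commutator_def)
  thus "commutator G x y \<in> derived_set G (carrier G)"
    using assms inv_closed[OF assms(1)] inv_closed[OF assms(2)] by blast
qed

text \<open>\<open>rel g h\<close> says that the cosets of \<open>g\<close> and \<open>h\<close>
  correspond under \<phi>. It is multiplicative and determines \<open>g\<close> up to a central
  factor, which transfers every property that holds modulo the centre. Whether a commutator is
  trivial is an exact statement and transfers by the injectivity of \<psi>.\<close>

lemma phi9_frame_isoclinic:
  fixes G :: "('a, 'b) monoid_scheme" and H :: "('c, 'd) monoid_scheme"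
  assumes "group G" "group H" "isoclinic G H" "phi9_frame H p x y1 y2 y3 y4"
  shows "\<exists>g a1 a2 a3 a4. phi9_frame G p g a1 a2 a3 a4"
proof -
  interpret G: group G by fact
  interpret H: group H by fact
  interpret GZ: normal "center G" G by (rule G.normal_center)
  interpret HZ: normal "center H" H by (rule H.normal_center)
  interpret QG: group "G Mod center G" by (rule GZ.factorgroup_is_group)
  interpret QH: group "H Mod center H" by (rule HZ.factorgroup_is_group)
  obtain \<phi> \<psi> where phi: "\<phi> \<in> iso (G Mod center G) (H Mod center H)"
    and psi: "\<psi> \<in> iso (G\<lparr>carrier := commutator_subgroup G\<rparr>) (H\<lparr>carrier := commutator_subgroup H\<rparr>)"
    and compat: "\<And>x y u v. x \<in> carrier G \<Longrightarrow> y \<in> carrier G \<Longrightarrow> u \<in> carrier H \<Longrightarrow> v \<in> carrier H \<Longrightarrow>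
          \<phi> (center G #>\<^bsub>G\<^esub> x) = center H #>\<^bsub>H\<^esub> u \<Longrightarrow>
          \<phi> (center G #>\<^bsub>G\<^esub> y) = center H #>\<^bsub>H\<^esub> v \<Longrightarrow>
          \<psi> (commutator G x y) = commutator H u v"
    using assms(3) unfolding isoclinic_def by blast
  interpret phi: group_hom "G Mod center G" "H Mod center H" \<phi>
    using phi by unfold_locales (auto simp: iso_def)
  have carQ: "carrier (G Mod center G) = (\<lambda>x. center G #>\<^bsub>G\<^esub> x) ` carrier G"
    "carrier (H Mod center H) = (\<lambda>x. center H #>\<^bsub>H\<^esub> x) ` carrier H"
    by (auto simp: FactGroup_def RCOSETS_def)
  have phi_bij: "bij_betw \<phi> (carrier (G Mod center G)) (carrier (H Mod center H))"
    using phi by (auto simp: iso_def)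
  define rel where "rel g h \<longleftrightarrow> g \<in> carrier G \<and> h \<in> carrier H \<and>
    \<phi> (center G #>\<^bsub>G\<^esub> g) = center H #>\<^bsub>H\<^esub> h" for g h
  have rel_left: "\<exists>g. rel g h" if "h \<in> carrier H" for h
  proof -
    have "center H #>\<^bsub>H\<^esub> h \<in> \<phi> ` carrier (G Mod center G)"
      using phi_bij that unfolding bij_betw_def carQ by auto
    thus ?thesis using that by (auto simp: rel_def carQ)
  qed
  have rel_right: "\<exists>h. rel g h" if "g \<in> carrier G" for g
  proof -
    have "\<phi> (center G #>\<^bsub>G\<^esub> g) \<in> carrier (H Mod center H)"
      using that by (intro phi.hom_closed) (auto simp: carQ)
    thus ?thesis using that by (auto simp: rel_def carQ)
  qed
  have rel_carr: "g \<in> carrier G" "h \<in> carrier H" if "rel g h" for g h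
    using that by (auto simp: rel_def)
  have rel_mult: "rel (g \<otimes>\<^bsub>G\<^esub> g') (h \<otimes>\<^bsub>H\<^esub> h')" if "rel g h" "rel g' h'" for g g' h h'
  proof -
    have "\<phi> ((center G #>\<^bsub>G\<^esub> g) \<otimes>\<^bsub>G Mod center G\<^esub> (center G #>\<^bsub>G\<^esub> g')) =
        (center H #>\<^bsub>H\<^esub> h) \<otimes>\<^bsub>H Mod center H\<^esub> (center H #>\<^bsub>H\<^esub> h')"
      using that by (subst phi.hom_mult) (auto simp: rel_def carQ)
    thus ?thesis using that by (simp add: rel_def GZ.rcos_sum HZ.rcos_sum)
  qed
  have rel_one: "rel \<one>\<^bsub>G\<^esub> z" if "z \<in> center H" for z
    using that phi.hom_one
    by (simp add: rel_def G.coset_mult_one GZ.subset HZ.rcos_const)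
  have rel_pow: "rel (g [^]\<^bsub>G\<^esub> n) (h [^]\<^bsub>H\<^esub> n)" if "rel g h" for g h and n :: nat
    using that by (induction n) (auto intro: rel_mult rel_one HZ.one_closed)
  have rel_unique: "\<exists>z\<in>center G. g' = g \<otimes>\<^bsub>G\<^esub> z" if "rel g h" "rel g' h" for g g' h
  proof -
    have "center G #>\<^bsub>G\<^esub> g = center G #>\<^bsub>G\<^esub> g'"
      using bij_betw_imp_inj_on[OF phi_bij] that by (auto simp: rel_def carQ inj_on_def)
    moreover have "g' \<in> center G #>\<^bsub>G\<^esub> g'"
      using that by (intro G.rcos_self GZ.is_subgroup) (auto simp: rel_def)
    ultimately have "g' \<in> center G #>\<^bsub>G\<^esub> g" by simp
    then obtain z where "z \<in> center G" "g' = z \<otimes>\<^bsub>G\<^esub> g" by (auto simp: r_coset_def)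
    thus ?thesis using G.center_commute[of z g] rel_carr(1)[OF that(1)] by auto
  qed
  have rel_center: "g \<in> center G" if "rel g h" "h \<in> center H" for g h
    using rel_unique[OF rel_one[OF that(2)] that(1)] by (auto dest: G.center_subset)
  have rel_inv: "rel (inv\<^bsub>G\<^esub> g) (inv\<^bsub>H\<^esub> h)" if "rel g h" for g h
  proof -
    have "inv\<^bsub>G\<^esub> g \<in> carrier G" using rel_carr[OF that] by simp
    then obtain h' where h': "rel (inv\<^bsub>G\<^esub> g) h'" using rel_right by blast
    have "rel \<one>\<^bsub>G\<^esub> (h' \<otimes>\<^bsub>H\<^esub> h)"
      using rel_mult[OF h' that] rel_carr[OF that] by simp
    hence "center H #>\<^bsub>H\<^esub> (h' \<otimes>\<^bsub>H\<^esub> h) = center H"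
      using phi.hom_one by (simp add: rel_def G.coset_mult_one GZ.subset)
    hence "h' \<otimes>\<^bsub>H\<^esub> h \<in> center H"
      using H.rcos_self[OF _ HZ.is_subgroup, of "h' \<otimes>\<^bsub>H\<^esub> h"] rel_carr[OF that] rel_carr[OF h'] by simp
    then obtain z where z: "z \<in> center H" "h' \<otimes>\<^bsub>H\<^esub> h = z" by blast
    have "inv\<^bsub>H\<^esub> h = inv\<^bsub>H\<^esub> z \<otimes>\<^bsub>H\<^esub> h'"
      using z rel_carr[OF that] rel_carr[OF h'] H.center_subset[OF z(1)]
      by (metis H.inv_closed H.inv_equality H.inv_solve_left H.l_inv H.m_assoc H.m_closed)
    moreover have "rel \<one>\<^bsub>G\<^esub> (inv\<^bsub>H\<^esub> z)" by (rule rel_one) (use z in auto)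
    ultimately show ?thesis using rel_mult[OF _ h', of "\<one>\<^bsub>G\<^esub>" "inv\<^bsub>H\<^esub> z"] rel_carr[OF that] by simp
  qed
  have rel_comm: "rel (commutator G g g') (commutator H h h')" if "rel g h" "rel g' h'" for g g' h h'
    unfolding commutator_def by (intro rel_mult rel_inv that)
  have psi_comm: "\<psi> (commutator G g g') = commutator H h h'" if "rel g h" "rel g' h'" for g g' h h'
    using that by (intro compat) (auto simp: rel_def)
  have subG: "subgroup (commutator_subgroup G) G" by (rule G.derived_is_subgroup) simp
  have subH: "subgroup (commutator_subgroup H) H" by (rule H.derived_is_subgroup) simp
  interpret psi: group_hom "G\<lparr>carrier := commutator_subgroup G\<rparr>" "H\<lparr>carrier := commutator_subgroup H\<rparr>" \<psi>
    using psi G.subgroup_imp_group[OF subG] H.subgroup_imp_group[OF subH]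
    by (auto simp: group_hom_def group_hom_axioms_def iso_def)
  have psi_one: "\<psi> \<one>\<^bsub>G\<^esub> = \<one>\<^bsub>H\<^esub>" using psi.hom_one by simp
  have comm_one: "commutator G g g' = \<one>\<^bsub>G\<^esub> \<longleftrightarrow> commutator H h h' = \<one>\<^bsub>H\<^esub>"
    if "rel g h" "rel g' h'" for g g' h h'
  proof -
    have "commutator G g g' \<in> commutator_subgroup G" "\<one>\<^bsub>G\<^esub> \<in> commutator_subgroup G"
      using rel_carr[OF that(1)] rel_carr[OF that(2)] subgroup.one_closed[OF subG]
      by (auto intro: G.commutator_derived)
    moreover have "inj_on \<psi> (commutator_subgroup G)"
      using psi by (auto simp: iso_def bij_betw_def)
    ultimately show ?thesis
      unfolding psi_comm[OF that, symmetric] psi_one[symmetric] by (auto dest: inj_onD)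
  qed
  note fr = assms(4)[unfolded phi9_frame_def]
  obtain g a1 where g: "rel g x" and a1: "rel a1 y1" using rel_left fr by blast
  \<comment> \<open>Computing the commutators in \<open>G\<close> makes these relations exact;
    independent lifts of \<open>y2\<close>, \<open>y3\<close>, \<open>y4\<close> would satisfy them
    only modulo the centre.\<close>
  define a2 where "a2 = commutator G a1 g"
  define a3 where "a3 = commutator G a2 g"
  define a4 where "a4 = commutator G a3 g"
  have a2: "rel a2 y2" unfolding a2_def using rel_comm[OF a1 g] fr by simp
  have a3: "rel a3 y3" unfolding a3_def using rel_comm[OF a2 g] fr by simp
  have a4: "rel a4 y4" unfolding a4_def using rel_comm[OF a3 g] fr by simp
  obtain e :: nat and z where ez: "z \<in> center H" "y1 [^]\<^bsub>H\<^esub> p = y3 [^]\<^bsub>H\<^esub> e \<otimes>\<^bsub>H\<^esub> z" using fr by blast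
  \<comment> \<open>Central elements of \<open>H\<close> correspond to \<one>, so the factor
    \<open>z\<close> disappears here and returns as an unspecified central element of
    \<open>G\<close>.\<close>
  have "rel (a3 [^]\<^bsub>G\<^esub> e \<otimes>\<^bsub>G\<^esub> \<one>\<^bsub>G\<^esub>) (y1 [^]\<^bsub>H\<^esub> p)"
    unfolding ez(2) by (intro rel_mult rel_pow a3 rel_one ez)
  hence "rel (a3 [^]\<^bsub>G\<^esub> e) (y1 [^]\<^bsub>H\<^esub> p)" using rel_carr[OF a3] by simp
  from rel_unique[OF this rel_pow[OF a1]]
  have pow1: "\<exists>e::nat. \<exists>z\<in>center G. a1 [^]\<^bsub>G\<^esub> p = a3 [^]\<^bsub>G\<^esub> e \<otimes>\<^bsub>G\<^esub> z" by blast
  have span: "\<exists>(i::nat) (a::nat) (b::nat) (c::nat). \<exists>z\<in>center G.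
      v = g [^]\<^bsub>G\<^esub> i \<otimes>\<^bsub>G\<^esub> (a1 [^]\<^bsub>G\<^esub> a \<otimes>\<^bsub>G\<^esub> (a2 [^]\<^bsub>G\<^esub> b \<otimes>\<^bsub>G\<^esub> (a3 [^]\<^bsub>G\<^esub> c \<otimes>\<^bsub>G\<^esub> z)))"
    if v: "v \<in> carrier G" for v
  proof -
    obtain h where h: "rel v h" using rel_right[OF v] by blast
    then obtain i a b c :: nat and z where z: "z \<in> center H"
      "h = x [^]\<^bsub>H\<^esub> i \<otimes>\<^bsub>H\<^esub> (y1 [^]\<^bsub>H\<^esub> a \<otimes>\<^bsub>H\<^esub> (y2 [^]\<^bsub>H\<^esub> b \<otimes>\<^bsub>H\<^esub> (y3 [^]\<^bsub>H\<^esub> c \<otimes>\<^bsub>H\<^esub> z)))"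
      using fr rel_carr(2)[OF h] by blast
    have "rel (g [^]\<^bsub>G\<^esub> i \<otimes>\<^bsub>G\<^esub> (a1 [^]\<^bsub>G\<^esub> a \<otimes>\<^bsub>G\<^esub> (a2 [^]\<^bsub>G\<^esub> b \<otimes>\<^bsub>G\<^esub> (a3 [^]\<^bsub>G\<^esub> c \<otimes>\<^bsub>G\<^esub> \<one>\<^bsub>G\<^esub>)))) h"
      unfolding z(2) by (intro rel_mult rel_pow g a1 a2 a3 rel_one z)
    from rel_unique[OF this h] obtain z' where z': "z' \<in> center G"
      "v = g [^]\<^bsub>G\<^esub> i \<otimes>\<^bsub>G\<^esub> (a1 [^]\<^bsub>G\<^esub> a \<otimes>\<^bsub>G\<^esub> (a2 [^]\<^bsub>G\<^esub> b \<otimes>\<^bsub>G\<^esub> (a3 [^]\<^bsub>G\<^esub> c \<otimes>\<^bsub>G\<^esub> \<one>\<^bsub>G\<^esub>))) \<otimes>\<^bsub>G\<^esub> z'" by blast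
    have "v = g [^]\<^bsub>G\<^esub> i \<otimes>\<^bsub>G\<^esub> (a1 [^]\<^bsub>G\<^esub> a \<otimes>\<^bsub>G\<^esub> (a2 [^]\<^bsub>G\<^esub> b \<otimes>\<^bsub>G\<^esub> (a3 [^]\<^bsub>G\<^esub> c \<otimes>\<^bsub>G\<^esub> z')))"
      unfolding z'(2) using G.center_subset[OF z'(1)] rel_carr(1)[OF g] rel_carr(1)[OF a1]
        rel_carr(1)[OF a2] rel_carr(1)[OF a3] by (simp add: G.m_assoc)
    thus ?thesis using z'(1) by blast
  qed
  have "phi9_frame G p g a1 a2 a3 a4"
    unfolding phi9_frame_def
  proof (intro conjI)
    show "a4 \<noteq> \<one>\<^bsub>G\<^esub>" using comm_one[OF a3 g] fr by (simp add: a4_def)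
    show "commutator G a1 a2 = \<one>\<^bsub>G\<^esub>" using comm_one[OF a1 a2] fr by simp
    show "commutator G a1 a3 = \<one>\<^bsub>G\<^esub>" using comm_one[OF a1 a3] fr by simp
    show "commutator G a2 a3 = \<one>\<^bsub>G\<^esub>" using comm_one[OF a2 a3] fr by simp
    show "g [^]\<^bsub>G\<^esub> p \<in> center G" by (rule rel_center[OF rel_pow[OF g]]) (use fr in blast)
    show "a3 [^]\<^bsub>G\<^esub> p \<in> center G" by (rule rel_center[OF rel_pow[OF a3]]) (use fr in blast)
    show "a2 [^]\<^bsub>G\<^esub> p \<in> center G" by (rule rel_center[OF rel_pow[OF a2]]) (use fr in blast)
    show "a4 \<in> center G" by (rule rel_center[OF a4]) (use fr in blast)
  qed (use rel_carr(1)[OF g] rel_carr(1)[OF a1] rel_carr(1)[OF a2] rel_carr(1)[OF a3] pow1 span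
        in \<open>auto simp: a2_def a3_def a4_def\<close>)
  thus ?thesis by blast
qed

section \<open>The centralizer of the derived subgroup and its \<open>p\<close>-th powers\<close>

lemma (in group) finite_submonoid_subgroup:
  assumes "finite (carrier G)" "T \<subseteq> carrier G" "\<one> \<in> T" "\<And>x y. x \<in> T \<Longrightarrow> y \<in> T \<Longrightarrow> x \<otimes> y \<in> T"
  shows "subgroup T G"
proof
  fix x assume x: "x \<in> T"
  have pow: "x [^] (n::nat) \<in> T" for n by (induction n) (use assms x in auto)
  have "Coset.order G > 0" using assms(1) by (simp add: order_gt_0_iff_finite)
  then obtain n where n: "Coset.order G = Suc n" by (cases "Coset.order G") auto
  have "x [^] n \<otimes> x = \<one>" using pow_order_eq_1[of x] x assms(2) n by auto
  hence "inv x = x [^] n" using x assms(2) by (intro inv_equality) auto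
  thus "inv x \<in> T" using pow by simp
qed (use assms in auto)

lemma (in group) card_subgroup_strict:
  assumes "finite (carrier G)" "Coset.order G = p ^ n" "Factorial_Ring.prime p"
    and "subgroup H G" "subgroup K G" "H \<subset> K"
  shows "p * card H \<le> card K"
proof -
  have "card H dvd p ^ n" "card K dvd p ^ n"
    using lagrange[OF assms(4)] lagrange[OF assms(5)] assms(2) by (metis dvd_triv_right)+
  then obtain i j where ij: "card H = p ^ i" "card K = p ^ j"
    using divides_primepow_nat[OF assms(3)] by metis
  have "finite K" using assms(1) subgroup.subset[OF assms(5)] by (rule rev_finite_subset)
  hence "card H < card K" using assms(6) by (rule psubset_card_mono)
  hence "i < j" using ij prime_gt_1_nat[OF assms(3)] by (simp add: power_strict_increasing_iff)
  hence "p ^ Suc i \<le> p ^ j" using prime_gt_1_nat[OF assms(3)] by (intro power_increasing) auto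
  thus ?thesis using ij by simp
qed

text \<open>What the Wedderburn decomposition needs to know about \<open>G\<close>; \<open>A\<close> is the centralizer of \<open>G'\<close>.\<close>

locale cyclic_extension = group G for G (structure) +
  fixes p :: nat and A :: "'a set" and g :: 'a
  assumes finite_G: "finite (carrier G)"
    and prime_p: "Factorial_Ring.prime p"
    and subgroup_A: "subgroup A G"
    and abelian_A: "a \<in> A \<Longrightarrow> b \<in> A \<Longrightarrow> a \<otimes> b = b \<otimes> a"
    and order_A: "\<exists>n. card A = p ^ n"
    and derived_A: "derived G (carrier G) \<subseteq> A"
    and g_closed: "g \<in> carrier G"
    and coset_rep: "x \<in> carrier G \<Longrightarrow> \<exists>i::nat. \<exists>a\<in>A. x = g [^] i \<otimes> a"
    and g_pow_in_A: "g [^] (i::nat) \<in> A \<longleftrightarrow> p dvd i"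
    and pow_p: "a \<in> A \<Longrightarrow> \<exists>b\<in>A. a [^] p = commutator G (commutator G b g) g"

text \<open>\<open>el\<close> gives coordinates on \<open>Z1\<close>, which turns out to be the
  centralizer. The commutator with \<open>g\<close> shifts them towards the centre, so that the
  centre, \<open>Z3\<close>, \<open>Z2\<close>, \<open>Z1\<close> and \<open>G\<close> form a
  strictly increasing chain. In order p^5 this leaves at most \<open>p\<close> central elements, and
  they are the powers of \<open>a4\<close>. Consequently every element of \<open>Z3\<close> is a
  double commutator with \<open>g\<close>, and \<open>p\<close>-th powers of elements of
  \<open>Z1\<close> lie in \<open>Z3\<close>.\<close>

lemma (in group) phi9_frame_cyclic_extension:
  assumes p: "Factorial_Ring.prime p" and ord: "Coset.order G = p ^ 5"
    and frame: "phi9_frame G p g a1 a2 a3 a4"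
  shows "cyclic_extension G p (centralizer G (derived G (carrier G))) g"
proof -
  have p0: "p > 0" using p prime_gt_0_nat by blast
  have fin: "finite (carrier G)"
    using ord p0 by (metis order_gt_0_iff_finite zero_less_power)
  note fr = frame[unfolded phi9_frame_def]
  have carr: "g \<in> carrier G" "a1 \<in> carrier G" "a2 \<in> carrier G" "a3 \<in> carrier G" "a4 \<in> carrier G"
    using fr center_subset by blast+
  interpret Z: subgroup "center G" G by (rule subgroup_center)
  have a4Z: "a4 \<in> center G" and a4: "a4 \<noteq> \<one>" using fr by blast+
  have ac: "a1 \<otimes> a2 = a2 \<otimes> a1" "a1 \<otimes> a3 = a3 \<otimes> a1" "a2 \<otimes> a3 = a3 \<otimes> a2" "a3 \<otimes> a4 = a4 \<otimes> a3"
    using fr carr center_commute[OF a4Z] by (simp_all add: commutator_eq_one_iff)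
  have gc: "a1 \<otimes> g = g \<otimes> (a1 \<otimes> a2)" "a2 \<otimes> g = g \<otimes> (a2 \<otimes> a3)" "a3 \<otimes> g = g \<otimes> (a3 \<otimes> a4)"
    using fr carr by (simp_all add: commutator_eq_iff)
  have a4p: "a4 [^] (n::nat) \<in> center G" for n by (induction n) (auto intro: a4Z)
  define el where "el a b c z = a1 [^] a \<otimes> (a2 [^] b \<otimes> (a3 [^] c \<otimes> z))"
    for a b c :: nat and z
  have el_carr: "el a b c z \<in> carrier G" if "z \<in> center G" for a b c z
    using carr center_subset[OF that] by (simp add: el_def)
  have el_mult: "el a b c z \<otimes> el a' b' c' z' = el (a + a') (b + b') (c + c') (z \<otimes> z')"
    if z: "z \<in> center G" "z' \<in> center G" for a b c z a' b' c' z'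
  proof -
    note pc = pow_commute2[OF carr(3,2) ac(1)[symmetric]] pow_commute2[OF carr(4,2) ac(2)[symmetric]]
      pow_commute2[OF carr(4,3) ac(3)[symmetric]]
    note lc = left_commute[OF _ _ _ pc(1)] left_commute[OF _ _ _ pc(2)] left_commute[OF _ _ _ pc(3)]
    have zc: "z \<otimes> (w \<otimes> v) = w \<otimes> (z \<otimes> v)" if "w \<in> carrier G" "v \<in> carrier G" for w v
      by (intro left_commute center_commute z center_subset that)
    have "el a b c z \<otimes> el a' b' c' z' = a1 [^] a \<otimes> (a1 [^] a' \<otimes> (a2 [^] b \<otimes> (a2 [^] b' \<otimes>
        (a3 [^] c \<otimes> (a3 [^] c' \<otimes> (z \<otimes> z'))))))"
      using carr z by (simp add: el_def m_assoc zc lc)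
    also have "\<dots> = el (a + a') (b + b') (c + c') (z \<otimes> z')"
      using carr z by (simp add: el_def flip: nat_pow_mult) (simp add: m_assoc)
    finally show ?thesis .
  qed
  have el_one: "el 0 0 0 \<one> = \<one>" by (simp add: el_def)
  have el_g: "el a b c z \<otimes> g = g \<otimes> (el a b c z \<otimes> el 0 a b (a4 [^] c))" if z: "z \<in> center G" for a b c z
  proof -
    have c1: "a1 [^] a \<otimes> (g \<otimes> w) = g \<otimes> (a1 [^] a \<otimes> (a2 [^] a \<otimes> w))"
     and c2: "a2 [^] b \<otimes> (g \<otimes> w) = g \<otimes> (a2 [^] b \<otimes> (a3 [^] b \<otimes> w))"
     and c3: "a3 [^] c \<otimes> (g \<otimes> w) = g \<otimes> (a3 [^] c \<otimes> (a4 [^] c \<otimes> w))" if "w \<in> carrier G" for w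
      using pow_conj_step[of g a1 a2 a] pow_conj_step[of g a2 a3 b] pow_conj_step[of g a3 a4 c]
        that carr gc ac by (simp_all flip: m_assoc)
    have c4: "a3 [^] b \<otimes> (a3 [^] c \<otimes> w) = a3 [^] (b + c) \<otimes> w"
      and c5: "a2 [^] a \<otimes> (a2 [^] b \<otimes> w) = a2 [^] (a + b) \<otimes> w" if "w \<in> carrier G" for w
      using carr that by (simp_all add: nat_pow_mult flip: m_assoc)
    have "el a b c z \<otimes> g = g \<otimes> el a (b + a) (c + b) (z \<otimes> a4 [^] c)"
      using carr z by (simp add: el_def m_assoc center_commute[OF z] c1 c2 c3 c4 c5 add.commute)
    thus ?thesis using el_mult[OF z a4p] by simp
  qed
  \<comment> \<open>The shift that drives the whole proof: the exponents of \<open>a1\<close>,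
    \<open>a2\<close>, \<open>a3\<close> move to \<open>a2\<close>, \<open>a3\<close>,
    \<open>a4\<close>.\<close>
  have comm_el: "commutator G (el a b c z) g = el 0 a b (a4 [^] c)" if "z \<in> center G" for a b c z
    using el_g[OF that] carr el_carr that a4p by (subst commutator_eq_iff) auto
  have el_pow: "el a b c z [^] (n::nat) = el (a * n) (b * n) (c * n) (z [^] n)" and zpow: "z [^] n \<in> center G"
    if "z \<in> center G" for a b c z and n :: nat
  proof -
    have zn: "z [^] k \<in> center G" for k :: nat using that by (induction k) auto
    show "z [^] n \<in> center G" by (rule zn)
    show "el a b c z [^] n = el (a * n) (b * n) (c * n) (z [^] n)"
      by (induction n) (simp_all add: el_one el_mult that zn algebra_simps)
  qed
  define Z3 where "Z3 = {el 0 0 c z | c z. z \<in> center G}"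
  define Z2 where "Z2 = {el 0 b c z | b c z. z \<in> center G}"
  define Z1 where "Z1 = {el a b c z | a b c z. z \<in> center G}"
  have sub3: "subgroup Z3 G"
  proof (rule finite_submonoid_subgroup[OF fin])
    show "Z3 \<subseteq> carrier G" using el_carr by (auto simp: Z3_def)
    show "\<one> \<in> Z3" unfolding Z3_def using el_one[symmetric] Z.one_closed by blast
    fix x y assume "x \<in> Z3" "y \<in> Z3"
    thus "x \<otimes> y \<in> Z3" unfolding Z3_def using el_mult[of _ _ 0 0 _ 0 0] Z.m_closed by fastforce
  qed
  have sub2: "subgroup Z2 G"
  proof (rule finite_submonoid_subgroup[OF fin])
    show "Z2 \<subseteq> carrier G" using el_carr by (auto simp: Z2_def)
    show "\<one> \<in> Z2" unfolding Z2_def using el_one[symmetric] Z.one_closed by blast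
    fix x y assume "x \<in> Z2" "y \<in> Z2"
    thus "x \<otimes> y \<in> Z2" unfolding Z2_def using el_mult[of _ _ 0 _ _ 0] Z.m_closed by fastforce
  qed
  have sub1: "subgroup Z1 G"
  proof (rule finite_submonoid_subgroup[OF fin])
    show "Z1 \<subseteq> carrier G" using el_carr by (auto simp: Z1_def)
    show "\<one> \<in> Z1" unfolding Z1_def using el_one[symmetric] Z.one_closed by blast
    fix x y assume "x \<in> Z1" "y \<in> Z1"
    then obtain a b c z a' b' c' z' where "z \<in> center G" "x = el a b c z"
      "z' \<in> center G" "y = el a' b' c' z'" by (auto simp: Z1_def)
    thus "x \<otimes> y \<in> Z1" unfolding Z1_def using el_mult[of z z' a b c a' b' c'] Z.m_closed[of z z'] by blast
  qed
  have in3: "el 0 0 c z \<in> Z3" and in2: "el 0 b c z \<in> Z2" and in1: "el a b c z \<in> Z1"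
    if "z \<in> center G" for a b c z
    using that by (auto simp: Z1_def Z2_def Z3_def)
  have Z1_comm: "u \<otimes> v = v \<otimes> u" if uv: "u \<in> Z1" "v \<in> Z1" for u v
  proof -
    obtain a b c z where u: "z \<in> center G" "u = el a b c z" using uv(1) by (auto simp: Z1_def)
    obtain a' b' c' z' where v: "z' \<in> center G" "v = el a' b' c' z'" using uv(2) by (auto simp: Z1_def)
    show ?thesis unfolding u(2) v(2) el_mult[OF u(1) v(1)] el_mult[OF v(1) u(1)]
      using center_commute[OF u(1) center_subset[OF v(1)]] by (simp add: add.commute)
  qed
  have a3_el: "a3 = el 0 0 1 \<one>" and a2_el: "a2 = el 0 1 0 \<one>" and a1_el: "a1 = el 1 0 0 \<one>"
    using carr by (simp_all add: el_def)
  have cZ: "center G \<subseteq> Z3"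
  proof
    fix z assume z: "z \<in> center G"
    have "el 0 0 0 z = z" using center_subset[OF z] by (simp add: el_def)
    thus "z \<in> Z3" using in3[OF z, of 0] by simp
  qed
  have Z32: "Z3 \<subseteq> Z2" and Z21: "Z2 \<subseteq> Z1" using in2 in1 by (auto simp: Z2_def Z3_def)
  have a_in: "a3 \<in> Z3" "a2 \<in> Z2" "a1 \<in> Z1"
    unfolding a3_el a2_el a1_el by (rule in3 in2 in1, rule Z.one_closed)+
  have a3Z1: "a3 \<in> Z1" using a_in Z32 Z21 by blast
  have inZ: "commutator G z g = \<one>" if "z \<in> center G" for z
    using that center_commute[OF that carr(1)] center_subset[OF that] carr
    by (simp add: commutator_eq_one_iff)
  have a3Z: "a3 \<notin> center G" using inZ[of a3] fr by auto
  have ch1: "center G \<subset> Z3" using cZ a3Z a_in by blast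
  have a2Z: "a2 \<notin> Z3"
  proof
    assume "a2 \<in> Z3"
    then obtain c z where "z \<in> center G" "a2 = el 0 0 c z" by (auto simp: Z3_def)
    hence "a3 = el 0 0 0 (a4 [^] c)" using comm_el[of z 0 0 c] fr by simp
    thus False using a3Z a4p carr by (simp add: el_def)
  qed
  have ch2: "Z3 \<subset> Z2" using a2Z a_in Z32 by blast
  have a1Z: "a1 \<notin> Z2"
  proof
    assume "a1 \<in> Z2"
    then obtain b c z where "z \<in> center G" "a1 = el 0 b c z" by (auto simp: Z2_def)
    hence "a2 = el 0 0 b (a4 [^] c)" using comm_el[of z 0 b c] fr by simp
    thus False using a2Z a4p by (auto simp: Z3_def)
  qed
  have ch3: "Z2 \<subset> Z1" using a1Z a_in Z21 by blast
  have gZ: "g \<notin> Z1"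
  proof
    assume "g \<in> Z1"
    hence "commutator G a3 g = \<one>" using Z1_comm[OF a3Z1] carr by (simp add: commutator_eq_one_iff)
    thus False using fr by simp
  qed
  have ch4: "Z1 \<subset> carrier G" using gZ carr(1) subgroup.subset[OF sub1] by blast
  note strict = card_subgroup_strict[OF fin ord p]
  \<comment> \<open>Each of the four strict inclusions between subgroups costs a factor of at least
    \<open>p\<close>.\<close>
  have "p * (p * (p * (p * card (center G)))) \<le> p * (p * (p * card Z3))"
    using strict[OF subgroup_center sub3 ch1] by (intro mult_le_mono2)
  also have "\<dots> \<le> p * (p * card Z2)"
    using strict[OF sub3 sub2 ch2] by (intro mult_le_mono2)
  also have "\<dots> \<le> p * card Z1"
    using strict[OF sub2 sub1 ch3] by (intro mult_le_mono2)
  also have "\<dots> \<le> p ^ 5"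
    using strict[OF sub1 subgroup_self ch4] ord[unfolded Coset.order_def] by simp
  finally have "p ^ 4 * card (center G) \<le> p ^ 4 * p" by (simp add: eval_nat_numeral mult_ac)
  hence cardZ: "card (center G) \<le> p" using p0 by simp
  define Z4 where "Z4 = {a4 [^] n | n :: nat. True}"
  have sub4: "subgroup Z4 G"
  proof (rule finite_submonoid_subgroup[OF fin])
    show "\<one> \<in> Z4" unfolding Z4_def by (auto intro: exI[of _ 0])
    fix x y assume "x \<in> Z4" "y \<in> Z4"
    then obtain m n :: nat where "x = a4 [^] m" "y = a4 [^] n" by (auto simp: Z4_def)
    thus "x \<otimes> y \<in> Z4" using carr by (auto simp: Z4_def nat_pow_mult)
  qed (use carr in \<open>auto simp: Z4_def\<close>)
  have "a4 [^] (1::nat) \<in> Z4" unfolding Z4_def by blast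
  hence "{\<one>} \<subset> Z4" using a4 carr subgroup.one_closed[OF sub4] by auto
  hence "p \<le> card Z4" using card_subgroup_strict[OF fin ord p triv_subgroup sub4] by simp
  moreover have "Z4 \<subseteq> center G" using a4p by (auto simp: Z4_def)
  \<comment> \<open>The nontrivial element \<open>a4\<close> has at least \<open>p\<close> powers,
    which exhaust a centre of at most \<open>p\<close> elements.\<close>
  ultimately have Z4: "Z4 = center G"
    using cardZ by (intro card_seteq) (auto intro: finite_subset[OF Z.subset fin])
  have a4_ord: "p dvd i" if "a4 [^] i = \<one>" for i :: nat
  proof -
    have "ord a4 dvd i" using that carr by (simp add: pow_eq_id)
    moreover have "ord a4 dvd p ^ 5" using ord_dvd_group_order[OF carr(5)] ord by simp
    then obtain k where "ord a4 = p ^ k" using divides_primepow_nat[OF p] by blast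
    moreover have "ord a4 \<noteq> 1" using a4 carr pow_eq_id[of a4 1] by auto
    ultimately show ?thesis by (cases k) (auto intro: dvd_trans)
  qed
  have a3g: "a3 \<otimes> g [^] i = g [^] i \<otimes> (a3 \<otimes> a4 [^] i)" for i :: nat
  proof (induction i)
    case (Suc i)
    have "a3 \<otimes> g [^] Suc i = g [^] i \<otimes> (a3 \<otimes> a4 [^] i) \<otimes> g"
      using carr Suc by (simp flip: m_assoc)
    also have "\<dots> = g [^] i \<otimes> (a3 \<otimes> g \<otimes> a4 [^] i)"
      using carr center_commute[OF a4p carr(1)] by (simp add: m_assoc)
    also have "\<dots> = g [^] Suc i \<otimes> (a3 \<otimes> a4 [^] Suc i)"
      unfolding gc(3) using carr pow_commute[OF carr(5,5), of i] by (simp add: m_assoc)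
    finally show ?case .
  qed (use carr in simp)
  \<comment> \<open>Moving \<open>a3\<close> past \<open>g [^] i\<close> produces
    \<open>a4 [^] i\<close>, and the order of \<open>a4\<close> is a multiple of \<open>p\<close>;
    conversely \<open>g [^] p\<close> is central.\<close>
  have gi_comm: "a3 \<otimes> g [^] i = g [^] i \<otimes> a3 \<longleftrightarrow> p dvd i" for i :: nat
  proof
    assume "a3 \<otimes> g [^] i = g [^] i \<otimes> a3"
    hence "a4 [^] i = \<one>" using a3g[of i] carr by simp
    thus "p dvd i" by (rule a4_ord)
  next
    assume "p dvd i"
    then obtain j where "i = p * j" by blast
    hence "g [^] i = (g [^] p) [^] j" using carr by (simp add: nat_pow_pow)
    hence "g [^] i \<in> center G" using zpow fr by simp
    thus "a3 \<otimes> g [^] i = g [^] i \<otimes> a3" using center_commute carr by simp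
  qed
  have span: "\<exists>i::nat. \<exists>a\<in>Z1. x = g [^] i \<otimes> a" if "x \<in> carrier G" for x
    using fr that unfolding Z1_def el_def by blast
  interpret Z1: subgroup Z1 G by (rule sub1)
  have g_conj: "\<exists>n'\<in>Z1. n \<otimes> g [^] i = g [^] i \<otimes> n'" if "n \<in> Z1" for n and i :: nat
  proof (induction i)
    case 0
    thus ?case using that by auto
  next
    case (Suc i)
    then obtain n' where n': "n' \<in> Z1" "n \<otimes> g [^] i = g [^] i \<otimes> n'" by blast
    then obtain a b c z where z: "z \<in> center G" "n' = el a b c z" by (auto simp: Z1_def)
    define n'' where "n'' = el a b c z \<otimes> el 0 a b (a4 [^] c)"
    have n'': "n'' \<in> Z1" "n' \<otimes> g = g \<otimes> n''"
      unfolding n''_def z(2) using el_g[OF z(1)] subgroup.m_closed[OF sub1 in1[OF z(1)] in1[OF a4p]] by auto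
    have "n \<otimes> g [^] Suc i = g [^] i \<otimes> (n' \<otimes> g)"
      using carr that n' by (simp add: m_assoc[symmetric])
    also have "\<dots> = g [^] Suc i \<otimes> n''" using carr n' n'' by (simp add: m_assoc)
    finally show ?case using n'' by blast
  qed
  define N where "N = {x \<in> carrier G. \<forall>n\<in>Z1. inv x \<otimes> n \<otimes> x \<in> Z1}"
  have Nall: "N = carrier G"
  proof
    show "N \<subseteq> carrier G" by (auto simp: N_def)
    show "carrier G \<subseteq> N"
    proof
      fix x assume "x \<in> carrier G"
      then obtain i :: nat and a where x: "a \<in> Z1" "x = g [^] i \<otimes> a" using span by blast
      have "inv x \<otimes> n \<otimes> x \<in> Z1" if n: "n \<in> Z1" for n
      proof -
        obtain n' where n': "n' \<in> Z1" "n \<otimes> g [^] i = g [^] i \<otimes> n'" using g_conj[OF n] by blast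
        have "inv x \<otimes> n \<otimes> x = inv a \<otimes> inv (g [^] i) \<otimes> (n \<otimes> g [^] i) \<otimes> a"
          using x carr n by (simp add: m_assoc inv_mult_group)
        also have "\<dots> = inv a \<otimes> n' \<otimes> a"
          unfolding n'(2) using x carr n' by (simp add: m_assoc) (simp flip: m_assoc)
        finally show ?thesis using x n' by simp
      qed
      thus "x \<in> N" using \<open>x \<in> carrier G\<close> by (auto simp: N_def)
    qed
  qed
  have normZ1: "x \<otimes> n \<otimes> inv x \<in> Z1" if "x \<in> carrier G" "n \<in> Z1" for x n
  proof -
    have "inv x \<in> N" using Nall that by simp
    thus ?thesis using that by (auto simp: N_def)
  qed
  have der: "derived G (carrier G) \<subseteq> Z1"
    unfolding derived_def
  proof (rule generate_subgroup_incl[OF _ sub1], rule subsetI)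
    fix c assume "c \<in> derived_set G (carrier G)"
    then obtain u v where uv: "u \<in> carrier G" "v \<in> carrier G" "c = u \<otimes> v \<otimes> inv u \<otimes> inv v" by blast
    obtain i :: nat and a where u: "a \<in> Z1" "u = g [^] i \<otimes> a" using span uv(1) by blast
    obtain j :: nat and b where v: "b \<in> Z1" "v = g [^] j \<otimes> b" using span uv(2) by blast
    obtain a' where a': "a' \<in> Z1" "a \<otimes> g [^] j = g [^] j \<otimes> a'" using g_conj[OF u(1)] by blast
    obtain b' where b': "b' \<in> Z1" "b \<otimes> g [^] i = g [^] i \<otimes> b'" using g_conj[OF v(1)] by blast
    have "u \<otimes> v = g [^] i \<otimes> (a \<otimes> g [^] j) \<otimes> b" using u v carr by (simp add: m_assoc)
    also have "\<dots> = g [^] (i + j) \<otimes> (a' \<otimes> b)" unfolding a'(2) using a' v carr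
      by (simp add: m_assoc flip: nat_pow_mult)
    finally have uv': "u \<otimes> v = g [^] (i + j) \<otimes> (a' \<otimes> b)" .
    have "v \<otimes> u = g [^] j \<otimes> (b \<otimes> g [^] i) \<otimes> a" using u v carr by (simp add: m_assoc)
    also have "\<dots> = g [^] (j + i) \<otimes> (b' \<otimes> a)" unfolding b'(2) using b' u carr
      by (simp add: m_assoc flip: nat_pow_mult)
    finally have vu': "v \<otimes> u = g [^] (i + j) \<otimes> (b' \<otimes> a)" by (simp add: add.commute)
    have "c = (u \<otimes> v) \<otimes> inv (v \<otimes> u)" using uv by (simp add: inv_mult_group m_assoc)
    also have "\<dots> = g [^] (i + j) \<otimes> ((a' \<otimes> b) \<otimes> inv (b' \<otimes> a)) \<otimes> inv (g [^] (i + j))"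
      unfolding uv' vu' using a' b' u v carr by (simp add: inv_mult_group m_assoc)
    also have "\<dots> \<in> Z1" using a' b' u v carr by (intro normZ1) auto
    finally show "c \<in> Z1" .
  qed
  have a3d: "a3 \<in> derived G (carrier G)" using fr commutator_derived carr by metis
  have C: "centralizer G (derived G (carrier G)) = Z1"
  proof (intro equalityI subsetI)
    fix x assume "x \<in> Z1"
    thus "x \<in> centralizer G (derived G (carrier G))"
      using der Z1_comm by (auto simp: centralizer_def)
  next
    fix x assume x: "x \<in> centralizer G (derived G (carrier G))"
    hence xc: "x \<in> carrier G" "x \<otimes> a3 = a3 \<otimes> x" using a3d by (auto simp: centralizer_def)
    obtain i :: nat and a where xa: "a \<in> Z1" "x = g [^] i \<otimes> a" using span xc(1) by blast
    \<comment> \<open>The factor \<open>a\<close> commutes with \<open>a3\<close>, so only the power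
      of \<open>g\<close> decides.\<close>
    have "g [^] i \<otimes> a3 \<otimes> a = a3 \<otimes> g [^] i \<otimes> a"
      using xc(2) Z1_comm[OF xa(1) a3Z1] carr xa by (simp add: m_assoc)
    hence "g [^] i \<otimes> a3 = a3 \<otimes> g [^] i" using carr xa by (subst (asm) r_cancel) auto
    hence "p dvd i" using gi_comm[of i] by simp
    then obtain j where "i = p * j" by blast
    hence "g [^] i = (g [^] p) [^] j" using carr by (simp add: nat_pow_pow)
    hence "g [^] i \<in> center G" using zpow fr by simp
    hence "g [^] i \<in> Z1" using cZ by (fastforce simp: Z1_def Z3_def)
    thus "x \<in> Z1" using xa by simp
  qed
  show ?thesis unfolding C
  proof
    show "\<exists>n. card Z1 = p ^ n"
      using lagrange[OF sub1] ord divides_primepow_nat[OF p] by (metis dvd_triv_right)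
    fix i :: nat
    show "g [^] i \<in> Z1 \<longleftrightarrow> p dvd i"
    proof
      assume "g [^] i \<in> Z1"
      thus "p dvd i" using gi_comm[of i] Z1_comm[OF a3Z1] by blast
    next
      assume "p dvd i"
      then obtain j where "i = p * j" by blast
      hence "g [^] i = (g [^] p) [^] j" using carr by (simp add: nat_pow_pow)
      hence "g [^] i \<in> center G" using zpow fr by simp
      thus "g [^] i \<in> Z1" using cZ by (fastforce simp: Z1_def Z3_def)
    qed
  next
    fix v assume "v \<in> Z1"
    then obtain a b c z where v: "z \<in> center G" "v = el a b c z" by (auto simp: Z1_def)
    obtain e :: nat and z' where ez: "z' \<in> center G" "a1 [^] p = a3 [^] e \<otimes> z'" using fr by blast
    have 1: "(a1 [^] p) [^] a = el 0 0 (e * a) (z' [^] a)"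
    proof -
      have "a1 [^] p = el 0 0 e z'" using ez carr center_subset[OF ez(1)] by (simp add: el_def)
      thus ?thesis using el_pow[OF ez(1), of 0 0 e a] by simp
    qed
    have 2: "(a2 [^] p) [^] b \<in> center G" "(a3 [^] p) [^] c \<in> center G"
      using zpow fr by blast+
    \<comment> \<open>All factors after the first are central, and the first is a power of
      \<open>a3\<close> times a central element.\<close>
    have "v [^] p = (a1 [^] p) [^] a \<otimes> ((a2 [^] p) [^] b \<otimes> ((a3 [^] p) [^] c \<otimes> z [^] p))"
      unfolding v(2) el_pow[OF v(1)] using carr by (simp add: el_def nat_pow_pow mult.commute)
    also have "\<dots> = el 0 0 (e * a) (z' [^] a \<otimes> ((a2 [^] p) [^] b \<otimes> ((a3 [^] p) [^] c \<otimes> z [^] p)))"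
      unfolding 1 using carr center_subset ez(1) v(1) 2 by (simp add: el_def m_assoc)
    finally obtain c' z'' where c': "z'' \<in> center G" "v [^] p = el 0 0 c' z''"
      using 2 zpow[OF v(1), of p] zpow[OF ez(1), of a] by (metis Z.m_closed)
    obtain d :: nat where d: "z'' = a4 [^] d" using c'(1) Z4 by (auto simp: Z4_def)
    \<comment> \<open>Two shifts carry the exponents of \<open>a1\<close> and \<open>a2\<close> to
      \<open>a3\<close> and \<open>a4\<close>, which dictates the choice of \<open>c'\<close> and
      \<open>d\<close> as coordinates.\<close>
    have "commutator G (commutator G (el c' d 0 \<one>) g) g = el 0 0 c' (a4 [^] d)"
      using comm_el[OF Z.one_closed, of c' d 0] comm_el[OF Z.one_closed, of 0 c' d] by simp
    moreover have "el c' d 0 \<one> \<in> Z1" by (rule in1[OF Z.one_closed])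
    ultimately show "\<exists>b\<in>Z1. v [^] p = commutator G (commutator G b g) g"
      using c' d by metis
  qed (use fin p sub1 Z1_comm der carr span in auto)
qed

section \<open>Cyclic subgroups and conjugate characters\<close>

lemma finite_units_below: "finite (units_below p k)"
  by (simp add: units_below_def)

lemma card_units_below_pos:
  assumes "Factorial_Ring.prime p"
  shows "card (units_below p k) > 0"
proof -
  have "1 < p ^ Suc k" using prime_gt_1_nat[OF assms] by (intro one_less_power) auto
  hence "1 \<in> units_below p k" using assms by (auto simp: units_below_def)
  thus ?thesis by (auto simp: card_gt_0_iff finite_units_below)
qed

lemma coprime_units_below:
  fixes p r k :: nat
  assumes "Factorial_Ring.prime p"
  shows "coprime r (p ^ Suc k) \<longleftrightarrow> \<not> p dvd r"
proof
  assume "coprime r (p ^ Suc k)"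
  moreover have "p dvd p ^ Suc k" by simp
  ultimately show "\<not> p dvd r" using assms by (metis coprime_common_divisor_nat not_prime_1)
next
  assume "\<not> p dvd r"
  hence "coprime p r" using assms by (rule prime_imp_coprime[rotated])
  thus "coprime r (p ^ Suc k)" by (simp add: coprime_commute)
qed

text \<open>The difference of the two torsion sets consists of the elements of order exactly
  \<open>p ^ Suc k\<close>. These are partitioned by the cyclic subgroup that they generate, and the
  generators of one such subgroup correspond to the units modulo \<open>p ^ Suc k\<close>.\<close>

lemma (in group) card_torsion_num_cyclic_subgroups:
  assumes fin: "finite (carrier G)" and p: "Factorial_Ring.prime p"
  shows "card {x \<in> carrier G. x [^] (p ^ Suc k) = \<one>} =
    card {x \<in> carrier G. x [^] (p ^ k) = \<one>} +
    card (units_below p k) * num_cyclic_subgroups G (p ^ Suc k)"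
proof -
  define d where "d = p ^ Suc k"
  have p1: "p > 1" using p by (rule prime_gt_1_nat)
  have d0: "d > 0" using p1 by (simp add: d_def)
  define S where "S = {x \<in> carrier G. ord x = d}"
  define Cyc where "Cyc = {H. subgroup H G \<and> cyclic_group (G\<lparr>carrier := H\<rparr>) \<and> card H = d}"
  have gen: "generate G {y} = {y [^] n | n :: nat. n \<in> UNIV}" if "y \<in> carrier G" for y
    using generate_pow_on_finite_carrier[OF fin that] by simp
  have finS: "finite S" using fin by (simp add: S_def)
  have "{x \<in> carrier G. x [^] (p ^ Suc k) = \<one>} = {x \<in> carrier G. x [^] (p ^ k) = \<one>} \<union> S"
  proof (intro equalityI subsetI)
    fix x assume x: "x \<in> {x \<in> carrier G. x [^] (p ^ Suc k) = \<one>}"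
    hence "ord x dvd p ^ Suc k" using pow_eq_id by blast
    then obtain j where j: "j \<le> Suc k" "ord x = p ^ j" using divides_primepow_nat[OF p] by blast
    show "x \<in> {x \<in> carrier G. x [^] (p ^ k) = \<one>} \<union> S"
    proof (cases "j = Suc k")
      case False
      hence "ord x dvd p ^ k" using j by (auto intro: le_imp_power_dvd)
      thus ?thesis using x by (auto simp: pow_eq_id)
    qed (use x j in \<open>auto simp: S_def d_def\<close>)
  next
    fix x assume "x \<in> {x \<in> carrier G. x [^] (p ^ k) = \<one>} \<union> S"
    thus "x \<in> {x \<in> carrier G. x [^] (p ^ Suc k) = \<one>}"
      by (auto simp: S_def d_def pow_eq_id)
  qed
  moreover have "{x \<in> carrier G. x [^] (p ^ k) = \<one>} \<inter> S = {}"
  proof -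
    have "\<not> p ^ Suc k dvd p ^ k" using p1 power_dvd_imp_le[of p "Suc k" k] by auto
    thus ?thesis by (auto simp: S_def d_def pow_eq_id)
  qed
  ultimately have cardT: "card {x \<in> carrier G. x [^] (p ^ Suc k) = \<one>} =
      card {x \<in> carrier G. x [^] (p ^ k) = \<one>} + card S"
    using fin finS by (simp add: card_Un_disjoint)
  have img: "(\<lambda>x. generate G {x}) ` S = Cyc"
  proof (intro equalityI subsetI)
    fix H assume "H \<in> (\<lambda>x. generate G {x}) ` S"
    then obtain x where x: "x \<in> carrier G" "ord x = d" "H = generate G {x}" by (auto simp: S_def)
    have sub: "subgroup H G" unfolding x(3) by (rule generate_is_subgroup) (use x in simp)
    interpret K: group "G\<lparr>carrier := H\<rparr>" by (rule subgroup_imp_group[OF sub])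
    have xH: "x \<in> H" unfolding x(3) by (rule generate.incl) simp
    have "H = range (\<lambda>n::int. x [^] n)" unfolding x(3) using generate_pow[OF x(1)] by auto
    hence "carrier (G\<lparr>carrier := H\<rparr>) = range (\<lambda>n::int. x [^]\<^bsub>G\<lparr>carrier := H\<rparr>\<^esub> n)"
      using int_pow_consistent[OF sub xH] by simp
    hence "cyclic_group (G\<lparr>carrier := H\<rparr>)" unfolding K.cyclic_group using xH by auto
    moreover have "card H = d" using generate_pow_card[OF x(1)] x by simp
    ultimately show "H \<in> Cyc" using sub by (simp add: Cyc_def)
  next
    fix H assume "H \<in> Cyc"
    hence H: "subgroup H G" "cyclic_group (G\<lparr>carrier := H\<rparr>)" "card H = d" by (auto simp: Cyc_def)
    interpret K: group "G\<lparr>carrier := H\<rparr>" by (rule subgroup_imp_group[OF H(1)])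
    obtain x where x: "x \<in> H" "H = range (\<lambda>n::int. x [^]\<^bsub>G\<lparr>carrier := H\<rparr>\<^esub> n)"
      using H(2) unfolding K.cyclic_group by auto
    have xc: "x \<in> carrier G" using x(1) subgroup.subset[OF H(1)] by blast
    have "H = range (\<lambda>n::int. x [^] n)" using x(2) int_pow_consistent[OF H(1) x(1)] by simp
    hence "H = generate G {x}" using generate_pow[OF xc] by auto
    moreover have "ord x = d" using generate_pow_card[OF xc] calculation H(3) by simp
    ultimately show "H \<in> (\<lambda>x. generate G {x}) ` S" using xc by (auto simp: S_def)
  qed
  have fib: "card {x \<in> S. generate G {x} = H} = card (units_below p k)" if "H \<in> Cyc" for H
  proof -
    from that obtain y where y: "y \<in> carrier G" "ord y = d" "H = generate G {y}"
      unfolding img[symmetric] by (auto simp: S_def)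
    have finH: "finite H" using y(3) fin generate_incl[of "{y}"] y(1) by (auto intro: finite_subset)
    have "{x \<in> S. generate G {x} = H} = (\<lambda>r. y [^] r) ` units_below p k"
    proof (intro equalityI subsetI)
      fix x assume "x \<in> {x \<in> S. generate G {x} = H}"
      hence x: "x \<in> carrier G" "ord x = d" "generate G {x} = H" by (auto simp: S_def)
      have "x \<in> H" unfolding x(3)[symmetric] by (rule generate.incl) simp
      then obtain n :: nat where n: "x = y [^] n" using gen[OF y(1)] y(3) by auto
      have "coprime n d" using pow_ord_eq_ord_iff[OF fin y(1), of n] x(2) y(2) n by simp
      moreover have "p dvd d" by (simp add: d_def)
      ultimately have "\<not> p dvd n" using p by (metis coprime_common_divisor_nat not_prime_1)
      hence "\<not> p dvd n mod d" using \<open>p dvd d\<close> by (simp add: dvd_mod_iff)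
      hence "n mod d \<in> units_below p k" using d0 by (simp add: units_below_def d_def)
      moreover have "x = y [^] (n mod d)"
      proof -
        have "y [^] n = y [^] (d * (n div d) + n mod d)" by simp
        also have "\<dots> = (y [^] d) [^] (n div d) \<otimes> y [^] (n mod d)"
          by (simp only: nat_pow_mult[OF y(1), symmetric] nat_pow_pow[OF y(1)])
        also have "\<dots> = y [^] (n mod d)" using y pow_ord_eq_1[OF y(1)] by simp
        finally show ?thesis using n by simp
      qed
      ultimately show "x \<in> (\<lambda>r. y [^] r) ` units_below p k" by blast
    next
      fix x assume "x \<in> (\<lambda>r. y [^] r) ` units_below p k"
      then obtain r where r: "\<not> p dvd r" "x = y [^] r" by (auto simp: units_below_def)
      have "coprime r d" unfolding d_def coprime_units_below[OF p] by (rule r)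
      hence ox: "ord x = d" using pow_ord_eq_ord_iff[OF fin y(1), of r] y(2) r by simp
      have xc: "x \<in> carrier G" using r y by simp
      have "x \<in> H" using r gen[OF y(1)] y(3) by auto
      hence "generate G {x} \<subseteq> H" unfolding y(3)
        by (intro generate_subgroup_incl generate_is_subgroup) (use y in auto)
      moreover have "card (generate G {x}) = card H"
        using generate_pow_card[OF xc] generate_pow_card[OF y(1)] ox y by simp
      ultimately have "generate G {x} = H" using finH by (intro card_subset_eq)
      thus "x \<in> {x \<in> S. generate G {x} = H}" using xc ox by (simp add: S_def)
    qed
    moreover have "inj_on (\<lambda>r. y [^] r) (units_below p k)"
      by (rule inj_on_subset[OF ord_inj[OF y(1)]]) (use y(2) in \<open>auto simp: units_below_def d_def\<close>)
    ultimately show ?thesis by (simp add: card_image)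
  qed
  have "card S = (\<Sum>H\<in>Cyc. card {x \<in> S. generate G {x} = H})"
    using sum.image_gen[OF finS, of "\<lambda>_. 1::nat" "\<lambda>x. generate G {x}"] by (simp add: img)
  also have "\<dots> = card (units_below p k) * card Cyc" by (simp add: fib)
  finally show ?thesis using cardT by (simp add: num_cyclic_subgroups_def Cyc_def d_def)
qed

text \<open>This makes the summand for \<open>d = 1\<close> empty, as it must be: a character of
  order 1 is trivial on the derived subgroup.\<close>

lemma (in group) num_cyclic_subgroups_1: "num_cyclic_subgroups G 1 = 1"
proof -
  have "{H. subgroup H G \<and> cyclic_group (G\<lparr>carrier := H\<rparr>) \<and> card H = 1} = {{\<one>}}"
  proof (intro equalityI subsetI)
    fix H assume "H \<in> {H. subgroup H G \<and> cyclic_group (G\<lparr>carrier := H\<rparr>) \<and> card H = 1}"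
    hence "subgroup H G" "card H = 1" by auto
    thus "H \<in> {{\<one>}}" using subgroup.one_closed[of H G] by (auto simp: card_1_singleton_iff)
  next
    fix H assume "H \<in> {{\<one>}}"
    hence H: "H = {\<one>}" by simp
    interpret K: group "G\<lparr>carrier := {\<one>}\<rparr>" by (rule subgroup_imp_group[OF triv_subgroup])
    have "cyclic_group (G\<lparr>carrier := {\<one>}\<rparr>)"
      by (rule trivial_imp_cyclic_group) (simp add: trivial_group_def K.is_group)
    thus "H \<in> {H. subgroup H G \<and> cyclic_group (G\<lparr>carrier := H\<rparr>) \<and> card H = 1}"
      using triv_subgroup H by simp
  qed
  thus ?thesis by (simp add: num_cyclic_subgroups_def)
qed

lemma (in group) num_cyclic_subgroups_pos_imp:
  assumes "finite (carrier G)" "num_cyclic_subgroups G d > 0"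
  shows "\<exists>x\<in>carrier G. ord x = d"
proof -
  obtain H where H: "subgroup H G" "cyclic_group (G\<lparr>carrier := H\<rparr>)" "card H = d"
    using assms(2) unfolding num_cyclic_subgroups_def by (metis (mono_tags, lifting) card.empty empty_Collect_eq not_gr0)
  interpret K: group "G\<lparr>carrier := H\<rparr>" by (rule subgroup_imp_group[OF H(1)])
  obtain x where x: "x \<in> H" "H = range (\<lambda>n::int. x [^]\<^bsub>G\<lparr>carrier := H\<rparr>\<^esub> n)"
    using H(2) unfolding K.cyclic_group by auto
  have xc: "x \<in> carrier G" using x(1) subgroup.subset[OF H(1)] by blast
  have "H = range (\<lambda>n::int. x [^] n)" using x(2) int_pow_consistent[OF H(1) x(1)] by simp
  hence "H = generate G {x}" using generate_pow[OF xc] by auto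
  thus ?thesis using generate_pow_card[OF xc] H(3) xc by auto
qed

lemma (in group) exponent_dvd_iff:
  assumes "finite (carrier G)"
  shows "exponent G dvd n \<longleftrightarrow> (\<forall>x\<in>carrier G. x [^] n = \<one>)"
    and "exponent G > 0" and "x \<in> carrier G \<Longrightarrow> ord x dvd exponent G"
    and "exponent G dvd Coset.order G"
proof -
  let ?P = "\<lambda>n::nat. n > 0 \<and> (\<forall>x\<in>carrier G. x [^] n = \<one>)"
  have "?P (Coset.order G)" using assms pow_order_eq_1 by (auto simp: order_gt_0_iff_finite)
  hence e: "?P (exponent G)" unfolding exponent_def by (rule LeastI)
  show pos: "exponent G > 0" using e by blast
  have min: "exponent G \<le> n" if "?P n" for n unfolding exponent_def using that by (rule Least_le)
  have all: "exponent G dvd n" if n: "\<forall>x\<in>carrier G. x [^] n = \<one>" for n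
  proof (rule ccontr)
    assume "\<not> exponent G dvd n"
    hence "n mod exponent G > 0" by (simp add: dvd_eq_mod_eq_0)
    moreover have "x [^] (n mod exponent G) = \<one>" if "x \<in> carrier G" for x
    proof -
      have "ord x dvd n" "ord x dvd exponent G" using n e that by (auto simp: pow_eq_id)
      thus ?thesis using that by (simp add: pow_eq_id dvd_mod)
    qed
    ultimately have "exponent G \<le> n mod exponent G" by (intro min) auto
    thus False using pos mod_less_divisor[OF pos, of n] by simp
  qed
  show "exponent G dvd n \<longleftrightarrow> (\<forall>x\<in>carrier G. x [^] n = \<one>)"
  proof
    assume "exponent G dvd n"
    moreover have "\<forall>x\<in>carrier G. ord x dvd exponent G" using e by (auto simp: pow_eq_id)
    ultimately show "\<forall>x\<in>carrier G. x [^] n = \<one>" by (auto simp: pow_eq_id intro: dvd_trans)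
  qed (rule all)
  show "ord x dvd exponent G" if "x \<in> carrier G" using e that by (auto simp: pow_eq_id)
  show "exponent G dvd Coset.order G" by (intro all) (simp add: pow_order_eq_1)
qed

section \<open>Conjugation of characters\<close>

context cyclic_extension
begin

abbreviation "D \<equiv> derived G (carrier G)"
abbreviation "Ag \<equiv> G\<lparr>carrier := A\<rparr>"
abbreviation "chars \<equiv> characters Ag"
definition "cj x a = inv x \<otimes> a \<otimes> x"

lemma finite_A: "finite A"
  using finite_G subgroup.subset[OF subgroup_A] by (rule rev_finite_subset)

lemma A_carrier: "a \<in> A \<Longrightarrow> a \<in> carrier G"
  using subgroup.subset[OF subgroup_A] by blast

lemma finite_comm_group_A: "finite_comm_group Ag"
proof -
  interpret K: group Ag by (rule subgroup_imp_group[OF subgroup_A])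
  show ?thesis by unfold_locales (auto simp: abelian_A finite_A)
qed

end

sublocale cyclic_extension \<subseteq> C: finite_comm_group "G\<lparr>carrier := A\<rparr>"
  by (rule finite_comm_group_A)

sublocale cyclic_extension \<subseteq> SA: subgroup A G
  by (rule subgroup_A)

context cyclic_extension
begin

lemma chi_mult: "\<chi> \<in> chars \<Longrightarrow> a \<in> A \<Longrightarrow> b \<in> A \<Longrightarrow> \<chi> (a \<otimes> b) = \<chi> a * \<chi> b"
  using C.character_mult[of \<chi> a b] by simp

lemma chi_one: "\<chi> \<in> chars \<Longrightarrow> \<chi> \<one> = 1"
  using C.character_one[of \<chi>] by simp

lemma chi_outside: "\<chi> \<in> chars \<Longrightarrow> a \<notin> A \<Longrightarrow> \<chi> a = 0"
  using C.character_outside[of \<chi> a] by simp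

lemma chi_nonzero: "\<chi> \<in> chars \<Longrightarrow> a \<in> A \<Longrightarrow> \<chi> a \<noteq> 0"
  using C.character_nonzero[of \<chi> a] by simp

lemma pow_A: "a \<in> A \<Longrightarrow> a [^] (n::nat) \<in> A"
  by (induction n) auto

lemma chi_pow: "\<chi> \<in> chars \<Longrightarrow> a \<in> A \<Longrightarrow> \<chi> (a [^] (n::nat)) = \<chi> a ^ n"
  using C.character_pow[of \<chi> a n] nat_pow_consistent[of a n A] by simp

lemma chi_inv: "\<chi> \<in> chars \<Longrightarrow> a \<in> A \<Longrightarrow> \<chi> (inv a) = inverse (\<chi> a)"
  using C.character_inv[of \<chi> a] m_inv_consistent[OF subgroup_A, of a] by simp

lemma chi_card: "\<chi> \<in> chars \<Longrightarrow> a \<in> A \<Longrightarrow> \<chi> a ^ card A = 1"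
  using C.character_pow_order[of \<chi> a] by (simp add: Coset.order_def)

lemma chi_closedI:
  assumes "\<And>x. x \<notin> A \<Longrightarrow> \<chi> x = 0" "\<chi> \<one> = 1"
    and "\<And>x y. x \<in> A \<Longrightarrow> y \<in> A \<Longrightarrow> \<chi> (x \<otimes> y) = \<chi> x * \<chi> y"
  shows "\<chi> \<in> chars"
  by (rule C.characterI) (use assms in auto)

lemma cj_closed: "x \<in> carrier G \<Longrightarrow> a \<in> carrier G \<Longrightarrow> cj x a \<in> carrier G"
  by (simp add: cj_def)

lemma cj_A: assumes "x \<in> carrier G" "a \<in> A" shows "cj x a \<in> A"
proof -
  have "cj x a = a \<otimes> commutator G a x"
    using assms A_carrier by (simp add: cj_def commutator_def flip: m_assoc)
  thus ?thesis using commutator_derived[of a x] derived_A assms A_carrier by auto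
qed

lemma cj_mult: "x \<in> carrier G \<Longrightarrow> a \<in> carrier G \<Longrightarrow> b \<in> carrier G \<Longrightarrow> cj x (a \<otimes> b) = cj x a \<otimes> cj x b"
proof -
  assume c: "x \<in> carrier G" "a \<in> carrier G" "b \<in> carrier G"
  have "x \<otimes> (inv x \<otimes> (b \<otimes> x)) = b \<otimes> x" using c by (simp flip: m_assoc)
  thus ?thesis using c by (simp add: cj_def m_assoc)
qed

lemma cj_cj: "x \<in> carrier G \<Longrightarrow> y \<in> carrier G \<Longrightarrow> a \<in> carrier G \<Longrightarrow> cj y (cj x a) = cj (x \<otimes> y) a"
  by (simp add: cj_def inv_mult_group m_assoc)

lemma cj_one: "a \<in> carrier G \<Longrightarrow> cj \<one> a = a"
  by (simp add: cj_def)

lemma cj_inv_cancel: "x \<in> carrier G \<Longrightarrow> a \<in> carrier G \<Longrightarrow> cj (inv x) (cj x a) = a"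
   "x \<in> carrier G \<Longrightarrow> a \<in> carrier G \<Longrightarrow> cj x (cj (inv x) a) = a"
  by (simp_all add: cj_cj cj_one)

lemma cj_of_one: "x \<in> carrier G \<Longrightarrow> cj x \<one> = \<one>"
  by (simp add: cj_def)

lemma cj_A_iff: "x \<in> carrier G \<Longrightarrow> a \<in> carrier G \<Longrightarrow> cj x a \<in> A \<longleftrightarrow> a \<in> A"
  using cj_A[of x a] cj_A[of "inv x" "cj x a"] cj_inv_cancel(1)[of x a] by auto

lemma cj_abelian: "b \<in> A \<Longrightarrow> a \<in> A \<Longrightarrow> cj b a = a"
  using abelian_A[of a b] A_carrier by (simp add: cj_def m_assoc) (simp flip: m_assoc)

lemma gpow_closed: "g [^] (i::nat) \<in> carrier G"
  using g_closed by simp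

lemma cj_pow_p: "p dvd i \<Longrightarrow> a \<in> A \<Longrightarrow> cj (g [^] i) a = a"
  using g_pow_in_A cj_abelian by blast

lemma character_conj_pow:
  assumes "x \<in> carrier G" "\<And>a. a \<in> A \<Longrightarrow> \<chi> (cj x a) = \<chi> a ^ r" "a \<in> A"
  shows "(\<chi> :: 'a \<Rightarrow> complex) (cj (x [^] (n::nat)) a) = \<chi> a ^ (r ^ n)"
  using assms(3)
proof (induction n arbitrary: a)
  case (Suc n)
  have "cj (x [^] Suc n) a = cj x (cj (x [^] n) a)"
    using assms(1) Suc.prems A_carrier by (simp add: cj_cj)
  thus ?case using Suc assms(1,2) cj_A[of "x [^] n" a] by (simp add: power_mult[symmetric] mult.commute)
qed (use A_carrier in \<open>simp add: cj_one\<close>)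

text \<open>For u = g^i a and v = g^j b the products u v and v u have the same power of
  \<open>g\<close>, so the commutator is a conjugate of the quotient of their parts \<open>n\<close>
  and \<open>n'\<close> in \<open>A\<close>. An invariant \<chi> takes the value \<chi> a \<chi> b
  on both parts.\<close>

lemma character_invariant_trivial:
  assumes chi: "\<chi> \<in> chars" and inv: "\<And>a. a \<in> A \<Longrightarrow> \<chi> (cj g a) = \<chi> a" and c: "c \<in> D"
  shows "\<chi> c = 1"
proof -
  have invn: "\<chi> (cj (g [^] n) a) = \<chi> a" if "a \<in> A" for n :: nat and a
    using character_conj_pow[OF g_closed, of \<chi> 1 a n] inv that by simp
  have invi: "\<chi> (cj (inv (g [^] n)) a) = \<chi> a" if "a \<in> A" for n :: nat and a
    using invn[of "cj (inv (g [^] n)) a" n] that A_carrier cj_A cj_inv_cancel(2)[OF gpow_closed] gpow_closed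
    by simp
  define K where "K = {k \<in> A. \<chi> k = 1}"
  have K: "subgroup K G"
  proof
    show "K \<subseteq> carrier G" using A_carrier by (auto simp: K_def)
  qed (use chi in \<open>auto simp: K_def chi_mult chi_one chi_inv\<close>)
  have "D \<subseteq> K" unfolding derived_def
  proof (rule generate_subgroup_incl[OF _ K], rule subsetI)
    fix c assume "c \<in> derived_set G (carrier G)"
    then obtain u v where uv: "u \<in> carrier G" "v \<in> carrier G" "c = u \<otimes> v \<otimes> inv u \<otimes> inv v" by blast
    have "c \<in> derived G (carrier G)" unfolding derived_def
      by (rule generate.incl) fact
    hence cA: "c \<in> A" using derived_A by blast
    obtain i :: nat and a where u: "a \<in> A" "u = g [^] i \<otimes> a" using coset_rep uv(1) by blast
    obtain j :: nat and b where v: "b \<in> A" "v = g [^] j \<otimes> b" using coset_rep uv(2) by blast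
    note carr = A_carrier[OF u(1)] A_carrier[OF v(1)] gpow_closed
    define n where "n = cj (g [^] j) a \<otimes> b"
    define n' where "n' = cj (g [^] i) b \<otimes> a"
    have nA: "n \<in> A" "n' \<in> A" using u v by (auto simp: n_def n'_def cj_A gpow_closed)
    have can: "x \<otimes> (inv x \<otimes> w) = w" if "x \<in> carrier G" "w \<in> carrier G" for x w
      using that by (simp flip: m_assoc)
    have "u \<otimes> v = g [^] (i + j) \<otimes> n"
      using carr by (simp add: u v n_def cj_def m_assoc can g_closed flip: nat_pow_mult)
    moreover have "v \<otimes> u = g [^] (j + i) \<otimes> n'"
      using carr by (simp add: u v n'_def cj_def m_assoc can g_closed flip: nat_pow_mult)
    moreover have "c = (u \<otimes> v) \<otimes> inv (v \<otimes> u)" using uv by (simp add: inv_mult_group m_assoc)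
    ultimately have "c = (g [^] (i + j) \<otimes> n) \<otimes> inv (g [^] (i + j) \<otimes> n')" by (simp add: add.commute)
    also have "\<dots> = cj (inv (g [^] (i + j))) (n \<otimes> inv n')"
      using nA A_carrier g_closed by (simp add: cj_def inv_mult_group m_assoc)
    finally have "\<chi> c = \<chi> (n \<otimes> inv n')" using invi[of "n \<otimes> inv n'" "i + j"] nA by simp
    also have "\<dots> = \<chi> n * inverse (\<chi> n')" using nA chi by (simp add: chi_mult chi_inv)
    also have "\<chi> n = \<chi> n'" using chi u v invn by (simp add: n_def n'_def chi_mult cj_A gpow_closed)
    also have "\<chi> n' * inverse (\<chi> n') = 1" using chi_nonzero[OF chi nA(2)] by simp
    finally show "c \<in> K" using cA by (simp add: K_def)
  qed
  thus ?thesis using c by (auto simp: K_def)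
qed

text \<open>If conjugation by \<open>g\<close> raises \<open>\<chi>\<close> to the power \<open>r\<close>, then \<open>r = 1 + p s\<close> by Fermat, and evaluating \<open>\<chi>\<close> on
  \<open>a\<^sup>p = [[b, g], g]\<close> shows that every \<open>\<chi>(a)\<^sup>p\<close> is a power of some \<open>\<chi>(b)\<close> with exponent divisible by
  arbitrarily high powers of \<open>p\<close>, hence is \<open>1\<close>.\<close>

lemma character_conj_g_not_power:
  assumes chi: "\<chi> \<in> chars" and nontriv: "\<not> (\<forall>c\<in>D. \<chi> c = 1)"
    and r: "\<And>a. a \<in> A \<Longrightarrow> \<chi> (cj g a) = \<chi> a ^ r"
  shows False
proof -
  obtain N where N: "card A = p ^ N" using order_A by blast
  have p1: "p > 1" using prime_p by (rule prime_gt_1_nat)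
  have chiN: "\<chi> a ^ (p ^ N) = 1" if "a \<in> A" for a using chi_card[OF chi that] N by simp
  obtain a0 where a0: "a0 \<in> A" "\<chi> a0 \<noteq> 1" using nontriv derived_A by blast
  define j where "j = (LEAST j. \<chi> a0 ^ (p ^ j) = 1)"
  have j: "\<chi> a0 ^ (p ^ j) = 1" unfolding j_def by (rule LeastI) (rule chiN[OF a0(1)])
  have "j \<noteq> 0" using j a0(2) by (intro notI) simp
  then obtain j' where j': "j = Suc j'" by (cases j) auto
  \<comment> \<open>A value of \<chi> of order exactly \<open>p\<close>, on which exponents count
    only modulo \<open>p\<close>.\<close>
  define w where "w = \<chi> (a0 [^] (p ^ j'))"
  have wA: "a0 [^] (p ^ j') \<in> A" using a0 by (intro pow_A)
  have w: "w = \<chi> a0 ^ (p ^ j')" using a0 chi by (simp add: w_def chi_pow)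
  have w1: "w \<noteq> 1" using not_less_Least[of j' "\<lambda>j. \<chi> a0 ^ (p ^ j) = 1"] j' unfolding j_def[symmetric] w by simp
  have wp: "w ^ p = 1" using j unfolding w j' by (simp add: power_mult[symmetric] mult.commute)
  have wmod: "w ^ n = w ^ (n mod p)" for n
  proof -
    have "w ^ n = w ^ (p * (n div p) + n mod p)" by simp
    also have "\<dots> = w ^ (n mod p)" unfolding power_add power_mult wp by simp
    finally show ?thesis .
  qed
  \<comment> \<open>\<open>g [^] p\<close> lies in the abelian group \<open>A\<close>, so
    conjugating \<open>p\<close> times by \<open>g\<close> changes nothing.\<close>
  have "w ^ (r ^ p) = w"
    using character_conj_pow[where x = g and \<chi> = \<chi> and r = r and n = p, OF g_closed r wA]
    unfolding cj_pow_p[of p, OF dvd_refl wA] w_def by (rule HOL.sym)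
  moreover have "r ^ p mod p = r mod p"
  proof (cases "p dvd r")
    case True
    moreover have "p dvd r ^ p" using True p1 by (intro dvd_trans[OF True dvd_power]) auto
    ultimately show ?thesis by simp
  next
    case False
    have "[r ^ (p - 1) = 1] (mod p)" by (rule fermat_theorem[OF prime_p False])
    hence "[r ^ (p - 1) * r = 1 * r] (mod p)" by (rule cong_scalar_right)
    moreover have "r ^ (p - 1) * r = r ^ p" using p1 by (intro power_minus_mult) simp
    ultimately show ?thesis by (simp add: cong_def)
  qed
  ultimately have wr: "w ^ r = w" using wmod[of "r ^ p"] wmod[of r] by simp
  have r0: "r \<noteq> 0" using wr w1 by (intro notI) simp
  have w0: "w \<noteq> 0" using wA chi chi_nonzero by (auto simp: w_def)
  have wr1: "w ^ (r - 1) = 1"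
  proof -
    have "w * w ^ (r - 1) = w * 1" using wr r0 by (simp flip: power_Suc)
    thus ?thesis using w0 by simp
  qed
  have "p dvd r - 1"
  proof (rule ccontr)
    assume "\<not> p dvd r - 1"
    hence "coprime (r - 1) p" using prime_p by (metis coprime_commute prime_imp_coprime)
    moreover have "r - 1 > 0" using \<open>\<not> p dvd r - 1\<close> by (intro Nat.gr0I) auto
    ultimately obtain x y where "(r - 1) * x = p * y + 1"
      using bezout_nat[of "r - 1" p] by (auto simp: coprime_iff_gcd_eq_1)
    hence "w ^ ((r - 1) * x) = w ^ (p * y + 1)" by simp
    thus False using w1 wr1 wp by (simp add: power_mult)
  qed
  then obtain s where s: "r = p * s + 1" using r0 by (metis Suc_diff_1 Suc_eq_plus1 dvdE not_gr0)
  have comm: "\<chi> (commutator G a g) = \<chi> a ^ (p * s)" "commutator G a g \<in> A" if a: "a \<in> A" for a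
  proof -
    have eq: "commutator G a g = inv a \<otimes> cj g a"
      using a A_carrier g_closed by (simp add: commutator_def cj_def m_assoc)
    thus "commutator G a g \<in> A" using a cj_A g_closed by simp
    have "\<chi> (commutator G a g) = inverse (\<chi> a) * \<chi> a ^ r"
      using a chi r cj_A[OF g_closed a] by (simp add: eq chi_mult chi_inv)
    also have "\<dots> = \<chi> a ^ (p * s)" using chi_nonzero[OF chi a] by (simp add: s)
    finally show "\<chi> (commutator G a g) = \<chi> a ^ (p * s)" .
  qed
  \<comment> \<open>The double commutator multiplies the exponent by (p s)^2. One factor
    \<open>p\<close> stays with \<chi> b, so that the step can be applied again.\<close>
  have step: "\<exists>b\<in>A. \<chi> a ^ p = (\<chi> b ^ p) ^ (p * s * s)" if a: "a \<in> A" for a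
  proof -
    obtain b where b: "b \<in> A" "a [^] p = commutator G (commutator G b g) g" using pow_p[OF a] by blast
    have "\<chi> a ^ p = (\<chi> b ^ (p * s)) ^ (p * s)"
      using arg_cong[OF b(2), of \<chi>] chi_pow[OF chi a] comm[OF b(1)] comm(1)[OF comm(2)[OF b(1)]] by simp
    also have "\<dots> = (\<chi> b ^ p) ^ (p * s * s)" by (simp add: mult_ac flip: power_mult)
    finally show ?thesis using b by blast
  qed
  have "\<exists>b\<in>A. \<exists>t. \<chi> a ^ p = \<chi> b ^ (p ^ k * t)" if "a \<in> A" for a k
    using that
  proof (induction k arbitrary: a)
    case 0
    thus ?case by (intro bexI[of _ a] exI[of _ p]) auto
  next
    case (Suc k)
    obtain b where b: "b \<in> A" "\<chi> a ^ p = (\<chi> b ^ p) ^ (p * s * s)" using step Suc by blast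
    obtain c t where c: "c \<in> A" "\<chi> b ^ p = \<chi> c ^ (p ^ k * t)" using Suc.IH[OF b(1)] by blast
    have "\<chi> a ^ p = \<chi> c ^ (p ^ Suc k * (t * s * s))"
      unfolding b(2) c(2) by (simp add: mult_ac flip: power_mult)
    thus ?case using c by blast
  qed
  from this[of _ N] have "\<chi> a ^ p = 1" if "a \<in> A" for a
    using that chiN by (metis power_mult power_one)
  \<comment> \<open>Once all \<open>p\<close>-th powers of values are 1, the exponent
    \<open>p * s + 1\<close> acts like 1.\<close>
  hence "\<chi> (cj g a) = \<chi> a" if "a \<in> A" for a using r[OF that] that by (simp add: s power_mult)
  thus False using character_invariant_trivial[OF chi] nontriv by blast
qed

text \<open>As \<open>i\<close> is invertible modulo \<open>p\<close>, some power of
  \<open>g [^] i\<close> acts on \<open>A\<close> like \<open>g\<close>, which reduces the claim to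
  the case of \<open>g\<close>.\<close>

lemma character_conj_not_power:
  assumes chi: "\<chi> \<in> chars" and nontriv: "\<not> (\<forall>c\<in>D. \<chi> c = 1)" and i: "\<not> p dvd i"
    and r: "\<And>a. a \<in> A \<Longrightarrow> \<chi> (cj (g [^] (i::nat)) a) = \<chi> a ^ r"
  shows False
proof -
  have "coprime i p" using i prime_p by (metis coprime_commute prime_imp_coprime)
  moreover have "i > 0" using i by (intro Nat.gr0I) auto
  ultimately obtain j m where jm: "i * j = p * m + 1"
    using bezout_nat[of i p] by (auto simp: coprime_iff_gcd_eq_1)
  have "\<chi> (cj g a) = \<chi> a ^ (r ^ j)" if a: "a \<in> A" for a
  proof -
    have "\<chi> a ^ (r ^ j) = \<chi> (cj ((g [^] i) [^] j) a)"
      by (rule character_conj_pow[where x = "g [^] i" and \<chi> = \<chi>, OF gpow_closed r a, symmetric])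
    also have "(g [^] i) [^] j = g [^] (p * m) \<otimes> g"
      using g_closed by (simp add: nat_pow_pow jm)
    also have "cj (g [^] (p * m) \<otimes> g) a = cj g (cj (g [^] (p * m)) a)"
      using a g_closed A_carrier by (simp add: cj_cj)
    also have "\<dots> = cj g a" using cj_pow_p[of "p * m" a] a by simp
    finally show ?thesis by simp
  qed
  thus False using character_conj_g_not_power[OF chi nontriv] by blast
qed

end

section \<open>Orbits of characters\<close>

lemma inverse_mod_prime_power:
  fixes r :: nat
  assumes "Factorial_Ring.prime p" "\<not> p dvd r"
  obtains s m where "r * s = p ^ Suc k * m + 1" "\<not> p dvd s"
proof -
  have "coprime r (p ^ Suc k)" using coprime_units_below[OF assms(1)] assms(2) by blast
  moreover have "r > 0" using assms(2) by (intro Nat.gr0I) auto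
  ultimately obtain s m where sm: "r * s = p ^ Suc k * m + 1"
    using bezout_nat[of r "p ^ Suc k"] by (auto simp: coprime_iff_gcd_eq_1 simp del: power_Suc)
  have "\<not> p dvd s"
  proof
    assume "p dvd s"
    hence "p dvd p ^ Suc k * m + 1" using sm by (metis dvd_mult)
    hence "p dvd 1" by (subst (asm) dvd_add_right_iff) auto
    thus False using assms(1) by simp
  qed
  thus ?thesis using that sm by blast
qed

lemma root_of_unity_coprime:
  fixes w :: complex
  assumes "Factorial_Ring.prime p" "\<not> p dvd r" "w ^ (p ^ Suc k) = 1" "w ^ r = 1"
  shows "w = 1"
proof -
  obtain s m where "r * s = p ^ Suc k * m + 1" using inverse_mod_prime_power[OF assms(1,2), of k] by blast
  hence "w ^ (r * s) = w ^ (p ^ Suc k * m + 1)" by simp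
  thus ?thesis using assms(3,4) by (simp only: power_add power_mult) simp
qed

context cyclic_extension
begin

definition nontriv :: "('a \<Rightarrow> complex) \<Rightarrow> bool" where
  "nontriv \<chi> \<longleftrightarrow> \<not> (\<forall>c\<in>D. \<chi> c = 1)"

definition kills :: "nat \<Rightarrow> ('a \<Rightarrow> complex) \<Rightarrow> bool" where
  "kills n \<chi> \<longleftrightarrow> (\<forall>a\<in>A. \<chi> a ^ n = 1)"

text \<open>For prime \<open>p\<close> the two conditions with \<open>kills\<close> say that \<chi>
  has order exactly \<open>p ^ Suc k\<close>.\<close>

definition exact_chars :: "nat \<Rightarrow> ('a \<Rightarrow> complex) set" where
  "exact_chars k = {\<chi> \<in> chars. nontriv \<chi> \<and> kills (p ^ Suc k) \<chi> \<and> \<not> kills (p ^ k) \<chi>}"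

text \<open>Conjugation by \<open>x\<close> combined with the Galois substitution that raises roots
  of unity to the power \<open>r\<close>.\<close>

definition twist :: "'a \<Rightarrow> nat \<Rightarrow> ('a \<Rightarrow> complex) \<Rightarrow> 'a \<Rightarrow> complex" where
  "twist x r \<chi> = (\<lambda>a. if a \<in> A then \<chi> (cj x a) ^ r else 0)"

text \<open>The orbit relation for conjugation and Galois action together. Letting \<open>x\<close>
  range over all of \<open>G\<close>, not over powers of \<open>g\<close>, keeps transitivity free
  of normal forms.\<close>

definition sim :: "('a \<Rightarrow> complex) \<Rightarrow> ('a \<Rightarrow> complex) \<Rightarrow> bool" where
  "sim \<chi> \<chi>' \<longleftrightarrow> (\<exists>x\<in>carrier G. \<exists>r. \<not> p dvd r \<and> \<chi>' = twist x r \<chi>)"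

lemma p_gt_1: "p > 1"
  using prime_p by (rule prime_gt_1_nat)

lemma kills_mono: "kills m \<chi> \<Longrightarrow> m dvd n \<Longrightarrow> kills n \<chi>"
  unfolding kills_def by (metis dvdE power_mult power_one)

lemma finite_chars: "finite chars"
  by (rule C.finite_characters)

lemma finite_exact_chars: "finite (exact_chars k)"
  using finite_chars by (simp add: exact_chars_def)

lemma normal_D: "D \<lhd> G"
  by (rule derived_self_is_normal)

lemma subgroup_D: "subgroup D G"
  using normal_D by (simp add: normal_def)

lemma cj_D:
  assumes "x \<in> carrier G" "c \<in> D"
  shows "cj x c \<in> D"
  using normal.inv_op_closed1[OF normal_D assms] by (simp add: cj_def)

lemma twist_chars:
  assumes "\<chi> \<in> chars" "x \<in> carrier G"
  shows "twist x r \<chi> \<in> chars"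
proof (rule chi_closedI)
  show "twist x r \<chi> \<one> = 1"
    using assms by (simp add: twist_def cj_of_one chi_one)
  fix a b assume "a \<in> A" "b \<in> A"
  thus "twist x r \<chi> (a \<otimes> b) = twist x r \<chi> a * twist x r \<chi> b"
    using assms by (simp add: twist_def cj_mult A_carrier chi_mult cj_A power_mult_distrib)
qed (simp add: twist_def)

lemma twist_twist:
  assumes "x \<in> carrier G" "y \<in> carrier G"
  shows "twist y s (twist x r \<chi>) = twist (y \<otimes> x) (r * s) \<chi>"
  using assms by (auto simp: twist_def fun_eq_iff cj_A cj_cj A_carrier power_mult)

lemma twist_exact:
  assumes chi: "\<chi> \<in> exact_chars k" and x: "x \<in> carrier G" and r: "\<not> p dvd r"
  shows "twist x r \<chi> \<in> exact_chars k"
proof -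
  have c: "\<chi> \<in> chars" "nontriv \<chi>" "kills (p ^ Suc k) \<chi>" "\<not> kills (p ^ k) \<chi>"
    using chi by (auto simp: exact_chars_def)
  have "nontriv (twist x r \<chi>)"
    unfolding nontriv_def
  proof
    assume triv: "\<forall>c\<in>D. twist x r \<chi> c = 1"
    have "\<chi> d = 1" if d: "d \<in> D" for d
    proof -
      have dA: "d \<in> A" using d derived_A by blast
      have "cj (inv x) d \<in> D" using d x by (intro cj_D) auto
      hence "twist x r \<chi> (cj (inv x) d) = 1" "cj (inv x) d \<in> A" using triv derived_A by auto
      hence "\<chi> d ^ r = 1" using cj_inv_cancel(2)[OF x A_carrier[OF dA]] by (simp add: twist_def)
      thus ?thesis using root_of_unity_coprime[OF prime_p r, of "\<chi> d" k] c(3) dA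
        by (simp add: kills_def)
    qed
    thus False using c(2) by (simp add: nontriv_def)
  qed
  moreover have "kills (p ^ Suc k) (twist x r \<chi>)"
    unfolding kills_def
  proof
    fix a assume a: "a \<in> A"
    have "(\<chi> (cj x a) ^ r) ^ (p ^ Suc k) = (\<chi> (cj x a) ^ (p ^ Suc k)) ^ r"
      by (simp only: power_mult[symmetric] mult.commute)
    also have "\<dots> = 1" using c(3) cj_A[OF x a] unfolding kills_def by simp
    finally show "twist x r \<chi> a ^ (p ^ Suc k) = 1" using a by (simp add: twist_def)
  qed
  moreover have "\<not> kills (p ^ k) (twist x r \<chi>)"
  proof
    assume kl: "kills (p ^ k) (twist x r \<chi>)"
    have "\<chi> b ^ (p ^ k) = 1" if b: "b \<in> A" for b
    proof -
      have "cj (inv x) b \<in> A" using b x by (intro cj_A) auto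
      hence "(\<chi> b ^ r) ^ (p ^ k) = 1"
        using kl cj_inv_cancel(2)[OF x A_carrier[OF b]] by (auto simp: kills_def twist_def)
      hence "(\<chi> b ^ (p ^ k)) ^ r = 1" by (simp only: power_mult[symmetric] mult.commute)
      moreover have "(\<chi> b ^ (p ^ k)) ^ (p ^ Suc 0) = 1"
        using c(3) b unfolding kills_def by (simp add: mult.commute flip: power_mult)
      ultimately show ?thesis using root_of_unity_coprime[OF prime_p r] by blast
    qed
    thus False using c(4) by (simp add: kills_def)
  qed
  ultimately show ?thesis using twist_chars[OF c(1) x] by (simp add: exact_chars_def)
qed

lemma twist_one:
  assumes "\<chi> \<in> chars" "\<And>a. a \<in> A \<Longrightarrow> \<chi> a ^ n = \<chi> a"
  shows "twist \<one> n \<chi> = \<chi>"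
  using assms by (auto simp: twist_def fun_eq_iff cj_one A_carrier chi_outside)

lemma kills_power_mod:
  assumes "kills d \<chi>" "a \<in> A"
  shows "\<chi> a ^ (d * m + n) = \<chi> a ^ n"
  using assms by (simp add: kills_def power_add power_mult)

lemma sim_refl: "\<chi> \<in> exact_chars k \<Longrightarrow> sim \<chi> \<chi>"
  unfolding sim_def using twist_one[of \<chi> 1] p_gt_1
  by (intro bexI[of _ \<one>] exI[of _ 1]) (auto simp: exact_chars_def)

lemma sim_sym:
  assumes "\<chi> \<in> exact_chars k" "sim \<chi> \<chi>'"
  shows "sim \<chi>' \<chi>"
proof -
  obtain x r where xr: "x \<in> carrier G" "\<not> p dvd r" "\<chi>' = twist x r \<chi>"
    using assms(2) by (auto simp: sim_def)
  obtain s m where s: "r * s = p ^ Suc k * m + 1" "\<not> p dvd s"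
    using inverse_mod_prime_power[OF prime_p xr(2), of k] by blast
  have "twist (inv x) s \<chi>' = twist \<one> (r * s) \<chi>"
    using xr by (simp add: twist_twist)
  also have "\<dots> = \<chi>"
    using assms(1) kills_power_mod[of "p ^ Suc k" \<chi> _ m 1] unfolding s(1)
    by (intro twist_one) (auto simp: exact_chars_def)
  finally show ?thesis unfolding sim_def using xr s by (intro bexI[of _ "inv x"] exI[of _ s]) auto
qed

lemma sim_trans: "sim \<chi> \<chi>' \<Longrightarrow> sim \<chi>' \<chi>'' \<Longrightarrow> sim \<chi> \<chi>''"
proof -
  assume "sim \<chi> \<chi>'" "sim \<chi>' \<chi>''"
  then obtain x r y s where "x \<in> carrier G" "\<not> p dvd r" "\<chi>' = twist x r \<chi>"
    "y \<in> carrier G" "\<not> p dvd s" "\<chi>'' = twist y s \<chi>'" by (auto simp: sim_def)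
  thus "sim \<chi> \<chi>''" unfolding sim_def
    using prime_p by (intro bexI[of _ "y \<otimes> x"] exI[of _ "r * s"]) (auto simp: twist_twist prime_dvd_mult_iff)
qed

lemma sim_exact: "\<chi> \<in> exact_chars k \<Longrightarrow> sim \<chi> \<chi>' \<Longrightarrow> \<chi>' \<in> exact_chars k"
  unfolding sim_def using twist_exact by blast

lemma exact_chars_primitive:
  assumes "\<chi> \<in> exact_chars k"
  obtains b where "b \<in> A" "\<chi> b ^ (p ^ Suc k) = 1" "\<chi> b ^ (p ^ k) \<noteq> 1"
  using assms by (auto simp: exact_chars_def kills_def)

text \<open>Freeness of the action: undoing the conjugation by \<open>g [^] i\<close> and inverting
  \<open>s\<close> modulo the order of \<chi> would exhibit a proper conjugate of \<chi> as a power
  of \<chi>.\<close>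

lemma twist_g_eq_conj:
  assumes chi: "\<chi> \<in> exact_chars k" and ij: "i < j" "j < p" and rs: "\<not> p dvd s"
    and eq: "\<And>a. a \<in> A \<Longrightarrow> \<chi> (cj (g [^] i) a) ^ r = \<chi> (cj (g [^] j) a) ^ s"
  shows False
proof -
  have c: "\<chi> \<in> chars" "nontriv \<chi>" "kills (p ^ Suc k) \<chi>"
    using chi by (auto simp: exact_chars_def)
  obtain t m where t: "s * t = p ^ Suc k * m + 1"
    using inverse_mod_prime_power[OF prime_p rs, of k] by blast
  have pd: "\<not> p dvd j - i" using ij by (auto dest: dvd_imp_le)
  have "\<chi> (cj (g [^] (j - i)) b) = \<chi> b ^ (r * t)" if b: "b \<in> A" for b
  proof -
    define a where "a = cj (inv (g [^] i)) b"
    have a: "a \<in> A" "cj (g [^] i) a = b"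
      using b gpow_closed cj_inv_cancel(2)[OF gpow_closed A_carrier[OF b]] by (auto simp: a_def intro: cj_A)
    have "cj (g [^] (j - i)) b = cj (g [^] i \<otimes> g [^] (j - i)) a"
      using a A_carrier by (simp add: cj_cj[OF gpow_closed gpow_closed, symmetric])
    also have "g [^] i \<otimes> g [^] (j - i) = g [^] j" using ij g_closed by (simp add: nat_pow_mult)
    finally have "\<chi> b ^ r = \<chi> (cj (g [^] (j - i)) b) ^ s" using eq[OF a(1)] a(2) by simp
    hence "\<chi> b ^ (r * t) = \<chi> (cj (g [^] (j - i)) b) ^ (s * t)" by (simp add: power_mult)
    also have "\<dots> = \<chi> (cj (g [^] (j - i)) b)"
      using kills_power_mod[OF c(3) cj_A[OF gpow_closed b], of "j - i" m 1] unfolding t by simp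
    finally show ?thesis by simp
  qed
  thus False using character_conj_not_power[OF c(1) _ pd, of "r * t"] c(2) by (simp add: nontriv_def)
qed

text \<open>Both \<open>A\<close> and \<open>g [^] p\<close> act trivially on characters of
  \<open>A\<close>, and exponents matter only modulo the order of \<chi>, so both parameters can be
  reduced.\<close>

lemma sim_twist_g:
  assumes chi: "\<chi> \<in> exact_chars k" and sim: "sim \<chi> \<chi>'"
  obtains i r where "i < p" "r \<in> units_below p k" "\<chi>' = twist (g [^] (i::nat)) r \<chi>"
proof -
  have c: "kills (p ^ Suc k) \<chi>" using chi by (auto simp: exact_chars_def)
    obtain x r where xr: "x \<in> carrier G" "\<not> p dvd r" "\<chi>' = twist x r \<chi>"
      using sim by (auto simp: sim_def)
    obtain n :: nat and a where na: "a \<in> A" "x = g [^] n \<otimes> a" using coset_rep[OF xr(1)] by blast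
    have cjx: "cj x b = cj (g [^] (n mod p)) b" if b: "b \<in> A" for b
    proof -
      have "cj x b = cj (g [^] n) b"
        using na b gpow_closed A_carrier cj_A[OF gpow_closed b]
        by (simp add: cj_cj[symmetric] cj_abelian)
      also have "g [^] n = g [^] (p * (n div p)) \<otimes> g [^] (n mod p)"
        using g_closed by (simp add: nat_pow_mult)
      also have "cj (g [^] (p * (n div p)) \<otimes> g [^] (n mod p)) b = cj (g [^] (n mod p)) b"
        using b gpow_closed A_carrier cj_pow_p[of "p * (n div p)" b] by (simp add: cj_cj[symmetric])
      finally show ?thesis .
    qed
    have "\<chi>' = twist (g [^] (n mod p)) (r mod p ^ Suc k) \<chi>"
    proof
      fix b
      have "\<chi> d ^ r = \<chi> d ^ (r mod p ^ Suc k)" if "d \<in> A" for d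
        using kills_power_mod[OF c that, of "r div p ^ Suc k" "r mod p ^ Suc k"]
        by (simp only: mult_div_mod_eq)
      thus "\<chi>' b = twist (g [^] (n mod p)) (r mod p ^ Suc k) \<chi> b"
        unfolding xr(3) twist_def using cjx cj_A[OF gpow_closed] by simp
    qed
    moreover have "n mod p < p" using p_gt_1 by simp
    moreover have "r mod p ^ Suc k \<in> units_below p k"
      using xr(2) p_gt_1 by (simp add: units_below_def dvd_mod_iff del: power_Suc)
  ultimately show ?thesis using that by blast
qed

text \<open>Distinct reduced parameters give distinct twists: the power of \<open>g\<close> is
  determined by \<open>twist_g_eq_conj\<close>, and then the exponent by a value of \<chi> that is a
  primitive root.\<close>

lemma card_sim_class:
  assumes chi: "\<chi> \<in> exact_chars k"
  shows "card {\<chi>'. sim \<chi> \<chi>'} = p * card (units_below p k)"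
proof -
  let ?f = "\<lambda>(i, r). twist (g [^] (i::nat)) r \<chi>"
  let ?S = "{..<p} \<times> units_below p k"
  have c: "\<chi> \<in> chars" "nontriv \<chi>" "kills (p ^ Suc k) \<chi>"
    using chi by (auto simp: exact_chars_def)
  have "{\<chi>'. sim \<chi> \<chi>'} = ?f ` ?S"
  proof (intro equalityI subsetI)
    fix \<chi>' assume "\<chi>' \<in> {\<chi>'. sim \<chi> \<chi>'}"
    hence "sim \<chi> \<chi>'" by simp
    from sim_twist_g[OF chi this] show "\<chi>' \<in> ?f ` ?S" by (metis (mono_tags, lifting) SigmaI case_prod_conv image_eqI lessThan_iff)
  next
    fix \<chi>' assume "\<chi>' \<in> ?f ` ?S"
    thus "\<chi>' \<in> {\<chi>'. sim \<chi> \<chi>'}" unfolding sim_def units_below_def using gpow_closed by auto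
  qed
  moreover have "inj_on ?f ?S"
  proof (rule inj_onI)
    fix u v assume uv: "u \<in> ?S" "v \<in> ?S" "?f u = ?f v"
    obtain i r j s where u: "u = (i, r)" and v: "v = (j, s)" by (cases u, cases v)
    have ir: "i < p" "j < p" "\<not> p dvd r" "\<not> p dvd s" "r < p ^ Suc k" "s < p ^ Suc k"
      using uv u v by (auto simp: units_below_def)
    have eq: "\<chi> (cj (g [^] i) a) ^ r = \<chi> (cj (g [^] j) a) ^ s" if "a \<in> A" for a
      using fun_cong[OF uv(3), of a] that by (simp add: u v twist_def)
    have "i = j"
      using twist_g_eq_conj[OF chi _ ir(2) ir(4) eq] twist_g_eq_conj[OF chi _ ir(1) ir(3) eq[symmetric]]
      by (metis nat_neq_iff)
    obtain b where b: "b \<in> A" "\<chi> b ^ (p ^ Suc k) = 1" "\<chi> b ^ (p ^ k) \<noteq> 1"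
      using exact_chars_primitive[OF chi] .
    have "cj (inv (g [^] i)) b \<in> A" using b gpow_closed by (intro cj_A) auto
    from eq[OF this] have "\<chi> b ^ r = \<chi> b ^ s"
      using \<open>i = j\<close> cj_inv_cancel(2)[OF gpow_closed A_carrier[OF b(1)]] by simp
    hence "r = s" using primitive_root_inj[OF prime_p b(2,3)] ir(5,6) by (auto simp: inj_on_def)
    thus "u = v" using \<open>i = j\<close> u v by simp
  qed
  ultimately show ?thesis by (simp add: card_image card_cartesian_product)
qed

section \<open>Counting orbits\<close>

abbreviation "QA \<equiv> Ag Mod D"

lemma subgroup_D_A: "subgroup D Ag"
  using subgroup_incl[OF subgroup_D subgroup_A derived_A] .

lemma group_QA: "group QA"
  using C.abelian_FactGroup[OF subgroup_D_A] by (simp add: comm_group_def)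

lemma finite_QA: "finite (carrier QA)"
  using finite_A by (simp add: carrier_FactGroup)

text \<open>Characters of order exactly \<open>p ^ Suc k\<close> are either nontrivial on
  \<open>D\<close> or come from the quotient by \<open>D\<close>. Torsion counts in \<open>A\<close>
  and in the quotient give the total and the second kind; the additive form avoids subtraction of
  natural numbers.\<close>

lemma card_exact_chars:
  "card (exact_chars k) + card (units_below p k) * num_cyclic_subgroups QA (p ^ Suc k) =
    card (units_below p k) * num_cyclic_subgroups Ag (p ^ Suc k)"
proof -
  interpret Q: group QA by (rule group_QA)
  define T where "T n = {\<chi> \<in> chars. kills n \<chi>}" for n
  define T' where "T' n = {\<chi> \<in> chars. (\<forall>c\<in>D. \<chi> c = 1) \<and> kills n \<chi>}" for n
  have fin: "finite (T n)" "finite (T' n)" for n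
    using finite_chars by (auto simp: T_def T'_def)
  have cT: "card (T n) = card {a \<in> carrier Ag. a [^]\<^bsub>Ag\<^esub> n = \<one>\<^bsub>Ag\<^esub>}" for n
    using C.card_characters_torsion[of n] by (simp add: T_def kills_def)
  have cT': "card (T' n) = card {q \<in> carrier QA. q [^]\<^bsub>QA\<^esub> n = \<one>\<^bsub>QA\<^esub>}" for n
    using C.card_characters_quotient_torsion[OF subgroup_D_A, of n] by (simp add: T'_def kills_def)
  have mono: "kills (p ^ k) \<chi> \<Longrightarrow> kills (p ^ Suc k) \<chi>" for \<chi>
    by (rule kills_mono) auto
  have "T (p ^ Suc k) = T (p ^ k) \<union> (exact_chars k \<union> (T' (p ^ Suc k) - T' (p ^ k)))"
    using mono by (auto simp: T_def T'_def exact_chars_def nontriv_def)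
  moreover have "T (p ^ k) \<inter> (exact_chars k \<union> (T' (p ^ Suc k) - T' (p ^ k))) = {}"
    "exact_chars k \<inter> (T' (p ^ Suc k) - T' (p ^ k)) = {}"
    by (auto simp: T_def T'_def exact_chars_def nontriv_def)
  ultimately have "card (T (p ^ Suc k)) = card (T (p ^ k)) + (card (exact_chars k) + card (T' (p ^ Suc k) - T' (p ^ k)))"
    using fin finite_exact_chars by (simp add: card_Un_disjoint del: power_Suc)
  moreover have sub: "T' (p ^ k) \<subseteq> T' (p ^ Suc k)" using mono by (auto simp: T'_def)
  hence "card (T' (p ^ Suc k)) = card (T' (p ^ k)) + card (T' (p ^ Suc k) - T' (p ^ k))"
    using card_Diff_subset[OF fin(2) sub] card_mono[OF fin(2) sub] by simp
  moreover have "card (T (p ^ Suc k)) = card (T (p ^ k)) + card (units_below p k) * num_cyclic_subgroups Ag (p ^ Suc k)"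
    unfolding cT by (rule C.card_torsion_num_cyclic_subgroups[OF C.finite_carrier prime_p])
  moreover have "card (T' (p ^ Suc k)) = card (T' (p ^ k)) + card (units_below p k) * num_cyclic_subgroups QA (p ^ Suc k)"
    unfolding cT' by (rule Q.card_torsion_num_cyclic_subgroups[OF finite_QA prime_p])
  ultimately show ?thesis by linarith
qed

text \<open>All orbits have the same size, \<open>p\<close> times the number of units. Cancelling
  the number of units from both counts leaves \<open>p\<close> times the number \<open>n\<close> of
  orbits.\<close>

lemma exact_chars_representatives:
  "\<exists>n rep. p * n + num_cyclic_subgroups QA (p ^ Suc k) = num_cyclic_subgroups Ag (p ^ Suc k) \<and>
     (\<forall>j<n. rep j \<in> exact_chars k) \<and>
     (\<forall>i<n. \<forall>j<n. sim (rep i) (rep j) \<longrightarrow> i = j) \<and>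
     (\<forall>\<chi>\<in>exact_chars k. \<exists>j<n. sim (rep j) \<chi>)"
proof -
  define cl where "cl \<chi> = {\<chi>'. sim \<chi> \<chi>'}" for \<chi>
  define Q where "Q = cl ` exact_chars k"
  have cl_eq: "cl \<chi> = cl \<chi>'" if "\<chi> \<in> exact_chars k" "sim \<chi> \<chi>'" for \<chi> \<chi>'
    using that sim_sym sim_trans unfolding cl_def by blast
  have clsub: "cl \<chi> \<subseteq> exact_chars k" if "\<chi> \<in> exact_chars k" for \<chi>
    using that sim_exact by (auto simp: cl_def)
  have self: "\<chi> \<in> cl \<chi>" if "\<chi> \<in> exact_chars k" for \<chi>
    using that sim_refl by (auto simp: cl_def)
  have UQ: "\<Union>Q = exact_chars k" using clsub self by (auto simp: Q_def)
  have finQ: "finite Q" using finite_exact_chars by (simp add: Q_def)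
  have "p * card (units_below p k) * card Q = card (\<Union>Q)"
  proof (rule card_partition[OF finQ])
    show "finite (\<Union>Q)" using UQ finite_exact_chars by simp
    show "card c = p * card (units_below p k)" if "c \<in> Q" for c
      using that card_sim_class by (auto simp: Q_def cl_def)
    show "c1 \<inter> c2 = {}" if c: "c1 \<in> Q" "c2 \<in> Q" "c1 \<noteq> c2" for c1 c2
    proof (rule ccontr)
      assume "c1 \<inter> c2 \<noteq> {}"
      then obtain \<chi> where chi: "\<chi> \<in> c1" "\<chi> \<in> c2" by blast
      obtain \<chi>1 \<chi>2 where "\<chi>1 \<in> exact_chars k" "c1 = cl \<chi>1" "\<chi>2 \<in> exact_chars k" "c2 = cl \<chi>2"
        using c by (auto simp: Q_def)
      thus False using chi c(3) cl_eq[of \<chi>1 \<chi>] cl_eq[of \<chi>2 \<chi>] by (auto simp: cl_def)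
    qed
  qed
  hence "card (units_below p k) * (p * card Q + num_cyclic_subgroups QA (p ^ Suc k)) =
      card (units_below p k) * num_cyclic_subgroups Ag (p ^ Suc k)"
    using card_exact_chars[of k] by (simp add: UQ algebra_simps)
  hence n: "p * card Q + num_cyclic_subgroups QA (p ^ Suc k) = num_cyclic_subgroups Ag (p ^ Suc k)"
    using card_units_below_pos[OF prime_p, of k] by (simp del: power_Suc)
  obtain h where h: "bij_betw h {0..<card Q} Q" using ex_bij_betw_nat_finite[OF finQ] by blast
  have hQ: "h j \<in> Q" if "j < card Q" for j using h that by (auto simp: bij_betw_def)
  define rep where "rep j = (SOME \<chi>. \<chi> \<in> exact_chars k \<and> cl \<chi> = h j)" for j
  have rep: "rep j \<in> exact_chars k \<and> cl (rep j) = h j" if "j < card Q" for j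
  proof -
    from hQ[OF that] obtain \<chi> where "\<chi> \<in> exact_chars k \<and> cl \<chi> = h j" unfolding Q_def by blast
    thus ?thesis unfolding rep_def
      by (rule someI[where P = "\<lambda>\<chi>. \<chi> \<in> exact_chars k \<and> cl \<chi> = h j"])
  qed
  show ?thesis
  proof (rule exI[of _ "card Q"], rule exI[of _ rep], intro conjI allI impI ballI)
    show "p * card Q + num_cyclic_subgroups QA (p ^ Suc k) = num_cyclic_subgroups Ag (p ^ Suc k)" by (rule n)
    show "rep j \<in> exact_chars k" if "j < card Q" for j using rep[OF that] by blast
    show "i = j" if "i < card Q" "j < card Q" "sim (rep i) (rep j)" for i j
    proof -
      have "h i = h j" using rep[OF that(1)] rep[OF that(2)] cl_eq[of "rep i" "rep j"] that(3) by simp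
      thus ?thesis using h that by (auto simp: bij_betw_def inj_on_def)
    qed
    fix \<chi> assume chi: "\<chi> \<in> exact_chars k"
    hence "cl \<chi> \<in> Q" by (simp add: Q_def)
    hence "cl \<chi> \<in> h ` {0..<card Q}" using h by (simp add: bij_betw_def)
    then obtain j where j: "j < card Q" "h j = cl \<chi>" by auto
    have "\<chi> \<in> cl (rep j)" using rep[OF j(1)] j(2) self[OF chi] by simp
    thus "\<exists>j<card Q. sim (rep j) \<chi>" using j(1) by (auto simp: cl_def)
  qed
qed

lemma nontriv_exact:
  assumes "\<chi> \<in> chars" "nontriv \<chi>"
  obtains k where "\<chi> \<in> exact_chars k"
proof -
  obtain N where N: "card A = p ^ N" using order_A by blast
  define j where "j = (LEAST j. kills (p ^ j) \<chi>)"
  have "kills (p ^ N) \<chi>" using chi_card[OF assms(1)] N by (simp add: kills_def)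
  hence j: "kills (p ^ j) \<chi>" unfolding j_def by (rule LeastI)
  have "j \<noteq> 0"
  proof
    assume "j = 0"
    hence "\<forall>c\<in>D. \<chi> c = 1" using j derived_A by (auto simp: kills_def)
    thus False using assms(2) by (simp add: nontriv_def)
  qed
  then obtain k where k: "j = Suc k" by (cases j) auto
  have "\<not> kills (p ^ k) \<chi>" using not_less_Least[of k "\<lambda>j. kills (p ^ j) \<chi>"] k unfolding j_def[symmetric] by simp
  thus ?thesis using that j k assms by (auto simp: exact_chars_def)
qed

lemma exponent_power:
  obtains M where "exponent Ag = p ^ M"
proof -
  obtain N where N: "card A = p ^ N" using order_A by blast
  have "exponent Ag dvd p ^ N" using C.exponent_dvd_iff(4)[OF C.finite_carrier] N by (simp add: Coset.order_def)
  thus ?thesis using that divides_primepow_nat[OF prime_p] by blast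
qed

lemma exact_chars_exponent:
  assumes "\<chi> \<in> exact_chars k"
  shows "p ^ Suc k dvd exponent Ag"
proof -
  obtain M where M: "exponent Ag = p ^ M" by (rule exponent_power)
  have "kills (p ^ M) \<chi>"
    unfolding kills_def
  proof
    fix a assume a: "a \<in> A"
    have "a [^]\<^bsub>Ag\<^esub> (p ^ M) = \<one>\<^bsub>Ag\<^esub>" using C.exponent_dvd_iff(1)[OF C.finite_carrier, of "p ^ M"] M a by simp
    hence "a [^] (p ^ M) = \<one>" using nat_pow_consistent[of a "p ^ M" A] by simp
    thus "\<chi> a ^ (p ^ M) = 1" using chi_pow[of \<chi> a "p ^ M"] chi_one[of \<chi>] assms a by (simp add: exact_chars_def)
  qed
  hence "\<not> M \<le> k" using assms kills_mono[of "p ^ M" \<chi> "p ^ k"] by (auto simp: exact_chars_def le_imp_power_dvd)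
  thus ?thesis unfolding M by (intro le_imp_power_dvd) simp
qed

lemma exact_chars_unique:
  assumes "\<chi> \<in> exact_chars k" "\<chi> \<in> exact_chars l"
  shows "k = l"
proof -
  have "\<not> k < l" if "\<chi> \<in> exact_chars k" "\<chi> \<in> exact_chars l" for k l
    using that kills_mono[of "p ^ Suc k" \<chi> "p ^ l"] by (auto simp: exact_chars_def le_imp_power_dvd simp del: power_Suc)
  from this[OF assms] this[OF assms(2,1)] show ?thesis by simp
qed

end

section \<open>The group algebra\<close>

text \<open>The product of basis elements is a parameter, so that the same lemmas serve the algebra
  of \<open>G\<close> and that of the quotient.\<close>

definition conv :: "('a \<Rightarrow> 'a \<Rightarrow> 'a) \<Rightarrow> ('a \<Rightarrow>\<^sub>0 rat) \<Rightarrow> ('a \<Rightarrow>\<^sub>0 rat) \<Rightarrow> ('a \<Rightarrow>\<^sub>0 rat)" where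
  "conv m f h = (\<Sum>x\<in>Poly_Mapping.keys f. \<Sum>y\<in>Poly_Mapping.keys h.
     Poly_Mapping.single (m x y) (Poly_Mapping.lookup f x * Poly_Mapping.lookup h y))"

text \<open>The linear extension of \<phi> to the rational group algebra.\<close>

definition ext :: "('a \<Rightarrow> complex) \<Rightarrow> ('a \<Rightarrow>\<^sub>0 rat) \<Rightarrow> complex" where
  "ext \<phi> f = (\<Sum>x\<in>Poly_Mapping.keys f. of_rat (Poly_Mapping.lookup f x) * \<phi> x)"

text \<open>The linear map of group algebras induced by \<pi> on basis elements.\<close>

definition push :: "('a \<Rightarrow> 'b) \<Rightarrow> ('a \<Rightarrow>\<^sub>0 rat) \<Rightarrow> ('b \<Rightarrow>\<^sub>0 rat)" where
  "push \<pi> f = (\<Sum>x\<in>Poly_Mapping.keys f. Poly_Mapping.single (\<pi> x) (Poly_Mapping.lookup f x))"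

lemma ext_superset:
  assumes "finite S" "Poly_Mapping.keys f \<subseteq> S"
  shows "ext \<phi> f = (\<Sum>x\<in>S. of_rat (Poly_Mapping.lookup f x) * \<phi> x)"
  unfolding ext_def using assms
  by (intro sum.mono_neutral_left) (auto simp: in_keys_iff)

lemma push_superset:
  assumes "finite S" "Poly_Mapping.keys f \<subseteq> S"
  shows "push \<pi> f = (\<Sum>x\<in>S. Poly_Mapping.single (\<pi> x) (Poly_Mapping.lookup f x))"
  unfolding push_def using assms
  by (intro sum.mono_neutral_left) (auto simp: in_keys_iff)

lemma conv_superset:
  assumes "finite S" "Poly_Mapping.keys f \<subseteq> S" "finite T" "Poly_Mapping.keys h \<subseteq> T"
  shows "conv m f h = (\<Sum>x\<in>S. \<Sum>y\<in>T.
     Poly_Mapping.single (m x y) (Poly_Mapping.lookup f x * Poly_Mapping.lookup h y))"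
proof -
  have "conv m f h = (\<Sum>x\<in>Poly_Mapping.keys f. \<Sum>y\<in>T.
     Poly_Mapping.single (m x y) (Poly_Mapping.lookup f x * Poly_Mapping.lookup h y))"
    unfolding conv_def using assms
    by (intro sum.cong HOL.refl sum.mono_neutral_left) (auto simp: in_keys_iff)
  also have "\<dots> = (\<Sum>x\<in>S. \<Sum>y\<in>T.
     Poly_Mapping.single (m x y) (Poly_Mapping.lookup f x * Poly_Mapping.lookup h y))"
    using assms by (intro sum.mono_neutral_left) (auto simp: in_keys_iff)
  finally show ?thesis .
qed

lemma keys_sum_subset:
  assumes "\<And>i. i \<in> I \<Longrightarrow> Poly_Mapping.keys (f i) \<subseteq> S"
  shows "Poly_Mapping.keys (\<Sum>i\<in>I. f i) \<subseteq> S"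
  using assms
proof (induction I rule: infinite_finite_induct)
  case (insert i I)
  thus ?case using Poly_Mapping.keys_add[of "f i" "\<Sum>i\<in>I. f i"] by auto
qed auto

lemma ext_add: "ext \<phi> (f + h) = ext \<phi> f + ext \<phi> h"
proof -
  let ?S = "Poly_Mapping.keys f \<union> Poly_Mapping.keys h"
  have "ext \<phi> (f + h) = (\<Sum>x\<in>?S. of_rat (Poly_Mapping.lookup (f + h) x) * \<phi> x)"
    "ext \<phi> f = (\<Sum>x\<in>?S. of_rat (Poly_Mapping.lookup f x) * \<phi> x)"
    "ext \<phi> h = (\<Sum>x\<in>?S. of_rat (Poly_Mapping.lookup h x) * \<phi> x)"
    by (intro ext_superset; use Poly_Mapping.keys_add[of f h] in auto)+
  thus ?thesis by (simp add: lookup_add of_rat_add distrib_right sum.distrib)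
qed

lemma ext_0 [simp]: "ext \<phi> 0 = 0"
  by (simp add: ext_def)

lemma ext_single [simp]: "ext \<phi> (Poly_Mapping.single x c) = of_rat c * \<phi> x"
  by (cases "c = 0") (simp_all add: ext_def)

lemma ext_sum: "ext \<phi> (\<Sum>i\<in>I. f i) = (\<Sum>i\<in>I. ext \<phi> (f i))"
  by (induction I rule: infinite_finite_induct) (auto simp: ext_add)

lemma push_add: "push \<pi> (f + h) = push \<pi> f + push \<pi> h"
proof -
  let ?S = "Poly_Mapping.keys f \<union> Poly_Mapping.keys h"
  have "push \<pi> (f + h) = (\<Sum>x\<in>?S. Poly_Mapping.single (\<pi> x) (Poly_Mapping.lookup (f + h) x))"
    "push \<pi> f = (\<Sum>x\<in>?S. Poly_Mapping.single (\<pi> x) (Poly_Mapping.lookup f x))"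
    "push \<pi> h = (\<Sum>x\<in>?S. Poly_Mapping.single (\<pi> x) (Poly_Mapping.lookup h x))"
    by (intro push_superset; use Poly_Mapping.keys_add[of f h] in auto)+
  thus ?thesis by (simp add: lookup_add single_add sum.distrib)
qed

lemma push_0 [simp]: "push \<pi> 0 = 0"
  by (simp add: push_def)

lemma push_single [simp]: "push \<pi> (Poly_Mapping.single x c) = Poly_Mapping.single (\<pi> x) c"
  by (cases "c = 0") (simp_all add: push_def)

lemma push_sum: "push \<pi> (\<Sum>i\<in>I. f i) = (\<Sum>i\<in>I. push \<pi> (f i))"
  by (induction I rule: infinite_finite_induct) (auto simp: push_add)

lemma lookup_push:
  assumes "finite S" "Poly_Mapping.keys f \<subseteq> S"
  shows "Poly_Mapping.lookup (push \<pi> f) q = (\<Sum>x\<in>S. if \<pi> x = q then Poly_Mapping.lookup f x else 0)"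
  unfolding push_superset[OF assms] by (simp add: lookup_sum lookup_single when_def)

lemma conv_add_left: "conv m (f1 + f2) h = conv m f1 h + conv m f2 h"
proof -
  let ?S = "Poly_Mapping.keys f1 \<union> Poly_Mapping.keys f2" and ?T = "Poly_Mapping.keys h"
  let ?c = "\<lambda>f. \<Sum>x\<in>?S. \<Sum>y\<in>?T. Poly_Mapping.single (m x y) (Poly_Mapping.lookup f x * Poly_Mapping.lookup h y)"
  have "conv m (f1 + f2) h = ?c (f1 + f2)" "conv m f1 h = ?c f1" "conv m f2 h = ?c f2"
    by (intro conv_superset; use Poly_Mapping.keys_add[of f1 f2] in auto)+
  thus ?thesis by (simp add: lookup_add single_add sum.distrib distrib_right)
qed

lemma conv_add_right: "conv m f (h1 + h2) = conv m f h1 + conv m f h2"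
proof -
  let ?T = "Poly_Mapping.keys h1 \<union> Poly_Mapping.keys h2" and ?S = "Poly_Mapping.keys f"
  let ?c = "\<lambda>h. \<Sum>x\<in>?S. \<Sum>y\<in>?T. Poly_Mapping.single (m x y) (Poly_Mapping.lookup f x * Poly_Mapping.lookup h y)"
  have "conv m f (h1 + h2) = ?c (h1 + h2)" "conv m f h1 = ?c h1" "conv m f h2 = ?c h2"
    by (intro conv_superset; use Poly_Mapping.keys_add[of h1 h2] in auto)+
  thus ?thesis by (simp add: lookup_add single_add sum.distrib distrib_left)
qed

lemma conv_single_single:
  "conv m (Poly_Mapping.single x c) (Poly_Mapping.single y e) = Poly_Mapping.single (m x y) (c * e)"
  by (subst conv_superset[of "{x}" _ "{y}"]) auto

lemma conv_0 [simp]: "conv m 0 h = 0" "conv m f 0 = 0"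
  by (simp_all add: conv_def)

lemma conv_sum_left: "conv m (\<Sum>i\<in>I. f i) h = (\<Sum>i\<in>I. conv m (f i) h)"
  by (induction I rule: infinite_finite_induct) (auto simp: conv_add_left)

lemma conv_sum_right: "conv m f (\<Sum>i\<in>I. h i) = (\<Sum>i\<in>I. conv m f (h i))"
  by (induction I rule: infinite_finite_induct) (auto simp: conv_add_right)

lemma push_conv:
  assumes "\<And>x y. x \<in> Poly_Mapping.keys f \<Longrightarrow> y \<in> Poly_Mapping.keys h \<Longrightarrow> \<pi> (m x y) = m' (\<pi> x) (\<pi> y)"
  shows "push \<pi> (conv m f h) = conv m' (push \<pi> f) (push \<pi> h)"
  unfolding conv_def[of m] push_sum push_def[of \<pi> f] conv_sum_left
  unfolding push_def[of \<pi> h] conv_sum_right conv_single_single push_single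
  using assms by (intro sum.cong HOL.refl) simp

lemma ext_conv:
  "ext \<phi> (conv m f h) = (\<Sum>x\<in>Poly_Mapping.keys f. \<Sum>y\<in>Poly_Mapping.keys h.
     of_rat (Poly_Mapping.lookup f x) * of_rat (Poly_Mapping.lookup h y) * \<phi> (m x y))"
  by (simp add: conv_def ext_sum of_rat_mult)

lemma lookup_scale: "Poly_Mapping.lookup (Poly_Mapping.map (\<lambda>a. c * a) f) x = (c::rat) * Poly_Mapping.lookup f x"
  by (simp add: map.rep_eq when_def)

lemma keys_scale: "Poly_Mapping.keys (Poly_Mapping.map (\<lambda>a. (c::rat) * a) f) \<subseteq> Poly_Mapping.keys f"
  by (auto simp: in_keys_iff lookup_scale)

lemma ext_scale: "ext \<phi> (Poly_Mapping.map (\<lambda>a. (c::rat) * a) f) = of_rat c * ext \<phi> f"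
  by (subst ext_superset[OF finite_keys keys_scale])
    (simp add: ext_def lookup_scale of_rat_mult sum_distrib_left mult.assoc)

lemma push_scale: "push \<pi> (Poly_Mapping.map (\<lambda>a. (c::rat) * a) f) = Poly_Mapping.map (\<lambda>a. c * a) (push \<pi> f)"
proof (rule poly_mapping_eqI)
  fix q
  show "Poly_Mapping.lookup (push \<pi> (Poly_Mapping.map (\<lambda>a. c * a) f)) q =
      Poly_Mapping.lookup (Poly_Mapping.map (\<lambda>a. c * a) (push \<pi> f)) q"
    unfolding lookup_scale lookup_push[OF finite_keys keys_scale]
    unfolding lookup_push[OF finite_keys subset_refl]
    by (simp add: sum_distrib_left lookup_scale if_distrib cong: if_cong)
qed

definition from_fun :: "'a set \<Rightarrow> ('a \<Rightarrow> 'b) \<Rightarrow> ('a \<Rightarrow> rat) \<Rightarrow> ('b \<Rightarrow>\<^sub>0 rat)" where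
  "from_fun S k w = (\<Sum>a\<in>S. Poly_Mapping.single (k a) (w a))"

lemma ext_from_fun: "ext \<phi> (from_fun S k w) = (\<Sum>a\<in>S. of_rat (w a) * \<phi> (k a))"
  by (simp add: from_fun_def ext_sum)

lemma push_from_fun: "push \<pi> (from_fun S k w) = from_fun S (\<lambda>a. \<pi> (k a)) w"
  by (simp add: from_fun_def push_sum)

lemma lookup_from_fun:
  "finite S \<Longrightarrow> Poly_Mapping.lookup (from_fun S k w) q = (\<Sum>a\<in>S. if k a = q then w a else 0)"
  by (simp add: from_fun_def lookup_sum lookup_single when_def)

lemma keys_from_fun:
  assumes "\<And>a. a \<in> S \<Longrightarrow> k a \<in> T"
  shows "Poly_Mapping.keys (from_fun S k w) \<subseteq> T"
  unfolding from_fun_def by (rule keys_sum_subset) (use assms in auto)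

section \<open>The induced representation\<close>

context cyclic_extension
begin

text \<open>If \<open>x\<close> lies in g^n A, then \<open>x \<otimes> g [^] i\<close> lies in
  \<open>A\<close> exactly if \<open>p\<close> divides \<open>n + i\<close>. In an induced matrix
  this locates the only nonzero entry of a row.\<close>

lemma coset_index:
  assumes "x \<in> carrier G"
  shows "\<exists>j<p. x \<otimes> g [^] (j::nat) \<in> A \<and> (\<forall>i<p. x \<otimes> g [^] i \<in> A \<longrightarrow> i = j)"
proof -
  obtain n :: nat and a where na: "a \<in> A" "x = g [^] n \<otimes> a" using coset_rep[OF assms] by blast
  have iff: "x \<otimes> g [^] i \<in> A \<longleftrightarrow> p dvd n + i" for i :: nat
  proof -
    have c: "cj (g [^] i) a \<in> A" by (rule cj_A[OF gpow_closed na(1)])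
    have "x \<otimes> g [^] i = g [^] n \<otimes> (g [^] i \<otimes> (inv (g [^] i) \<otimes> (a \<otimes> g [^] i)))"
      using na A_carrier gpow_closed by (simp add: m_assoc) (simp flip: m_assoc)
    also have "\<dots> = g [^] (n + i) \<otimes> cj (g [^] i) a"
      using na A_carrier g_closed by (simp add: cj_def m_assoc flip: nat_pow_mult)
    finally have eq: "x \<otimes> g [^] i = g [^] (n + i) \<otimes> cj (g [^] i) a" .
    have "g [^] (n + i) \<otimes> cj (g [^] i) a \<in> A \<longleftrightarrow> g [^] (n + i) \<in> A"
    proof
      assume "g [^] (n + i) \<otimes> cj (g [^] i) a \<in> A"
      hence "g [^] (n + i) \<otimes> cj (g [^] i) a \<otimes> inv (cj (g [^] i) a) \<in> A" using c by auto
      thus "g [^] (n + i) \<in> A" using A_carrier[OF c] gpow_closed by (simp add: m_assoc)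
    qed (use c in auto)
    thus ?thesis using eq g_pow_in_A by simp
  qed
  define j where "j = (p - n mod p) mod p"
  have "(n + j) mod p = 0"
  proof -
    have "(n + j) mod p = (n mod p + (p - n mod p)) mod p" by (simp add: j_def mod_simps)
    also have "n mod p + (p - n mod p) = p" using p_gt_1 by simp
    finally show ?thesis by simp
  qed
  hence "p dvd n + j" by auto
  moreover have "i = j" if "i < p" "p dvd n + i" for i
  proof -
    have "j < p" using p_gt_1 by (simp add: j_def)
    have "(n + i) mod p = (n + j) mod p" using that \<open>p dvd n + j\<close> by auto
    hence "[n + i = n + j] (mod p)" by (simp add: cong_def)
    hence "[i = j] (mod p)" by (simp add: cong_add_lcancel_nat)
    thus ?thesis using that \<open>j < p\<close> by (simp add: cong_def)
  qed
  moreover have "j < p" using p_gt_1 by (simp add: j_def)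
  ultimately show ?thesis using iff by blast
qed

text \<open>Entry (i, j) of the representation induced from \<chi>, for the transversal 1, g, ...,
  g^(p-1) of \<open>A\<close>. Since \<chi> vanishes off \<open>A\<close>, these matrices are
  monomial.\<close>

definition coeff_fun :: "('a \<Rightarrow> complex) \<Rightarrow> nat \<Rightarrow> nat \<Rightarrow> 'a \<Rightarrow> complex" where
  "coeff_fun \<chi> i j x = \<chi> (inv (g [^] i) \<otimes> x \<otimes> g [^] j)"

lemma A_mult_iff:
  assumes "a \<in> A" "x \<in> carrier G"
  shows "a \<otimes> x \<in> A \<longleftrightarrow> x \<in> A"
proof
  assume "a \<otimes> x \<in> A"
  hence "inv a \<otimes> (a \<otimes> x) \<in> A" using assms by auto
  thus "x \<in> A" using assms A_carrier by (simp flip: m_assoc)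
qed (use assms in auto)

lemma chi_mult_left:
  assumes "\<chi> \<in> chars" "a \<in> A" "x \<in> carrier G"
  shows "\<chi> (a \<otimes> x) = \<chi> a * \<chi> x"
  using chi_mult[OF assms(1,2)] chi_outside[OF assms(1)] A_mult_iff[OF assms(2,3)]
  by (cases "x \<in> A") simp_all

text \<open>Row \<open>i\<close> of the matrix of \<open>x\<close> has a single nonzero entry, so
  the matrix product collapses to one term, on which \<chi> is multiplicative.\<close>

lemma coeff_fun_mult:
  assumes chi: "\<chi> \<in> chars" and xy: "x \<in> carrier G" "y \<in> carrier G"
  shows "(\<Sum>j<p. coeff_fun \<chi> i j x * coeff_fun \<chi> j k y) = coeff_fun \<chi> i k (x \<otimes> y)"
proof -
  let ?x = "inv (g [^] i) \<otimes> x"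
  have xc: "?x \<in> carrier G" using xy gpow_closed by simp
  obtain j where j: "j < p" "?x \<otimes> g [^] j \<in> A" "\<forall>i<p. ?x \<otimes> g [^] i \<in> A \<longrightarrow> i = j"
    using coset_index[OF xc] by blast
  have "(\<Sum>l<p. coeff_fun \<chi> i l x * coeff_fun \<chi> l k y) =
      (\<Sum>l\<in>{j}. coeff_fun \<chi> i l x * coeff_fun \<chi> l k y)"
  proof (rule sum.mono_neutral_right)
    show "\<forall>l\<in>{..<p} - {j}. coeff_fun \<chi> i l x * coeff_fun \<chi> l k y = 0"
    proof
      fix l assume "l \<in> {..<p} - {j}"
      hence "?x \<otimes> g [^] l \<notin> A" using j(3) by auto
      thus "coeff_fun \<chi> i l x * coeff_fun \<chi> l k y = 0"
        using chi_outside[OF chi] by (simp add: coeff_fun_def)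
    qed
  qed (use j(1) in auto)
  also have "\<dots> = \<chi> (?x \<otimes> g [^] j) * \<chi> (inv (g [^] j) \<otimes> y \<otimes> g [^] k)"
    by (simp add: coeff_fun_def)
  also have "\<dots> = \<chi> (?x \<otimes> g [^] j \<otimes> (inv (g [^] j) \<otimes> y \<otimes> g [^] k))"
    using chi j(2) xy gpow_closed by (intro chi_mult_left[symmetric]) auto
  also have "?x \<otimes> g [^] j \<otimes> (inv (g [^] j) \<otimes> y \<otimes> g [^] k) = inv (g [^] i) \<otimes> (x \<otimes> y) \<otimes> g [^] k"
    using xy gpow_closed by (simp add: m_assoc) (simp flip: m_assoc)
  finally show ?thesis by (simp add: coeff_fun_def)
qed

lemma inv_g_g_in_A:
  assumes "i < p" "j < p"
  shows "inv (g [^] (i::nat)) \<otimes> g [^] (j::nat) \<in> A \<longleftrightarrow> i = j"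
proof -
  obtain l where l: "\<forall>k<p. inv (g [^] i) \<otimes> g [^] k \<in> A \<longrightarrow> k = l"
    using coset_index[OF inv_closed[OF gpow_closed[of i]]] by blast
  have "inv (g [^] i) \<otimes> g [^] i \<in> A" using gpow_closed by simp
  thus ?thesis using l assms by auto
qed

lemma coeff_fun_one:
  assumes "\<chi> \<in> chars" "i < p" "j < p"
  shows "coeff_fun \<chi> i j \<one> = (if i = j then 1 else 0)"
  using assms inv_g_g_in_A[OF assms(2,3)] gpow_closed
  by (auto simp: coeff_fun_def chi_one chi_outside)

lemma primitive_cis:
  "cis (2 * pi / real (p ^ Suc k)) ^ (p ^ Suc k) = 1" "cis (2 * pi / real (p ^ Suc k)) ^ (p ^ k) \<noteq> 1"
proof -
  have p0: "real p > 0" using p_gt_1 by simp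
  show "cis (2 * pi / real (p ^ Suc k)) ^ (p ^ Suc k) = 1"
    using p0 by (simp add: DeMoivre del: power_Suc)
  have "cis (2 * pi / real (p ^ Suc k)) ^ (p ^ k) = cis (2 * pi * real 1 / real p)"
    using p0 by (simp add: DeMoivre)
  moreover have "cis (2 * pi * real 1 / real p) \<noteq> cis (2 * pi * real 0 / real p)"
    using inj_onD[OF bij_betw_imp_inj_on[OF bij_betw_roots_unity[of p]], of 1 0] p_gt_1 by auto
  ultimately show "cis (2 * pi / real (p ^ Suc k)) ^ (p ^ k) \<noteq> 1" by simp
qed

lemma coeff_fun_field:
  assumes "\<chi> \<in> exact_chars k"
  shows "coeff_fun \<chi> i j x \<in> cyclotomic_field (p ^ Suc k)"
proof -
  have "\<chi> y \<in> cyclotomic_field (p ^ Suc k)" for y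
  proof (cases "y \<in> A")
    case True
    hence "\<chi> y ^ (p ^ Suc k) = 1" using assms by (simp add: exact_chars_def kills_def)
    then obtain n where "\<chi> y = cis (2 * pi / real (p ^ Suc k)) ^ n"
      using primitive_root_cyclic[OF prime_p primitive_cis] by blast
    thus ?thesis by (simp only: cyclotomic_field_closed)
  next
    case False
    hence "\<chi> y = 0" using assms chi_outside by (simp add: exact_chars_def)
    thus ?thesis by (simp only: cyclotomic_field_closed)
  qed
  thus ?thesis by (simp only: coeff_fun_def)
qed

lemma ext_field:
  assumes "\<chi> \<in> exact_chars k"
  shows "ext (coeff_fun \<chi> i j) f \<in> cyclotomic_field (p ^ Suc k)"
proof -
  have "(\<Sum>x\<in>S. of_rat (c x) * coeff_fun \<chi> i j x) \<in> cyclotomic_field (p ^ Suc k)"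
    for S and c :: "'a \<Rightarrow> rat"
    by (induction S rule: infinite_finite_induct)
      (auto intro!: cyclotomic_field_closed coeff_fun_field[OF assms] simp del: power_Suc)
  thus ?thesis by (simp only: ext_def)
qed

section \<open>Joint injectivity\<close>

lemma sum_A_shift:
  assumes "b \<in> A"
  shows "(\<Sum>a\<in>A. F (b \<otimes> a)) = (\<Sum>a\<in>A. F a :: 'x :: comm_monoid_add)"
  using assms A_carrier
  by (intro sum.reindex_bij_witness[of _ "\<lambda>a. inv b \<otimes> a" "\<lambda>a. b \<otimes> a"]) (auto simp flip: m_assoc)

lemma sum_G_shift:
  assumes "b \<in> carrier G"
  shows "(\<Sum>a\<in>carrier G. F (b \<otimes> a)) = (\<Sum>a\<in>carrier G. F a :: 'x :: comm_monoid_add)"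
  using assms
  by (intro sum.reindex_bij_witness[of _ "\<lambda>a. inv b \<otimes> a" "\<lambda>a. b \<otimes> a"]) (auto simp flip: m_assoc)

lemma rcos_D_iff:
  assumes "x \<in> carrier G" "y \<in> carrier G"
  shows "D #> x = D #> y \<longleftrightarrow> (\<exists>c\<in>D. x = c \<otimes> y)"
proof
  assume "D #> x = D #> y"
  moreover have "x \<in> D #> x" by (rule rcos_self[OF assms(1) subgroup_D])
  ultimately show "\<exists>c\<in>D. x = c \<otimes> y" by (auto simp: r_coset_def)
next
  assume "\<exists>c\<in>D. x = c \<otimes> y"
  then obtain c where "c \<in> D" "x = c \<otimes> y" by blast
  hence "x \<in> D #> y" by (auto simp: r_coset_def)
  thus "D #> x = D #> y" using repr_independence[OF _ assms(2) subgroup_D] by simp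
qed

lemma D_carrier: "c \<in> D \<Longrightarrow> c \<in> carrier G"
  using derived_A A_carrier by blast

lemma finite_D: "finite D"
  using derived_A finite_A by (rule finite_subset)

lemma card_D_pos: "card D > 0"
  using finite_D subgroup.one_closed[OF subgroup_D] by (auto simp: card_gt_0_iff)

abbreviation "proj \<equiv> (\<lambda>x. D #> x)"

lemma lookup_proj:
  assumes f: "Poly_Mapping.keys f \<subseteq> carrier G" and y: "y \<in> carrier G"
  shows "Poly_Mapping.lookup (push proj f) (D #> y) = (\<Sum>c\<in>D. Poly_Mapping.lookup f (c \<otimes> y))"
proof -
  have "Poly_Mapping.lookup (push proj f) (D #> y) =
      (\<Sum>x\<in>carrier G. if D #> x = D #> y then Poly_Mapping.lookup f x else 0)"
    by (rule lookup_push[OF finite_G f])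
  also have "\<dots> = (\<Sum>x\<in>{x\<in>carrier G. D #> x = D #> y}. Poly_Mapping.lookup f x)"
    using finite_G by (simp add: sum.inter_filter)
  also have "{x\<in>carrier G. D #> x = D #> y} = (\<lambda>c. c \<otimes> y) ` D"
  proof (intro equalityI subsetI)
    fix x assume "x \<in> (\<lambda>c. c \<otimes> y) ` D"
    then obtain c where c: "c \<in> D" "x = c \<otimes> y" by blast
    have "x \<in> carrier G" using c y D_carrier by simp
    moreover have "D #> x = D #> y" using rcos_D_iff[OF calculation y] c by blast
    ultimately show "x \<in> {x\<in>carrier G. D #> x = D #> y}" by simp
  qed (use rcos_D_iff[OF _ y] in blast)
  also have "(\<Sum>x\<in>(\<lambda>c. c \<otimes> y) ` D. Poly_Mapping.lookup f x) = (\<Sum>c\<in>D. Poly_Mapping.lookup f (c \<otimes> y))"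
    using y D_carrier by (subst sum.reindex) (auto simp: inj_on_def)
  finally show ?thesis .
qed

text \<open>For fixed \<open>y\<close> it suffices that all Fourier coefficients of the function
  \<open>?F\<close> on \<open>A\<close> vanish. At characters trivial on \<open>D\<close> they
  depend only on the image of \<open>f\<close> in the quotient algebra. At the others, a suitable
  matrix entry is, up to a nonzero factor, the coefficient at a conjugate of a representative, and
  Galois conjugation reaches the given character.\<close>

lemma algebra_map_injective:
  assumes f: "Poly_Mapping.keys f \<subseteq> carrier G" and push0: "push proj f = 0"
    and rep0: "\<And>\<chi> i j. \<chi> \<in> R \<Longrightarrow> i < p \<Longrightarrow> j < p \<Longrightarrow> ext (coeff_fun \<chi> i j) f = 0"
    and R: "\<And>\<chi>. \<chi> \<in> chars \<Longrightarrow> nontriv \<chi> \<Longrightarrow> \<exists>\<rho>\<in>R. \<exists>k. \<rho> \<in> exact_chars k \<and> sim \<rho> \<chi>"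
  shows "f = 0"
proof (rule poly_mapping_eqI)
  fix y
  show "Poly_Mapping.lookup f y = Poly_Mapping.lookup 0 y"
  proof (cases "y \<in> carrier G")
    case False
    thus ?thesis using f by (auto simp: in_keys_iff)
  next
    case y: True
    let ?F = "\<lambda>a. Poly_Mapping.lookup f (a \<otimes> y)"
    have "(\<Sum>a\<in>carrier Ag. complex_of_rat (?F a) * \<chi> a) = 0" if chi: "\<chi> \<in> chars" for \<chi>
    proof (cases "nontriv \<chi>")
      case False
      \<comment> \<open>Such a character is invariant under translation by \<open>D\<close>, which
        permits averaging over \<open>D\<close>.\<close>
      have shift: "(\<Sum>a\<in>A. of_rat (?F a) * \<chi> a) = (\<Sum>a\<in>A. of_rat (?F (c \<otimes> a)) * \<chi> a)" if c: "c \<in> D" for c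
      proof -
        have cA: "c \<in> A" using c derived_A by blast
        have "(\<Sum>a\<in>A. of_rat (?F a) * \<chi> a) = (\<Sum>a\<in>A. of_rat (?F (c \<otimes> a)) * \<chi> (c \<otimes> a))"
          by (rule sum_A_shift[OF cA, symmetric])
        also have "\<dots> = (\<Sum>a\<in>A. of_rat (?F (c \<otimes> a)) * \<chi> a)"
          using c cA False chi by (intro sum.cong HOL.refl) (simp add: chi_mult nontriv_def)
        finally show ?thesis .
      qed
      have "of_nat (card D) * (\<Sum>a\<in>A. of_rat (?F a) * \<chi> a) = (\<Sum>c\<in>D. \<Sum>a\<in>A. of_rat (?F a) * \<chi> a)"
        by simp
      also have "\<dots> = (\<Sum>c\<in>D. \<Sum>a\<in>A. of_rat (?F (c \<otimes> a)) * \<chi> a)"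
        by (rule sum.cong[OF HOL.refl]) (rule shift)
      also have "\<dots> = (\<Sum>a\<in>A. of_rat (\<Sum>c\<in>D. ?F (c \<otimes> a)) * \<chi> a)"
        by (subst sum.swap) (simp add: of_rat_sum sum_distrib_right)
      also have "\<dots> = 0"
      proof (intro sum.neutral ballI)
        fix a assume a: "a \<in> A"
        have "(\<Sum>c\<in>D. ?F (c \<otimes> a)) = (\<Sum>c\<in>D. Poly_Mapping.lookup f (c \<otimes> (a \<otimes> y)))"
          using a y A_carrier D_carrier by (intro sum.cong HOL.refl) (simp add: m_assoc)
        also have "\<dots> = 0" using lookup_proj[OF f, of "a \<otimes> y"] a y A_carrier by (simp add: push0)
        finally show "of_rat (\<Sum>c\<in>D. ?F (c \<otimes> a)) * \<chi> a = 0" by simp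
      qed
      finally show ?thesis using card_D_pos by simp
    next
      case True
      obtain \<rho> k where rho: "\<rho> \<in> R" "\<rho> \<in> exact_chars k" "sim \<rho> \<chi>" using R[OF chi True] by blast
      obtain i r where ir: "i < p" "r \<in> units_below p k" "\<chi> = twist (g [^] i) r \<rho>"
        using sim_twist_g[OF rho(2,3)] .
      have rc: "\<rho> \<in> chars" using rho(2) by (simp add: exact_chars_def)
      have yc: "inv (g [^] i) \<otimes> y \<in> carrier G" using y gpow_closed by simp
      \<comment> \<open>The column of row \<open>i\<close> that sees exactly the coset of
        \<open>A\<close> containing \<open>y\<close>.\<close>
      obtain j where j: "j < p" "inv (g [^] i) \<otimes> y \<otimes> g [^] j \<in> A" using coset_index[OF yc] by blast
      let ?u = "inv (g [^] i) \<otimes> y \<otimes> g [^] j"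
      have val: "coeff_fun \<rho> i j (a \<otimes> y) = \<rho> (cj (g [^] i) a) * \<rho> ?u" if a: "a \<in> A" for a
      proof -
        have "inv (g [^] i) \<otimes> (a \<otimes> y) \<otimes> g [^] j = cj (g [^] i) a \<otimes> ?u"
          using a y A_carrier gpow_closed by (simp add: cj_def m_assoc) (simp flip: m_assoc)
        thus ?thesis using chi_mult[OF rc cj_A[OF gpow_closed a] j(2)] by (simp add: coeff_fun_def)
      qed
      have "0 = ext (coeff_fun \<rho> i j) f" using rep0[OF rho(1) ir(1) j(1)] by simp
      also have "\<dots> = (\<Sum>x\<in>carrier G. of_rat (Poly_Mapping.lookup f x) * coeff_fun \<rho> i j x)"
        by (rule ext_superset[OF finite_G f])
      also have "\<dots> = (\<Sum>x\<in>(\<lambda>a. a \<otimes> y) ` A. of_rat (Poly_Mapping.lookup f x) * coeff_fun \<rho> i j x)"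
      proof (rule sum.mono_neutral_right[OF finite_G])
        show "(\<lambda>a. a \<otimes> y) ` A \<subseteq> carrier G" using y A_carrier by auto
        show "\<forall>x\<in>carrier G - (\<lambda>a. a \<otimes> y) ` A. of_rat (Poly_Mapping.lookup f x) * coeff_fun \<rho> i j x = 0"
        proof
          fix x assume x: "x \<in> carrier G - (\<lambda>a. a \<otimes> y) ` A"
          have xd: "x = (x \<otimes> inv y) \<otimes> y" using x y by (simp add: m_assoc)
          hence nA: "x \<otimes> inv y \<notin> A" using x by blast
          have "inv (g [^] i) \<otimes> x \<otimes> g [^] j = cj (g [^] i) (x \<otimes> inv y) \<otimes> ?u"
            using x y gpow_closed by (simp add: cj_def m_assoc) (simp flip: m_assoc)
          moreover have "cj (g [^] i) (x \<otimes> inv y) \<notin> A" using nA cj_A_iff[OF gpow_closed] x y by simp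
          hence "cj (g [^] i) (x \<otimes> inv y) \<otimes> ?u \<notin> A"
          proof (rule contrapos_nn)
            assume "cj (g [^] i) (x \<otimes> inv y) \<otimes> ?u \<in> A"
            hence "cj (g [^] i) (x \<otimes> inv y) \<otimes> ?u \<otimes> inv ?u \<in> A" using j(2) by blast
            moreover have "cj (g [^] i) (x \<otimes> inv y) \<in> carrier G" using x y gpow_closed by (intro cj_closed) auto
            ultimately show "cj (g [^] i) (x \<otimes> inv y) \<in> A" using A_carrier[OF j(2)] by (simp add: m_assoc)
          qed
          ultimately show "of_rat (Poly_Mapping.lookup f x) * coeff_fun \<rho> i j x = 0"
            using chi_outside[OF rc] by (simp add: coeff_fun_def)
        qed
      qed
      also have "\<dots> = (\<Sum>a\<in>A. of_rat (?F a) * coeff_fun \<rho> i j (a \<otimes> y))"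
        using y A_carrier by (subst sum.reindex) (auto simp: inj_on_def)
      also have "\<dots> = (\<Sum>a\<in>A. of_rat (?F a) * \<rho> (cj (g [^] i) a)) * \<rho> ?u"
        unfolding sum_distrib_right using val by (intro sum.cong HOL.refl) simp
      finally have zero: "(\<Sum>a\<in>A. of_rat (?F a) * \<rho> (cj (g [^] i) a)) = 0"
        using chi_nonzero[OF rc j(2)] by simp
      obtain b where b: "b \<in> A" "\<rho> b ^ (p ^ Suc k) = 1" "\<rho> b ^ (p ^ k) \<noteq> 1"
        using exact_chars_primitive[OF rho(2)] .
      \<comment> \<open>Writing all values as powers of one primitive root brings the vanishing sum
        into the form needed for the passage to exponent \<open>r\<close>.\<close>
      have "\<exists>n. \<rho> (cj (g [^] i) a) = \<rho> b ^ n" if "a \<in> A" for a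
        using primitive_root_cyclic[OF prime_p b(2,3), of "\<rho> (cj (g [^] i) a)"] rho(2) cj_A[OF gpow_closed that]
        unfolding exact_chars_def kills_def by blast
      then obtain n where n: "\<And>a. a \<in> A \<Longrightarrow> \<rho> (cj (g [^] i) a) = \<rho> b ^ n a" by metis
      have "(\<Sum>a\<in>A. of_rat (?F a) * \<rho> b ^ n a) = 0" using zero n by simp
      moreover have "\<not> p dvd r" using ir(2) by (simp add: units_below_def)
      ultimately have "(\<Sum>a\<in>A. of_rat (?F a) * (\<rho> b ^ r) ^ n a) = 0"
        by (intro galois_conjugate_zero[OF prime_p b(2,3) finite_A])
      moreover have "\<chi> a = (\<rho> b ^ r) ^ n a" if "a \<in> A" for a
        using that n[OF that] by (simp add: ir(3) twist_def mult.commute flip: power_mult)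
      ultimately show ?thesis by simp
    qed
    hence "complex_of_rat (?F \<one>) = 0"
      by (rule C.fourier_injective[where f = "\<lambda>a. complex_of_rat (?F a)"]) auto
    thus ?thesis using y by simp
  qed
qed

end

section \<open>Joint surjectivity\<close>

context cyclic_extension
begin

text \<open>Write \<open>z\<close> as a rational combination of powers of a primitive root \<rho> b.
  The same combination of the b^m, multiplied by the idempotent of the Galois orbit of \<rho>, has
  value \<open>z\<close> at \<rho> and 0 off the orbit. Its coefficients are rational because those
  of the idempotent are Ramanujan sums up to the factor 1/|A|.\<close>

lemma character_projection_exists:
  assumes rho: "\<rho> \<in> exact_chars k" and z: "z \<in> cyclotomic_field (p ^ Suc k)"
  shows "\<exists>w :: 'a \<Rightarrow> rat. (\<Sum>a\<in>A. of_rat (w a) * \<rho> a) = z \<and>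
    (\<forall>\<chi>\<in>chars. (\<forall>r. \<not> p dvd r \<longrightarrow> \<chi> \<noteq> twist \<one> r \<rho>) \<longrightarrow> (\<Sum>a\<in>A. of_rat (w a) * \<chi> a) = 0)"
proof -
  let ?d = "p ^ Suc k" and ?U = "units_below p k"
  have rc: "\<rho> \<in> chars" "kills ?d \<rho>" using rho by (auto simp: exact_chars_def)
  have d0: "?d > 0" using p_gt_1 by simp
  obtain F :: "rat poly" where F: "z = eval_poly of_rat F (cis (2 * pi / real ?d))"
    using cyclotomic_field_poly[OF z d0] by blast
  obtain b' where b': "b' \<in> A" "\<rho> b' ^ ?d = 1" "\<rho> b' ^ (p ^ k) \<noteq> 1"
    using exact_chars_primitive[OF rho] .
  obtain n where n: "cis (2 * pi / real ?d) = \<rho> b' ^ n"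
    using primitive_root_cyclic[OF prime_p b'(2,3) primitive_cis(1)] by blast
  define b where "b = b' [^] n"
  have b: "b \<in> A" "\<rho> b = cis (2 * pi / real ?d)"
    unfolding b_def n by (rule pow_A[OF b'(1)], rule chi_pow[OF rc(1) b'(1)])
  define N where "N = degree F"
  define c where "c m = coeff F m" for m
  have zsum: "z = (\<Sum>m\<le>N. of_rat (c m) * \<rho> (b [^] m))"
    unfolding F eval_poly_def poly_altdef N_def c_def
    using b chi_pow[OF rc(1) b(1)]
    by (intro sum.mono_neutral_cong_left) (auto simp: degree_map_poly_le coeff_map_poly coeff_eq_0)
  \<comment> \<open>The sum of the Galois conjugates of \<rho>; at an inverse argument it is |A|
    times the coefficient of the orbit idempotent.\<close>
  define T where "T x = (\<Sum>r\<in>?U. \<rho> x ^ r)" for x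
  have "\<exists>t. T x = of_rat t" if "x \<in> A" for x
  proof -
    have "T x \<in> \<rat>" unfolding T_def
      by (rule ramanujan_rational) (use rc that p_gt_1 in \<open>auto simp: kills_def\<close>)
    thus ?thesis by (auto elim: Rats_cases)
  qed
  then obtain t where t: "\<And>x. x \<in> A \<Longrightarrow> T x = of_rat (t x)" by metis
  define w where "w a = (\<Sum>m\<le>N. c m * t (b [^] m \<otimes> inv a)) / of_nat (card A)" for a
  have cardA: "card A > 0" using finite_A SA.one_closed card_gt_0_iff by blast
  \<comment> \<open>Orthogonality, applied to the quotient \<psi> of \<chi> by the
    \<open>r\<close>-th power of \<rho>.\<close>
  have char_quot: "(\<Sum>a\<in>A. inverse (\<rho> a) ^ r * \<chi> a) = (if \<chi> = twist \<one> r \<rho> then of_nat (card A) else 0)"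
    if chi: "\<chi> \<in> chars" for \<chi> r
  proof -
    define \<psi> where "\<psi> a = (if a \<in> A then inverse (\<rho> a) ^ r * \<chi> a else 0)" for a
    have psi: "\<psi> \<in> chars"
      by (rule chi_closedI) (use rc chi in \<open>auto simp: \<psi>_def chi_one chi_mult power_mult_distrib\<close>)
    have "(\<forall>a\<in>A. \<psi> a = 1) \<longleftrightarrow> \<chi> = twist \<one> r \<rho>"
    proof
      assume 1: "\<forall>a\<in>A. \<psi> a = 1"
      show "\<chi> = twist \<one> r \<rho>"
      proof
        fix a
        show "\<chi> a = twist \<one> r \<rho> a"
        proof (cases "a \<in> A")
          case True
          hence "inverse (\<rho> a) ^ r * \<chi> a = 1" using 1 by (simp add: \<psi>_def)
          thus ?thesis using True A_carrier chi_nonzero[OF rc(1) True]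
            by (simp add: twist_def cj_one power_inverse field_simps)
        qed (use chi chi_outside in \<open>auto simp: twist_def\<close>)
      qed
    next
      assume "\<chi> = twist \<one> r \<rho>"
      thus "\<forall>a\<in>A. \<psi> a = 1" using A_carrier chi_nonzero[OF rc(1)]
        by (auto simp: \<psi>_def twist_def cj_one power_inverse)
    qed
    moreover have "(\<Sum>a\<in>A. inverse (\<rho> a) ^ r * \<chi> a) = (\<Sum>a\<in>A. \<psi> a)"
      by (simp add: \<psi>_def)
    moreover have "(\<Sum>a\<in>A. \<psi> a) = (if \<forall>a\<in>A. \<psi> a = 1 then of_nat (card A) else 0)"
    proof -
      have "carrier Ag = A" by simp
      from C.sum_character_subgroup[OF psi C.subgroup_self, unfolded this] show ?thesis .
    qed
    ultimately show ?thesis by (simp only:)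
  qed
  have main: "(\<Sum>a\<in>A. of_rat (w a) * \<chi> a) =
      (\<Sum>m\<le>N. of_rat (c m) * (\<Sum>r\<in>?U. \<rho> (b [^] m) ^ r * (if \<chi> = twist \<one> r \<rho> then 1 else 0)))"
    if chi: "\<chi> \<in> chars" for \<chi>
  proof -
    have "of_rat (w a) * \<chi> a = (\<Sum>m\<le>N. of_rat (c m) * (\<Sum>r\<in>?U. \<rho> (b [^] m) ^ r * (inverse (\<rho> a) ^ r * \<chi> a))) / of_nat (card A)"
      if a: "a \<in> A" for a
    proof -
      have eq: "(\<Sum>r\<in>?U. \<rho> (b [^] m) ^ r * (inverse (\<rho> a) ^ r * \<chi> a)) = of_rat (t (b [^] m \<otimes> inv a)) * \<chi> a"
        for m :: nat
      proof -
        have "b [^] m \<otimes> inv a \<in> A" using a b pow_A by blast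
        hence "of_rat (t (b [^] m \<otimes> inv a)) = T (b [^] m \<otimes> inv a)" using t by simp
        also have "\<dots> = (\<Sum>r\<in>?U. \<rho> (b [^] m) ^ r * inverse (\<rho> a) ^ r)"
          unfolding T_def using a b(1) pow_A[OF b(1), of m] rc(1)
          by (simp add: chi_mult chi_inv power_mult_distrib)
        finally show ?thesis by (simp add: sum_distrib_right mult.assoc)
      qed
      show ?thesis unfolding eq
        by (simp add: w_def of_rat_divide of_rat_sum of_rat_mult sum_distrib_right mult.assoc)
    qed
    hence "(\<Sum>a\<in>A. of_rat (w a) * \<chi> a) =
       (\<Sum>a\<in>A. (\<Sum>m\<le>N. of_rat (c m) * (\<Sum>r\<in>?U. \<rho> (b [^] m) ^ r * (inverse (\<rho> a) ^ r * \<chi> a))) / of_nat (card A))"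
      by (intro sum.cong HOL.refl) simp
    also have "\<dots> = (\<Sum>m\<le>N. of_rat (c m) * (\<Sum>r\<in>?U. \<rho> (b [^] m) ^ r * (\<Sum>a\<in>A. inverse (\<rho> a) ^ r * \<chi> a))) / of_nat (card A)"
      unfolding sum_divide_distrib[symmetric] sum_distrib_left
      by (subst sum.swap, rule arg_cong[of _ _ "\<lambda>x. x / of_nat (card A)"], rule sum.cong[OF HOL.refl], rule sum.swap)
    also have "\<dots> = (\<Sum>m\<le>N. of_rat (c m) * (\<Sum>r\<in>?U. \<rho> (b [^] m) ^ r * (if \<chi> = twist \<one> r \<rho> then 1 else 0)))"
    proof -
      have "(\<Sum>r\<in>?U. \<rho> (b [^] m) ^ r * (if \<chi> = twist \<one> r \<rho> then of_nat (card A) else 0)) =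
          (\<Sum>r\<in>?U. \<rho> (b [^] m) ^ r * (if \<chi> = twist \<one> r \<rho> then 1 else 0)) * of_nat (card A)" for m :: nat
        unfolding sum_distrib_right by (intro sum.cong HOL.refl) simp
      thus ?thesis unfolding char_quot[OF chi] sum_divide_distrib
        using cardA by (intro sum.cong HOL.refl) simp
    qed
    finally show ?thesis .
  qed
  show ?thesis
  proof (intro exI[of _ w] conjI ballI impI)
    have one: "1 \<in> ?U" using p_gt_1 one_less_power[of p "Suc k"] by (simp add: units_below_def del: power_Suc)
    have only: "\<rho> = twist \<one> r \<rho> \<longleftrightarrow> r = 1" if "r \<in> ?U" for r
    proof
      assume "\<rho> = twist \<one> r \<rho>"
      from fun_cong[OF this, of b'] have "\<rho> b' ^ 1 = \<rho> b' ^ r" using b' A_carrier by (simp add: twist_def cj_one)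
      thus "r = 1" using primitive_root_inj[OF prime_p b'(2,3)] one that
        by (auto simp: inj_on_def units_below_def simp del: power_Suc)
    next
      assume "r = 1"
      thus "\<rho> = twist \<one> r \<rho>" using twist_one[OF rc(1), of 1] by simp
    qed
    have "(\<Sum>r\<in>?U. \<rho> (b [^] m) ^ r * (if \<rho> = twist \<one> r \<rho> then 1 else 0)) = \<rho> (b [^] m)" for m :: nat
    proof -
      have "(\<Sum>r\<in>?U. \<rho> (b [^] m) ^ r * (if \<rho> = twist \<one> r \<rho> then 1 else 0)) =
          (\<Sum>r\<in>?U. if r = 1 then \<rho> (b [^] m) else 0)"
        by (intro sum.cong HOL.refl) (simp add: only)
      also have "\<dots> = \<rho> (b [^] m)" using one by (simp add: finite_units_below)
      finally show ?thesis .
    qed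
    thus "(\<Sum>a\<in>A. of_rat (w a) * \<rho> a) = z" unfolding main[OF rc(1)] zsum by (simp only:)
  next
    fix \<chi> assume chi: "\<chi> \<in> chars" and no: "\<forall>r. \<not> p dvd r \<longrightarrow> \<chi> \<noteq> twist \<one> r \<rho>"
    have "(\<Sum>r\<in>?U. \<rho> (b [^] m) ^ r * (if \<chi> = twist \<one> r \<rho> then 1 else 0)) = 0" for m :: nat
      using no by (intro sum.neutral) (auto simp: units_below_def)
    thus "(\<Sum>a\<in>A. of_rat (w a) * \<chi> a) = 0" unfolding main[OF chi] by (simp only: mult_zero_right sum.neutral_const)
  qed
qed

lemma sum_nontriv_D:
  assumes "\<chi> \<in> chars" "nontriv \<chi>"
  shows "(\<Sum>c\<in>D. \<chi> c) = 0"
  unfolding C.sum_character_subgroup[OF assms(1) subgroup_D_A]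
  by (rule if_not_P) (use assms(2) in \<open>unfold nontriv_def\<close>)

lemma sum_nontriv_conj_D:
  assumes "\<chi> \<in> chars" "x \<in> carrier G" "nontriv \<chi>"
  shows "(\<Sum>c\<in>D. \<chi> (cj x c)) = 0"
proof -
  have tw: "twist x 1 \<chi> \<in> chars" by (rule twist_chars[OF assms(1,2)])
  have eq: "twist x 1 \<chi> c = \<chi> (cj x c)" if "c \<in> D" for c using that derived_A by (auto simp: twist_def)
  have "nontriv (twist x 1 \<chi>)"
    unfolding nontriv_def
  proof
    assume 1: "\<forall>c\<in>D. twist x 1 \<chi> c = 1"
    have "\<chi> c = 1" if c: "c \<in> D" for c
    proof -
      have "cj (inv x) c \<in> D" using c assms(2) by (intro cj_D) auto
      hence "\<chi> (cj x (cj (inv x) c)) = 1" using 1 eq by metis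
      thus ?thesis using cj_inv_cancel(2)[OF assms(2) D_carrier[OF c]] by simp
    qed
    thus False using assms(3) by (simp add: nontriv_def)
  qed
  hence "(\<Sum>c\<in>D. twist x 1 \<chi> c) = 0" by (rule sum_nontriv_D[OF tw])
  thus ?thesis using eq by simp
qed

text \<open>The preimage is \<open>g\<^sup>i w g\<^sup>-\<^sup>j\<close> for the element \<open>w\<close> of \<open>\<rat>A\<close> given by \<open>character_projection_exists\<close>.\<close>

lemma matrix_unit_preimage:
  assumes rho: "\<rho> \<in> exact_chars k" and z: "z \<in> cyclotomic_field (p ^ Suc k)" and ij: "i < p" "j < p"
  shows "\<exists>f. Poly_Mapping.keys f \<subseteq> carrier G \<and> push proj f = 0 \<and>
    (\<forall>i'<p. \<forall>j'<p. ext (coeff_fun \<rho> i' j') f = (if i' = i \<and> j' = j then z else 0)) \<and>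
    (\<forall>l. \<forall>\<chi>\<in>exact_chars l. \<not> sim \<rho> \<chi> \<longrightarrow> (\<forall>i' j'. ext (coeff_fun \<chi> i' j') f = 0))"
proof -
  have rc: "\<rho> \<in> chars" "nontriv \<rho>" using rho by (auto simp: exact_chars_def)
  obtain w :: "'a \<Rightarrow> rat" where w1: "(\<Sum>a\<in>A. of_rat (w a) * \<rho> a) = z"
    and w0': "\<forall>\<chi>\<in>chars. (\<forall>r. \<not> p dvd r \<longrightarrow> \<chi> \<noteq> twist \<one> r \<rho>) \<longrightarrow> (\<Sum>a\<in>A. of_rat (w a) * \<chi> a) = 0"
    using character_projection_exists[OF rho z] by (elim exE conjE)
  have w0: "(\<Sum>a\<in>A. of_rat (w a) * \<chi> a) = 0"
    if "\<chi> \<in> chars" "\<And>r. \<not> p dvd r \<Longrightarrow> \<chi> \<noteq> twist \<one> r \<rho>" for \<chi>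
    using w0' that by blast
  define u where "u a = g [^] i \<otimes> a \<otimes> inv (g [^] j)" for a
  define f where "f = from_fun A u w"
  have uc: "u a \<in> carrier G" if "a \<in> A" for a using that A_carrier gpow_closed by (simp add: u_def)
  \<comment> \<open>Every matrix entry of \<open>f\<close> is the Fourier coefficient of
    \<open>w\<close> at a conjugate of \<chi>, times a factor that depends only on the
    position.\<close>
  have entry: "ext (coeff_fun \<chi> i' j') f =
      (\<Sum>a\<in>A. of_rat (w a) * twist (inv (g [^] i) \<otimes> g [^] i') 1 \<chi> a) *
        \<chi> (inv (g [^] i') \<otimes> g [^] i \<otimes> (inv (g [^] j) \<otimes> g [^] j'))"
    if chi: "\<chi> \<in> chars" for \<chi> i' j'
  proof -
    let ?s = "inv (g [^] i) \<otimes> g [^] i'"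
    let ?v = "inv (g [^] i') \<otimes> g [^] i \<otimes> (inv (g [^] j) \<otimes> g [^] j')"
    have sc: "?s \<in> carrier G" "?v \<in> carrier G" using gpow_closed by auto
    have "coeff_fun \<chi> i' j' (u a) = twist ?s 1 \<chi> a * \<chi> ?v" if a: "a \<in> A" for a
    proof -
      have "inv (g [^] i') \<otimes> u a \<otimes> g [^] j' = cj ?s a \<otimes> ?v"
        using a A_carrier gpow_closed by (simp add: u_def cj_def inv_mult_group m_assoc) (simp flip: m_assoc)
      thus ?thesis using chi_mult_left[OF chi cj_A[OF sc(1) a] sc(2)] a
        by (simp add: coeff_fun_def twist_def)
    qed
    thus ?thesis unfolding f_def ext_from_fun sum_distrib_right
      by (intro sum.cong HOL.refl) (simp add: mult.assoc)
  qed
  \<comment> \<open>Coset sums of \<open>w\<close> over \<open>D\<close> have zero Fourier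
    coefficients: a character nontrivial on \<open>D\<close> sums to 0 over \<open>D\<close>, and
    one trivial on \<open>D\<close> is outside the Galois orbit of \<rho>.\<close>
  have avg: "(\<Sum>c\<in>D. w (c \<otimes> a)) = 0" if a: "a \<in> A" for a
  proof -
    define W where "W a = (\<Sum>c\<in>D. w (c \<otimes> a))" for a
    have "(\<Sum>a\<in>carrier Ag. complex_of_rat (W a) * \<chi> a) = 0" if chi: "\<chi> \<in> chars" for \<chi>
    proof -
      have "(\<Sum>a\<in>A. complex_of_rat (W a) * \<chi> a) = (\<Sum>c\<in>D. \<Sum>a\<in>A. of_rat (w (c \<otimes> a)) * \<chi> a)"
        unfolding W_def of_rat_sum sum_distrib_right by (rule sum.swap)
      also have "\<dots> = (\<Sum>c\<in>D. \<chi> (inv c) * (\<Sum>a\<in>A. of_rat (w a) * \<chi> a))"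
      proof (rule sum.cong[OF HOL.refl])
        fix c assume c: "c \<in> D"
        have cA: "c \<in> A" using c derived_A by blast
        have "\<chi> a = \<chi> (inv c) * \<chi> (c \<otimes> a)" if "a \<in> A" for a
          using that cA chi chi_nonzero[OF chi cA] by (simp add: chi_mult chi_inv)
        hence "(\<Sum>a\<in>A. of_rat (w (c \<otimes> a)) * \<chi> a) = (\<Sum>a\<in>A. \<chi> (inv c) * (of_rat (w (c \<otimes> a)) * \<chi> (c \<otimes> a)))"
          by (intro sum.cong HOL.refl) simp
        also have "\<dots> = (\<Sum>a\<in>A. \<chi> (inv c) * (of_rat (w a) * \<chi> a))"
          by (rule sum_A_shift[OF cA])
        finally show "(\<Sum>a\<in>A. of_rat (w (c \<otimes> a)) * \<chi> a) = \<chi> (inv c) * (\<Sum>a\<in>A. of_rat (w a) * \<chi> a)"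
          by (simp add: sum_distrib_left)
      qed
      also have "\<dots> = (\<Sum>c\<in>D. \<chi> (inv c)) * (\<Sum>a\<in>A. of_rat (w a) * \<chi> a)"
        by (simp add: sum_distrib_right)
      also have "\<dots> = 0"
      proof (cases "nontriv \<chi>")
        case True
        have "(\<Sum>c\<in>D. \<chi> (inv c)) = (\<Sum>c\<in>D. \<chi> c)"
          using subgroup.m_inv_closed[OF subgroup_D] D_carrier
          by (intro sum.reindex_bij_witness[of _ "\<lambda>c. inv c" "\<lambda>c. inv c"]) auto
        also have "\<dots> = 0" by (rule sum_nontriv_D[OF chi True])
        finally show ?thesis by simp
      next
        case False
        have "\<chi> \<noteq> twist \<one> r \<rho>" if "\<not> p dvd r" for r
          using twist_exact[OF rho one_closed that] False by (auto simp: exact_chars_def)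
        thus ?thesis using w0[OF chi] by simp
      qed
      finally show ?thesis by simp
    qed
    hence "complex_of_rat (W a) = 0"
      by (rule C.fourier_injective[where f = "\<lambda>a. complex_of_rat (W a)"]) (use a in auto)
    thus ?thesis by (simp add: W_def)
  qed
  have push0: "push proj f = 0"
  proof (rule poly_mapping_eqI)
    fix q
    \<comment> \<open>Left translation of \<open>a\<close> by \<open>D\<close> does not change the
      coset of \<open>u a\<close>, so \<open>avg\<close> gives the vanishing of the image in the
      quotient algebra.\<close>
    have proj_shift: "D #> u (c \<otimes> a) = D #> u a" if "c \<in> D" "a \<in> A" for c a
    proof -
      have "u (c \<otimes> a) = cj (inv (g [^] i)) c \<otimes> u a"
        using that A_carrier D_carrier gpow_closed by (simp add: u_def cj_def m_assoc) (simp flip: m_assoc)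
      moreover have "cj (inv (g [^] i)) c \<in> D" using that gpow_closed by (intro cj_D) auto
      moreover have "u (c \<otimes> a) \<in> carrier G" using that derived_A by (intro uc) auto
      ultimately show ?thesis using rcos_D_iff[OF _ uc[OF that(2)]] by blast
    qed
    have "rat_of_nat (card D) * Poly_Mapping.lookup (push proj f) q =
        (\<Sum>c\<in>D. \<Sum>a\<in>A. if D #> u a = q then w a else 0)"
      unfolding f_def push_from_fun lookup_from_fun[OF finite_A] by simp
    also have "\<dots> = (\<Sum>c\<in>D. \<Sum>a\<in>A. if D #> u a = q then w (c \<otimes> a) else 0)"
    proof (rule sum.cong[OF HOL.refl])
      fix c assume c: "c \<in> D"
      have cA: "c \<in> A" using c derived_A by blast
      have "(\<Sum>a\<in>A. if D #> u a = q then w a else 0) = (\<Sum>a\<in>A. if D #> u (c \<otimes> a) = q then w (c \<otimes> a) else 0)"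
        by (rule sum_A_shift[OF cA, symmetric])
      also have "\<dots> = (\<Sum>a\<in>A. if D #> u a = q then w (c \<otimes> a) else 0)"
        using proj_shift[OF c] by (intro sum.cong HOL.refl) simp
      finally show "(\<Sum>a\<in>A. if D #> u a = q then w a else 0) = \<dots>" .
    qed
    also have "\<dots> = (\<Sum>a\<in>A. \<Sum>c\<in>D. if D #> u a = q then w (c \<otimes> a) else 0)" by (rule sum.swap)
    also have "\<dots> = 0"
    proof (rule sum.neutral, rule ballI)
      fix a assume "a \<in> A"
      thus "(\<Sum>c\<in>D. if D #> u a = q then w (c \<otimes> a) else 0) = 0"
        using avg by (cases "D #> u a = q") simp_all
    qed
    finally show "Poly_Mapping.lookup (push proj f) q = Poly_Mapping.lookup 0 q"
      using card_D_pos by simp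
  qed
  show ?thesis
  proof (intro exI[of _ f] conjI ballI allI impI)
    show "Poly_Mapping.keys f \<subseteq> carrier G" unfolding f_def by (rule keys_from_fun) (rule uc)
    show "push proj f = 0" by (rule push0)
    show "ext (coeff_fun \<chi> i' j') f = 0" if "\<chi> \<in> exact_chars l" "\<not> sim \<rho> \<chi>" for \<chi> l i' j'
    proof -
      let ?s = "inv (g [^] i) \<otimes> g [^] i'"
      have sc: "?s \<in> carrier G" using gpow_closed by auto
      have chi: "\<chi> \<in> chars" using that by (simp add: exact_chars_def)
      have "twist ?s 1 \<chi> \<noteq> twist \<one> r \<rho>" if r: "\<not> p dvd r" for r
      proof
        assume eq: "twist ?s 1 \<chi> = twist \<one> r \<rho>"
        have "sim \<rho> (twist ?s 1 \<chi>)" unfolding eq sim_def using r by blast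
        moreover have "sim (twist ?s 1 \<chi>) \<chi>"
        proof (rule sim_sym[OF \<open>\<chi> \<in> exact_chars l\<close>])
          show "sim \<chi> (twist ?s 1 \<chi>)" unfolding sim_def using sc p_gt_1 by (intro bexI[OF _ sc] exI[of _ 1]) auto
        qed
        ultimately show False using \<open>\<not> sim \<rho> \<chi>\<close> sim_trans by blast
      qed
      thus ?thesis unfolding entry[OF chi] using w0[OF twist_chars[OF chi sc]] by simp
    qed
    show "ext (coeff_fun \<rho> i' j') f = (if i' = i \<and> j' = j then z else 0)" if i'j': "i' < p" "j' < p" for i' j'
    proof (cases "i' = i")
      case True
      have "twist \<one> 1 \<rho> = \<rho>" by (rule twist_one[OF rc(1)]) simp
      moreover have "\<rho> (inv (g [^] j) \<otimes> g [^] j') = (if j' = j then 1 else 0)"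
        using inv_g_g_in_A[OF ij(2) i'j'(2)] gpow_closed chi_one[OF rc(1)] chi_outside[OF rc(1)] by auto
      ultimately show ?thesis unfolding entry[OF rc(1)] using True w1 gpow_closed by simp
    next
      case False
      let ?s = "inv (g [^] i) \<otimes> g [^] i'"
      have sc: "?s \<in> carrier G" using gpow_closed by auto
      \<comment> \<open>In every row other than \<open>i\<close>, freeness keeps the conjugate
        outside the Galois orbit of \<rho>, where \<open>w\<close> has coefficient 0.\<close>
      have "twist ?s 1 \<rho> \<noteq> twist \<one> r \<rho>" if r: "\<not> p dvd r" for r
      proof
        assume eq: "twist ?s 1 \<rho> = twist \<one> r \<rho>"
        have e: "\<rho> (cj (g [^] i') b) ^ 1 = \<rho> (cj (g [^] i) b) ^ r" if b: "b \<in> A" for b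
        proof -
          have a: "cj (g [^] i) b \<in> A" by (rule cj_A[OF gpow_closed b])
          have "cj ?s (cj (g [^] i) b) = cj (g [^] i') b"
            using b A_carrier gpow_closed by (simp add: cj_cj) (simp flip: m_assoc)
          thus ?thesis using fun_cong[OF eq, of "cj (g [^] i) b"] a A_carrier by (simp add: twist_def cj_one)
        qed
        have "\<not> i' < i" using twist_g_eq_conj[OF rho _ ij(1) r e] by blast
        moreover have "\<not> p dvd 1" using p_gt_1 by simp
        hence "\<not> i < i'" using twist_g_eq_conj[OF rho _ i'j'(1) _ e[symmetric]] by blast
        ultimately show False using False by simp
      qed
      hence "(\<Sum>a\<in>A. of_rat (w a) * twist ?s 1 \<rho> a) = 0" using w0[OF twist_chars[OF rc(1) sc]] by simp
      thus ?thesis unfolding entry[OF rc(1)] using False by simp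
    qed
  qed
qed

text \<open>The lift is constant on cosets of \<open>D\<close>. Left translation by \<open>D\<close>
  therefore fixes it but multiplies an entry by values of a nontrivial character of
  \<open>D\<close>, whose sum is 0.\<close>

lemma quotient_preimage:
  fixes q :: "'a set \<Rightarrow>\<^sub>0 rat"
  assumes q: "Poly_Mapping.keys q \<subseteq> carrier (G Mod D)"
  shows "\<exists>f. Poly_Mapping.keys f \<subseteq> carrier G \<and> push proj f = q \<and>
    (\<forall>\<chi>\<in>chars. nontriv \<chi> \<longrightarrow> (\<forall>i j. ext (coeff_fun \<chi> i j) f = 0))"
proof -
  define w where "w x = Poly_Mapping.lookup q (D #> x) / of_nat (card D)" for x
  define f where "f = from_fun (carrier G) id w"
  have keys: "Poly_Mapping.keys f \<subseteq> carrier G" unfolding f_def by (rule keys_from_fun) simp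
  have lookup_f: "Poly_Mapping.lookup f x = w x" if "x \<in> carrier G" for x
    using that finite_G by (simp add: f_def lookup_from_fun)
  have wD: "w (c \<otimes> x) = w x" if "c \<in> D" "x \<in> carrier G" for c x
  proof -
    have "c \<otimes> x \<in> carrier G" using that D_carrier by simp
    hence "D #> (c \<otimes> x) = D #> x" using rcos_D_iff that by blast
    thus ?thesis by (simp add: w_def)
  qed
  show ?thesis
  proof (intro exI[of _ f] conjI ballI allI impI, rule keys)
    show "push proj f = q"
    proof (rule poly_mapping_eqI)
      fix Y
      show "Poly_Mapping.lookup (push proj f) Y = Poly_Mapping.lookup q Y"
      proof (cases "Y \<in> carrier (G Mod D)")
        case True
        then obtain y where y: "y \<in> carrier G" "Y = D #> y" by (auto simp: carrier_FactGroup)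
        have "Poly_Mapping.lookup (push proj f) Y = (\<Sum>c\<in>D. w y)"
          unfolding y(2) lookup_proj[OF keys y(1)]
          using lookup_f wD y D_carrier by (intro sum.cong HOL.refl) simp
        thus ?thesis using card_D_pos y by (simp add: w_def)
      next
        case False
        hence "Poly_Mapping.lookup q Y = 0" using q by (auto simp: in_keys_iff)
        moreover have "Poly_Mapping.lookup (push proj f) Y = 0"
          unfolding lookup_push[OF finite_G keys] using False
          by (intro sum.neutral) (auto simp: carrier_FactGroup)
        ultimately show ?thesis by simp
      qed
    qed
  next
    fix \<chi> i j assume chi: "\<chi> \<in> chars" "nontriv \<chi>"
    have "of_nat (card D) * ext (coeff_fun \<chi> i j) f =
        (\<Sum>c\<in>D. \<Sum>x\<in>carrier G. of_rat (w x) * coeff_fun \<chi> i j x)"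
      by (simp add: f_def ext_from_fun)
    also have "\<dots> = (\<Sum>c\<in>D. \<Sum>x\<in>carrier G. of_rat (w x) * (\<chi> (cj (g [^] i) c) * coeff_fun \<chi> i j x))"
    proof (rule sum.cong[OF HOL.refl])
      fix c assume c: "c \<in> D"
      have "(\<Sum>x\<in>carrier G. of_rat (w x) * coeff_fun \<chi> i j x) =
          (\<Sum>x\<in>carrier G. of_rat (w (c \<otimes> x)) * coeff_fun \<chi> i j (c \<otimes> x))"
        by (rule sum_G_shift[OF D_carrier[OF c], symmetric])
      also have "\<dots> = (\<Sum>x\<in>carrier G. of_rat (w x) * (\<chi> (cj (g [^] i) c) * coeff_fun \<chi> i j x))"
      proof (rule sum.cong[OF HOL.refl])
        fix x assume x: "x \<in> carrier G"
        have cc: "cj (g [^] i) c \<in> A" using c derived_A cj_A[OF gpow_closed] by blast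
        have "inv (g [^] i) \<otimes> (c \<otimes> x) \<otimes> g [^] j = cj (g [^] i) c \<otimes> (inv (g [^] i) \<otimes> x \<otimes> g [^] j)"
          using D_carrier[OF c] x gpow_closed by (simp add: cj_def m_assoc) (simp flip: m_assoc)
        hence "coeff_fun \<chi> i j (c \<otimes> x) = \<chi> (cj (g [^] i) c) * coeff_fun \<chi> i j x"
          using chi_mult_left[OF chi(1) cc] x gpow_closed by (simp add: coeff_fun_def)
        thus "of_rat (w (c \<otimes> x)) * coeff_fun \<chi> i j (c \<otimes> x) =
            of_rat (w x) * (\<chi> (cj (g [^] i) c) * coeff_fun \<chi> i j x)"
          using wD[OF c x] by simp
      qed
      finally show "(\<Sum>x\<in>carrier G. of_rat (w x) * coeff_fun \<chi> i j x) = \<dots>" .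
    qed
    also have "\<dots> = (\<Sum>c\<in>D. \<chi> (cj (g [^] i) c)) * (\<Sum>x\<in>carrier G. of_rat (w x) * coeff_fun \<chi> i j x)"
      unfolding sum_product by (intro sum.cong HOL.refl) simp
    also have "\<dots> = 0" using sum_nontriv_conj_D[OF chi(1) gpow_closed chi(2), of i] by simp
    finally show "ext (coeff_fun \<chi> i j) f = 0" using card_D_pos by simp
  qed
qed

text \<open>The lift of \<open>q\<close> has zero matrices and the lift of a single entry is zero
  everywhere else, so the sum of all these lifts solves the problem.\<close>

lemma algebra_map_surjective:
  fixes q :: "'a set \<Rightarrow>\<^sub>0 rat"
  assumes q: "Poly_Mapping.keys q \<subseteq> carrier (G Mod D)"
    and R: "finite R" "\<And>\<rho>. \<rho> \<in> R \<Longrightarrow> \<rho> \<in> exact_chars (\<kappa> \<rho>)"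
    and sep: "\<And>\<rho> \<rho>'. \<rho> \<in> R \<Longrightarrow> \<rho>' \<in> R \<Longrightarrow> sim \<rho> \<rho>' \<Longrightarrow> \<rho> = \<rho>'"
    and M: "\<And>\<rho> i j. \<rho> \<in> R \<Longrightarrow> i < p \<Longrightarrow> j < p \<Longrightarrow> M \<rho> i j \<in> cyclotomic_field (p ^ Suc (\<kappa> \<rho>))"
  shows "\<exists>f. Poly_Mapping.keys f \<subseteq> carrier G \<and> push proj f = q \<and>
    (\<forall>\<rho>\<in>R. \<forall>i<p. \<forall>j<p. ext (coeff_fun \<rho> i j) f = M \<rho> i j)"
proof -
  obtain f0 where f0: "Poly_Mapping.keys f0 \<subseteq> carrier G" "push proj f0 = q"
    "\<forall>\<chi>\<in>chars. nontriv \<chi> \<longrightarrow> (\<forall>i j. ext (coeff_fun \<chi> i j) f0 = 0)"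
    using quotient_preimage[OF q] by (elim exE conjE)
  have "\<exists>f. Poly_Mapping.keys f \<subseteq> carrier G \<and> push proj f = 0 \<and>
      (\<forall>i'<p. \<forall>j'<p. ext (coeff_fun \<rho> i' j') f = (if i' = i \<and> j' = j then M \<rho> i j else 0)) \<and>
      (\<forall>\<chi>\<in>R - {\<rho>}. \<forall>i' j'. ext (coeff_fun \<chi> i' j') f = 0)"
    if rho: "\<rho> \<in> R" and ij: "i < p" "j < p" for \<rho> i j
  proof -
    obtain f where f: "Poly_Mapping.keys f \<subseteq> carrier G" "push proj f = 0"
      "\<forall>i'<p. \<forall>j'<p. ext (coeff_fun \<rho> i' j') f = (if i' = i \<and> j' = j then M \<rho> i j else 0)"
      "\<forall>l. \<forall>\<chi>\<in>exact_chars l. \<not> sim \<rho> \<chi> \<longrightarrow> (\<forall>i' j'. ext (coeff_fun \<chi> i' j') f = 0)"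
      using matrix_unit_preimage[OF R(2)[OF rho] M[OF rho ij] ij] by (elim exE conjE)
    have "\<forall>\<chi>\<in>R - {\<rho>}. \<forall>i' j'. ext (coeff_fun \<chi> i' j') f = 0"
      using f(4) R(2) sep[OF rho] by blast
    thus ?thesis using f(1-3) by (intro exI[of _ f] conjI)
  qed
  then obtain e where e: "\<And>\<rho> i j. \<rho> \<in> R \<Longrightarrow> i < p \<Longrightarrow> j < p \<Longrightarrow>
      Poly_Mapping.keys (e \<rho> i j) \<subseteq> carrier G \<and> push proj (e \<rho> i j) = 0 \<and>
      (\<forall>i'<p. \<forall>j'<p. ext (coeff_fun \<rho> i' j') (e \<rho> i j) = (if i' = i \<and> j' = j then M \<rho> i j else 0)) \<and>
      (\<forall>\<chi>\<in>R - {\<rho>}. \<forall>i' j'. ext (coeff_fun \<chi> i' j') (e \<rho> i j) = 0)" by metis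
  define f where "f = f0 + (\<Sum>\<rho>\<in>R. \<Sum>i<p. \<Sum>j<p. e \<rho> i j)"
  show ?thesis
  proof (intro exI[of _ f] conjI ballI allI impI)
    have "Poly_Mapping.keys (\<Sum>\<rho>\<in>R. \<Sum>i<p. \<Sum>j<p. e \<rho> i j) \<subseteq> carrier G"
      by (intro keys_sum_subset e[THEN conjunct1]) auto
    thus "Poly_Mapping.keys f \<subseteq> carrier G"
      unfolding f_def by (intro subset_trans[OF Poly_Mapping.keys_add] Un_least f0(1))
    have "push proj (e \<rho> i j) = 0" if "\<rho> \<in> R" "i < p" "j < p" for \<rho> i j
      by (rule e[OF that, THEN conjunct2, THEN conjunct1])
    thus "push proj f = q" by (simp add: f_def push_add push_sum f0(2))
  next
    fix \<rho> i j assume rho: "\<rho> \<in> R" and ij: "i < p" "j < p"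
    have rc: "\<rho> \<in> chars" "nontriv \<rho>" using R(2)[OF rho] by (auto simp: exact_chars_def)
    have "ext (coeff_fun \<rho> i j) f = (\<Sum>\<rho>'\<in>R. \<Sum>i'<p. \<Sum>j'<p. ext (coeff_fun \<rho> i j) (e \<rho>' i' j'))"
      using f0(3) rc by (simp add: f_def ext_add ext_sum)
    also have "\<dots> = (\<Sum>\<rho>'\<in>R. if \<rho>' = \<rho> then (\<Sum>i'<p. \<Sum>j'<p. if i' = i \<and> j' = j then M \<rho> i j else 0) else 0)"
    proof (intro sum.cong HOL.refl)
      fix \<rho>' assume r': "\<rho>' \<in> R"
      show "(\<Sum>i'<p. \<Sum>j'<p. ext (coeff_fun \<rho> i j) (e \<rho>' i' j')) =
          (if \<rho>' = \<rho> then (\<Sum>i'<p. \<Sum>j'<p. if i' = i \<and> j' = j then M \<rho> i j else 0) else 0)"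
      proof (cases "\<rho>' = \<rho>")
        case True
        have "ext (coeff_fun \<rho> i j) (e \<rho> i' j') = (if i' = i \<and> j' = j then M \<rho> i j else 0)"
          if "i' < p" "j' < p" for i' j' using e[OF rho that] ij by auto
        thus ?thesis using True by simp
      next
        case False
        have "ext (coeff_fun \<rho> i j) (e \<rho>' i' j') = 0" if "i' < p" "j' < p" for i' j'
          using e[OF r' that] rho False by auto
        thus ?thesis using False by simp
      qed
    qed
    also have "\<dots> = (\<Sum>i'<p. \<Sum>j'<p. if i' = i \<and> j' = j then M \<rho> i j else 0)"
      using rho R(1) by simp
    also have "\<dots> = (\<Sum>i'<p. if i' = i then M \<rho> i j else 0)"
      by (intro sum.cong HOL.refl) (use ij in auto)
    also have "\<dots> = M \<rho> i j" using ij by simp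
    finally show "ext (coeff_fun \<rho> i j) f = M \<rho> i j" .
  qed
qed

end

section \<open>The decomposition\<close>

lemma algebra_sum_cong:
  assumes "\<And>i. i \<in> I \<Longrightarrow> F i = H i"
  shows "algebra_sum I F = algebra_sum I H"
proof -
  have "(\<Pi>\<^sub>E i\<in>I. carrier (F i)) = (\<Pi>\<^sub>E i\<in>I. carrier (H i))"
    using assms by (intro PiE_cong) simp
  thus ?thesis
    using assms by (auto simp: algebra_sum_def fun_eq_iff restrict_def)
qed

lemma mult_rat_group_algebra:
  "monoid.mult (rat_group_algebra G) = conv (\<lambda>x y. x \<otimes>\<^bsub>G\<^esub> y)"
  by (simp add: rat_group_algebra_def conv_def fun_eq_iff)

lemma rat_group_algebra_simps:
  "carrier (rat_group_algebra G) = {f. Poly_Mapping.keys f \<subseteq> carrier G}"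
  "\<one>\<^bsub>rat_group_algebra G\<^esub> = Poly_Mapping.single \<one>\<^bsub>G\<^esub> 1"
  "ring.add (rat_group_algebra G) = (\<lambda>f h. f + h)"
  "module.smult (rat_group_algebra G) = (\<lambda>c f. Poly_Mapping.map (\<lambda>a. c * a) f)"
  by (simp_all add: rat_group_algebra_def)

lemma matrix_algebra_simps:
  "carrier (matrix_algebra n K) = {M \<in> carrier_mat n n. elements_mat M \<subseteq> K}"
  "monoid.mult (matrix_algebra n K) = (\<lambda>M N. M * N)"
  "\<one>\<^bsub>matrix_algebra n K\<^esub> = 1\<^sub>m n"
  "ring.add (matrix_algebra n K) = (\<lambda>M N. M + N)"
  "module.smult (matrix_algebra n K) = (\<lambda>c M. of_rat c \<cdot>\<^sub>m M)"
  by (simp_all add: matrix_algebra_def)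

lemma algebra_sum_simps:
  "carrier (algebra_sum I F) = (\<Pi>\<^sub>E i\<in>I. carrier (F i))"
  "monoid.mult (algebra_sum I F) = (\<lambda>x y. \<lambda>i\<in>I. x i \<otimes>\<^bsub>F i\<^esub> y i)"
  "\<one>\<^bsub>algebra_sum I F\<^esub> = (\<lambda>i\<in>I. \<one>\<^bsub>F i\<^esub>)"
  "ring.add (algebra_sum I F) = (\<lambda>x y. \<lambda>i\<in>I. x i \<oplus>\<^bsub>F i\<^esub> y i)"
  "module.smult (algebra_sum I F) = (\<lambda>c x. \<lambda>i\<in>I. c \<odot>\<^bsub>F i\<^esub> x i)"
  by (simp_all add: algebra_sum_def)

lemma algebra_sum2_simps:
  "carrier (B \<oplus>\<^sub>Q C) = carrier B \<times> carrier C"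
  "(x, y) \<otimes>\<^bsub>B \<oplus>\<^sub>Q C\<^esub> (x', y') = (x \<otimes>\<^bsub>B\<^esub> x', y \<otimes>\<^bsub>C\<^esub> y')"
  "\<one>\<^bsub>B \<oplus>\<^sub>Q C\<^esub> = (\<one>\<^bsub>B\<^esub>, \<one>\<^bsub>C\<^esub>)"
  "(x, y) \<oplus>\<^bsub>B \<oplus>\<^sub>Q C\<^esub> (x', y') = (x \<oplus>\<^bsub>B\<^esub> x', y \<oplus>\<^bsub>C\<^esub> y')"
  "c \<odot>\<^bsub>B \<oplus>\<^sub>Q C\<^esub> (x, y) = (c \<odot>\<^bsub>B\<^esub> x, c \<odot>\<^bsub>C\<^esub> y)"
  by (simp_all add: algebra_sum2_def)

context cyclic_extension
begin

definition rho :: "('a \<Rightarrow> complex) \<Rightarrow> ('a \<Rightarrow>\<^sub>0 rat) \<Rightarrow> complex mat" where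
  "rho \<chi> f = mat p p (\<lambda>(i, j). ext (coeff_fun \<chi> i j) f)"

lemma rho_closed:
  assumes "\<chi> \<in> exact_chars k"
  shows "rho \<chi> f \<in> carrier (matrix_algebra p (cyclotomic_field (p ^ Suc k)))"
  using ext_field[OF assms] unfolding matrix_algebra_simps rho_def
  by (auto simp: elements_mat_def simp del: power_Suc)

lemma rho_add: "rho \<chi> (f + h) = rho \<chi> f + rho \<chi> h"
  by (intro eq_matI) (auto simp: rho_def ext_add)

lemma rho_scale: "rho \<chi> (Poly_Mapping.map (\<lambda>a. c * a) f) = of_rat c \<cdot>\<^sub>m rho \<chi> f"
  by (intro eq_matI) (auto simp: rho_def ext_scale)

lemma rho_one: "\<chi> \<in> chars \<Longrightarrow> rho \<chi> (Poly_Mapping.single \<one> 1) = 1\<^sub>m p"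
  by (intro eq_matI) (auto simp: rho_def coeff_fun_one)

lemma rho_mult:
  assumes chi: "\<chi> \<in> chars" and f: "Poly_Mapping.keys f \<subseteq> carrier G" "Poly_Mapping.keys h \<subseteq> carrier G"
  shows "rho \<chi> (conv (\<lambda>x y. x \<otimes> y) f h) = rho \<chi> f * rho \<chi> h"
proof (intro eq_matI)
  fix i k assume "i < dim_row (rho \<chi> f * rho \<chi> h)" "k < dim_col (rho \<chi> f * rho \<chi> h)"
  hence ik: "i < p" "k < p" by (auto simp: rho_def)
  let ?F = "\<lambda>x. complex_of_rat (Poly_Mapping.lookup f x)" and ?H = "\<lambda>y. complex_of_rat (Poly_Mapping.lookup h y)"
  have "(rho \<chi> f * rho \<chi> h) $$ (i, k) = (\<Sum>j<p. ext (coeff_fun \<chi> i j) f * ext (coeff_fun \<chi> j k) h)"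
    using ik by (simp add: rho_def scalar_prod_def atLeast0LessThan)
  also have "\<dots> = (\<Sum>j<p. \<Sum>x\<in>Poly_Mapping.keys f. \<Sum>y\<in>Poly_Mapping.keys h.
      ?F x * ?H y * (coeff_fun \<chi> i j x * coeff_fun \<chi> j k y))"
    unfolding ext_def sum_product by (intro sum.cong HOL.refl) (simp only: mult_ac)
  also have "\<dots> = (\<Sum>x\<in>Poly_Mapping.keys f. \<Sum>y\<in>Poly_Mapping.keys h. \<Sum>j<p.
      ?F x * ?H y * (coeff_fun \<chi> i j x * coeff_fun \<chi> j k y))"
    by (subst sum.swap, rule sum.cong[OF HOL.refl], rule sum.swap)
  also have "\<dots> = (\<Sum>x\<in>Poly_Mapping.keys f. \<Sum>y\<in>Poly_Mapping.keys h.
      ?F x * ?H y * coeff_fun \<chi> i k (x \<otimes> y))"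
    unfolding sum_distrib_left[symmetric]
    using f by (intro sum.cong HOL.refl) (simp add: coeff_fun_mult[OF chi] subset_iff)
  also have "\<dots> = rho \<chi> (conv (\<lambda>x y. x \<otimes> y) f h) $$ (i, k)"
    using ik by (simp add: rho_def ext_conv)
  finally show "rho \<chi> (conv (\<lambda>x y. x \<otimes> y) f h) $$ (i, k) = (rho \<chi> f * rho \<chi> h) $$ (i, k)" by simp
qed (auto simp: rho_def)

lemma push_proj_closed: 
  assumes "Poly_Mapping.keys f \<subseteq> carrier G"
  shows "Poly_Mapping.keys (push proj f) \<subseteq> carrier (G Mod D)"
  unfolding push_def by (rule keys_sum_subset) (use assms in \<open>auto simp: carrier_FactGroup\<close>)

lemma push_proj_mult:
  assumes "Poly_Mapping.keys f \<subseteq> carrier G" "Poly_Mapping.keys h \<subseteq> carrier G"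
  shows "push proj (conv (\<lambda>x y. x \<otimes> y) f h) = conv (\<lambda>x y. x \<otimes>\<^bsub>G Mod D\<^esub> y) (push proj f) (push proj h)"
  using assms normal.rcos_sum[OF normal_D] by (intro push_conv) (auto simp: subset_iff)

lemma exponent_divisors:
  assumes "d dvd exponent Ag"
  shows "d = 1 \<or> (\<exists>k. d = p ^ Suc k)"
proof -
  obtain M where "exponent Ag = p ^ M" by (rule exponent_power)
  then obtain i where "d = p ^ i" using assms divides_primepow_nat[OF prime_p] by metis
  thus ?thesis by (cases i) auto
qed

text \<open>A generator of a cyclic subgroup of order \<open>d\<close> has order \<open>d\<close>,
  which divides the exponent. This merges the two families of components into one.\<close>

lemma num_cyclic_subgroups_quotient_0:
  assumes "\<not> d dvd exponent QA"
  shows "num_cyclic_subgroups QA d = 0"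
proof (rule ccontr)
  interpret Q: group QA by (rule group_QA)
  assume "num_cyclic_subgroups QA d \<noteq> 0"
  then obtain x where "x \<in> carrier QA" "Q.ord x = d"
    using Q.num_cyclic_subgroups_pos_imp[OF finite_QA, of d] by blast
  thus False using Q.exponent_dvd_iff(3)[OF finite_QA] assms by blast
qed

text \<open>The multiplicity for both families; in the first one the subtracted term is 0.\<close>

definition ncomp :: "nat \<Rightarrow> nat" where
  "ncomp d = (num_cyclic_subgroups Ag d - num_cyclic_subgroups QA d) div p"

text \<open>Orbit representatives reindexed by the order \<open>d\<close> in place of the exponent
  \<open>k\<close>. The divisor \<open>d = 1\<close> has no \<open>k\<close>, and
  \<open>ncomp 1 = 0\<close> keeps it empty.\<close>

lemma representatives:
  "\<exists>rep. (\<forall>d. d dvd exponent Ag \<longrightarrow>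
        p * ncomp d + num_cyclic_subgroups QA d = num_cyclic_subgroups Ag d \<and>
        (\<forall>j<ncomp d. \<exists>k. d = p ^ Suc k \<and> rep d j \<in> exact_chars k)) \<and>
     (\<forall>d d' j j'. d dvd exponent Ag \<longrightarrow> d' dvd exponent Ag \<longrightarrow> j < ncomp d \<longrightarrow> j' < ncomp d' \<longrightarrow>
        sim (rep d j) (rep d' j') \<longrightarrow> d = d' \<and> j = j') \<and>
     (\<forall>\<chi>. \<chi> \<in> chars \<longrightarrow> nontriv \<chi> \<longrightarrow>
        (\<exists>d j. d dvd exponent Ag \<and> j < ncomp d \<and> sim (rep d j) \<chi>))"
proof -
  obtain nn rp where nr: "\<And>k. p * nn k + num_cyclic_subgroups QA (p ^ Suc k) = num_cyclic_subgroups Ag (p ^ Suc k) \<and>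
     (\<forall>j<nn k. rp k j \<in> exact_chars k) \<and>
     (\<forall>i<nn k. \<forall>j<nn k. sim (rp k i) (rp k j) \<longrightarrow> i = j) \<and>
     (\<forall>\<chi>\<in>exact_chars k. \<exists>j<nn k. sim (rp k j) \<chi>)"
    using exact_chars_representatives by metis
  have nn: "ncomp (p ^ Suc k) = nn k" for k
  proof -
    have "num_cyclic_subgroups Ag (p ^ Suc k) - num_cyclic_subgroups QA (p ^ Suc k) = p * nn k"
      using nr[of k] by linarith
    thus ?thesis using p_gt_1 by (simp add: ncomp_def del: power_Suc)
  qed
  interpret Q: group QA by (rule group_QA)
  have n1: "num_cyclic_subgroups Ag 1 = 1" "num_cyclic_subgroups QA 1 = 1"
    using C.num_cyclic_subgroups_1 Q.num_cyclic_subgroups_1 by auto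
  hence ncomp1: "ncomp 1 = 0" by (simp add: ncomp_def)
  define kk where "kk d = (SOME k. d = p ^ Suc k)" for d
  have kk: "kk (p ^ Suc k) = k" for k
  proof -
    have "p ^ Suc k = p ^ Suc (kk (p ^ Suc k))" unfolding kk_def by (rule someI) (rule HOL.refl)
    thus ?thesis using p_gt_1 by (simp del: power_Suc)
  qed
  define rep where "rep d j = rp (kk d) j" for d j
  have r1: "\<exists>k. d = p ^ Suc k \<and> j < nn k \<and> rep d j = rp k j \<and> rep d j \<in> exact_chars k"
    if dj: "d dvd exponent Ag" "j < ncomp d" for d j
  proof -
    obtain k where k: "d = p ^ Suc k" using exponent_divisors[OF dj(1)] ncomp1 dj(2) by auto
    thus ?thesis using nr[of k] nn kk dj(2) by (auto simp: rep_def simp del: power_Suc)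
  qed
  show ?thesis
  proof (intro exI[of _ rep] conjI allI impI)
    fix d assume d: "d dvd exponent Ag"
    show "p * ncomp d + num_cyclic_subgroups QA d = num_cyclic_subgroups Ag d"
    proof (cases "d = 1")
      case True
      thus ?thesis using n1 ncomp1 by simp
    next
      case False
      then obtain k where "d = p ^ Suc k" using exponent_divisors[OF d] by blast
      thus ?thesis using nr[of k] nn[of k] by simp
    qed
    show "\<exists>k. d = p ^ Suc k \<and> rep d j \<in> exact_chars k" if "j < ncomp d" for j
      using r1[OF d that] by blast
  next
    fix d d' j j'
    assume dj: "d dvd exponent Ag" "d' dvd exponent Ag" "j < ncomp d" "j' < ncomp d'"
      and sim: "sim (rep d j) (rep d' j')"
    obtain k where k: "d = p ^ Suc k" "j < nn k" "rep d j = rp k j" "rep d j \<in> exact_chars k"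
      using r1[OF dj(1,3)] by blast
    obtain k' where k': "d' = p ^ Suc k'" "j' < nn k'" "rep d' j' = rp k' j'" "rep d' j' \<in> exact_chars k'"
      using r1[OF dj(2,4)] by blast
    have "k = k'" using exact_chars_unique[OF sim_exact[OF k(4) sim] k'(4)] .
    moreover have "j = j'" using nr[of k] k k' sim calculation by simp
    ultimately show "d = d'" "j = j'" using k k' by auto
  next
    fix \<chi> assume chi: "\<chi> \<in> chars" "nontriv \<chi>"
    obtain k where k: "\<chi> \<in> exact_chars k" using nontriv_exact[OF chi] .
    then obtain j where j: "j < nn k" "sim (rp k j) \<chi>" using nr[of k] by blast
    show "\<exists>d j. d dvd exponent Ag \<and> j < ncomp d \<and> sim (rep d j) \<chi>"
      using exact_chars_exponent[OF k] j nn kk by (intro exI[of _ "p ^ Suc k"] exI[of _ j]) (simp add: rep_def del: power_Suc)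
  qed
qed

text \<open>The first claim shows that the subtraction and the division in \<open>ncomp\<close> are
  exact.\<close>

theorem wedderburn:
  shows "\<And>d. d dvd exponent Ag \<Longrightarrow> p * ncomp d + num_cyclic_subgroups QA d = num_cyclic_subgroups Ag d"
    and "rat_algebra_iso (rat_group_algebra G)
      (rat_group_algebra (G Mod D)
        \<oplus>\<^sub>Q algebra_sum {d. d dvd exponent Ag \<and> \<not> d dvd exponent QA}
              (\<lambda>d. algebra_copies (ncomp d) (matrix_algebra p (cyclotomic_field d)))
        \<oplus>\<^sub>Q algebra_sum {d. d dvd exponent Ag \<and> d dvd exponent QA}
              (\<lambda>d. algebra_copies (ncomp d) (matrix_algebra p (cyclotomic_field d))))"
proof -
  obtain rep where r12: "\<forall>d. d dvd exponent Ag \<longrightarrow>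
        p * ncomp d + num_cyclic_subgroups QA d = num_cyclic_subgroups Ag d \<and>
        (\<forall>j<ncomp d. \<exists>k. d = p ^ Suc k \<and> rep d j \<in> exact_chars k)"
    and r3: "\<forall>d d' j j'. d dvd exponent Ag \<longrightarrow> d' dvd exponent Ag \<longrightarrow> j < ncomp d \<longrightarrow> j' < ncomp d' \<longrightarrow>
        sim (rep d j) (rep d' j') \<longrightarrow> d = d' \<and> j = j'"
    and r4: "\<forall>\<chi>. \<chi> \<in> chars \<longrightarrow> nontriv \<chi> \<longrightarrow>
        (\<exists>d j. d dvd exponent Ag \<and> j < ncomp d \<and> sim (rep d j) \<chi>)"
    using representatives by (elim exE conjE)
  have rep1: "p * ncomp d + num_cyclic_subgroups QA d = num_cyclic_subgroups Ag d" if "d dvd exponent Ag" for d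
    using r12 that by blast
  have rep2: "\<exists>k. d = p ^ Suc k \<and> rep d j \<in> exact_chars k" if "d dvd exponent Ag" "j < ncomp d" for d j
    using r12 that by blast
  have rep3: "d = d' \<and> j = j'" if "d dvd exponent Ag" "d' dvd exponent Ag" "j < ncomp d" "j' < ncomp d'"
    "sim (rep d j) (rep d' j')" for d d' j j'
    using r3 that by blast
  have rep4: "\<exists>d j. d dvd exponent Ag \<and> j < ncomp d \<and> sim (rep d j) \<chi>" if "\<chi> \<in> chars" "nontriv \<chi>" for \<chi>
    using r4 that by blast
  show "p * ncomp d + num_cyclic_subgroups QA d = num_cyclic_subgroups Ag d" if "d dvd exponent Ag" for d
    using rep1[OF that] .
  define D1 where "D1 = {d. d dvd exponent Ag \<and> \<not> d dvd exponent QA}"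
  define D2 where "D2 = {d. d dvd exponent Ag \<and> d dvd exponent QA}"
  let ?M = "\<lambda>d. matrix_algebra p (cyclotomic_field d)"
  let ?S = "\<lambda>I. algebra_sum I (\<lambda>d. algebra_copies (ncomp d) (?M d))"
  let ?B = "rat_group_algebra (G Mod D) \<oplus>\<^sub>Q ?S D1 \<oplus>\<^sub>Q ?S D2"
  have Ddvd: "d dvd exponent Ag" if "d \<in> D1 \<or> d \<in> D2" for d using that by (auto simp: D1_def D2_def)
  define part where "part I f = (\<lambda>d\<in>I. \<lambda>j\<in>{..<ncomp d}. rho (rep d j) f)" for I f
  define h where "h f = (push proj f, part D1 f, part D2 f)" for f
  have rep_chars: "rep d j \<in> chars" if "d dvd exponent Ag" "j < ncomp d" for d j
    using rep2[OF that] by (auto simp: exact_chars_def)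
  have rho_in: "rho (rep d j) f \<in> carrier (?M d)" if "d dvd exponent Ag" "j < ncomp d" for d j f
    using rep2[OF that] rho_closed by blast
  have part_closed: "part I f \<in> carrier (?S I)" if "\<And>d. d \<in> I \<Longrightarrow> d dvd exponent Ag" for I f
    using that rho_in by (auto simp: part_def algebra_sum_simps)
  have part_mult: "part I (conv (\<lambda>x y. x \<otimes> y) f f') = part I f \<otimes>\<^bsub>?S I\<^esub> part I f'"
    if "\<And>d. d \<in> I \<Longrightarrow> d dvd exponent Ag" "Poly_Mapping.keys f \<subseteq> carrier G" "Poly_Mapping.keys f' \<subseteq> carrier G" for I f f'
    using that rep_chars
    by (auto simp: part_def algebra_sum_simps matrix_algebra_simps rho_mult restrict_def fun_eq_iff)
  have part_add: "part I (f + f') = part I f \<oplus>\<^bsub>?S I\<^esub> part I f'" for I f f'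
    by (auto simp: part_def algebra_sum_simps matrix_algebra_simps rho_add restrict_def fun_eq_iff)
  have part_scale: "part I (Poly_Mapping.map (\<lambda>a. c * a) f) = c \<odot>\<^bsub>?S I\<^esub> part I f" for I c f
    by (auto simp: part_def algebra_sum_simps matrix_algebra_simps rho_scale restrict_def fun_eq_iff)
  have part_one: "part I (Poly_Mapping.single \<one> 1) = \<one>\<^bsub>?S I\<^esub>"
    if "\<And>d. d \<in> I \<Longrightarrow> d dvd exponent Ag" for I
    using that rep_chars
    by (auto simp: part_def algebra_sum_simps matrix_algebra_simps rho_one restrict_def fun_eq_iff)
  have D12: "\<And>d. d \<in> D1 \<Longrightarrow> d dvd exponent Ag" "\<And>d. d \<in> D2 \<Longrightarrow> d dvd exponent Ag" using Ddvd by auto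
  have hom: "h \<in> Ring.ring_hom (rat_group_algebra G) ?B"
  proof (rule ring_hom_memI)
    fix f assume "f \<in> carrier (rat_group_algebra G)"
    thus "h f \<in> carrier ?B"
      using push_proj_closed part_closed[OF D12(1)] part_closed[OF D12(2)]
      by (simp add: h_def algebra_sum2_simps rat_group_algebra_simps)
  next
    fix f f' assume "f \<in> carrier (rat_group_algebra G)" "f' \<in> carrier (rat_group_algebra G)"
    hence f: "Poly_Mapping.keys f \<subseteq> carrier G" "Poly_Mapping.keys f' \<subseteq> carrier G"
      by (auto simp: rat_group_algebra_simps)
    have "part D1 (conv (\<lambda>x y. x \<otimes> y) f f') = part D1 f \<otimes>\<^bsub>?S D1\<^esub> part D1 f'"
      "part D2 (conv (\<lambda>x y. x \<otimes> y) f f') = part D2 f \<otimes>\<^bsub>?S D2\<^esub> part D2 f'"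
      by (rule part_mult, erule D12, rule f, rule f)+
    thus "h (f \<otimes>\<^bsub>rat_group_algebra G\<^esub> f') = h f \<otimes>\<^bsub>?B\<^esub> h f'"
      unfolding h_def algebra_sum2_simps mult_rat_group_algebra push_proj_mult[OF f] by (simp only:)
    show "h (f \<oplus>\<^bsub>rat_group_algebra G\<^esub> f') = h f \<oplus>\<^bsub>?B\<^esub> h f'"
      unfolding h_def algebra_sum2_simps rat_group_algebra_simps push_add part_add by (rule HOL.refl)
  next
    have "D #> \<one> = \<one>\<^bsub>G Mod D\<^esub>"
      using coset_mult_one[of D] subgroup.subset[OF subgroup_D] by simp
    moreover have "part D1 (Poly_Mapping.single \<one> 1) = \<one>\<^bsub>?S D1\<^esub>"
      "part D2 (Poly_Mapping.single \<one> 1) = \<one>\<^bsub>?S D2\<^esub>"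
      by (rule part_one, erule D12)+
    ultimately show "h \<one>\<^bsub>rat_group_algebra G\<^esub> = \<one>\<^bsub>?B\<^esub>"
      unfolding h_def algebra_sum2_simps rat_group_algebra_simps push_single by (simp only:)
  qed
  have smult: "h (c \<odot>\<^bsub>rat_group_algebra G\<^esub> f) = c \<odot>\<^bsub>?B\<^esub> h f" for c f
    unfolding h_def algebra_sum2_simps rat_group_algebra_simps push_scale part_scale by (rule HOL.refl)
  define J where "J = {(d, j). d dvd exponent Ag \<and> j < ncomp d}"
  define R where "R = (\<lambda>(d, j). rep d j) ` J"
  have part_eq: "rho (rep d j) f = rho (rep d j) f'"
    if eq: "part D1 f = part D1 f'" "part D2 f = part D2 f'" and dj: "(d, j) \<in> J" for d j f f'
  proof (cases "d \<in> D1")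
    case True
    thus ?thesis using fun_cong[OF fun_cong[OF eq(1), of d], of j] dj by (simp add: part_def J_def)
  next
    case False
    hence "d \<in> D2" using dj by (auto simp: J_def D1_def D2_def)
    thus ?thesis using fun_cong[OF fun_cong[OF eq(2), of d], of j] dj by (simp add: part_def J_def)
  qed
  have inj: "inj_on h (carrier (rat_group_algebra G))"
  proof (rule inj_onI)
    fix f f' assume ff: "f \<in> carrier (rat_group_algebra G)" "f' \<in> carrier (rat_group_algebra G)" "h f = h f'"
    have neg: "Poly_Mapping.keys (f - f') \<subseteq> carrier G"
      using ff(1,2) by (auto simp: rat_group_algebra_simps in_keys_iff lookup_minus subset_iff) (metis in_keys_iff)+
    have sub: "(f - f') + f' = f" by simp
    have "f - f' = 0"
    proof (rule algebra_map_injective[OF neg, of R])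
      have "push proj (f - f') + push proj f' = push proj f" by (subst push_add[symmetric]) simp
      thus "push proj (f - f') = 0" using ff(3) by (simp add: h_def)
    next
      fix \<chi> i j assume chi: "\<chi> \<in> R" and ij: "i < p" "j < p"
      then obtain d l where dl: "(d, l) \<in> J" "\<chi> = rep d l" by (auto simp: R_def)
      have "rho \<chi> f = rho \<chi> f'" unfolding dl(2) using part_eq[OF _ _ dl(1), of f f'] ff(3) by (simp add: h_def)
      hence "rho \<chi> f $$ (i, j) = rho \<chi> f' $$ (i, j)" by simp
      hence "ext (coeff_fun \<chi> i j) f = ext (coeff_fun \<chi> i j) f'" using ij by (simp add: rho_def)
      moreover have "ext (coeff_fun \<chi> i j) (f - f') + ext (coeff_fun \<chi> i j) f' = ext (coeff_fun \<chi> i j) f"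
        by (subst ext_add[symmetric]) simp
      ultimately show "ext (coeff_fun \<chi> i j) (f - f') = 0" by simp
    next
      fix \<chi> assume chi: "\<chi> \<in> chars" "nontriv \<chi>"
      obtain d j where dj: "d dvd exponent Ag" "j < ncomp d" "sim (rep d j) \<chi>" using rep4[OF chi] by blast
      hence "rep d j \<in> R" by (auto simp: R_def J_def)
      thus "\<exists>\<rho>\<in>R. \<exists>k. \<rho> \<in> exact_chars k \<and> sim \<rho> \<chi>" using dj rep2[OF dj(1,2)] by blast
    qed
    thus "f = f'" by simp
  qed
  have surj: "carrier ?B \<subseteq> h ` carrier (rat_group_algebra G)"
  proof
    fix t assume "t \<in> carrier ?B"
    then obtain q t1 t2 where t: "t = (q, t1, t2)" "Poly_Mapping.keys q \<subseteq> carrier (G Mod D)"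
      "t1 \<in> carrier (?S D1)" "t2 \<in> carrier (?S D2)"
      by (auto simp: algebra_sum2_simps rat_group_algebra_simps)
    \<comment> \<open>\<open>D1\<close> and \<open>D2\<close> are disjoint, so the two target tuples
      combine into one family of matrices.\<close>
    define T where "T d j = (if d \<in> D1 then t1 d j else t2 d j)" for d j
    have T: "T d j \<in> carrier (?M d)" if "(d, j) \<in> J" for d j
      using that t(3,4) by (auto simp: T_def J_def algebra_sum_simps D1_def D2_def PiE_iff)
    \<comment> \<open>Recovers the position of a component from its character, which is possible
      because distinct positions carry inequivalent characters.\<close>
    define idx where "idx \<rho> = (SOME dj. dj \<in> J \<and> (case dj of (d, j) \<Rightarrow> rep d j = \<rho>))" for \<rho>
    have idx: "idx (rep d j) = (d, j)" if dj: "(d, j) \<in> J" for d j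
    proof -
      obtain d' j' where d'j': "idx (rep d j) = (d', j')" by (cases "idx (rep d j)")
      have "idx (rep d j) \<in> J \<and> (case idx (rep d j) of (d', j') \<Rightarrow> rep d' j' = rep d j)"
        unfolding idx_def
        by (rule someI[where P = "\<lambda>x. x \<in> J \<and> (case x of (d', j') \<Rightarrow> rep d' j' = rep d j)" and x = "(d, j)"])
          (use dj in simp)
      hence *: "(d', j') \<in> J" "rep d' j' = rep d j" using d'j' by auto
      obtain k where "rep d j \<in> exact_chars k" using rep2 dj by (auto simp: J_def)
      hence "sim (rep d j) (rep d' j')" using sim_refl *(2) by simp
      thus ?thesis using rep3[of d d' j j'] dj * d'j' by (auto simp: J_def)
    qed
    define \<kappa> where "\<kappa> \<rho> = (SOME k. fst (idx \<rho>) = p ^ Suc k \<and> \<rho> \<in> exact_chars k)" for \<rho>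
    have kap: "d = p ^ Suc (\<kappa> (rep d j)) \<and> rep d j \<in> exact_chars (\<kappa> (rep d j))" if dj: "(d, j) \<in> J" for d j
    proof -
      obtain k where "d = p ^ Suc k \<and> rep d j \<in> exact_chars k" using rep2 dj by (auto simp: J_def)
      thus ?thesis unfolding \<kappa>_def idx[OF dj] fst_conv
        by (rule someI[where P = "\<lambda>k. d = p ^ Suc k \<and> rep d j \<in> exact_chars k"])
    qed
    have finJ: "finite J"
    proof -
      have "J \<subseteq> (SIGMA d:{d. d dvd exponent Ag}. {..<ncomp d})" by (auto simp: J_def)
      moreover have "finite {d. d dvd exponent Ag}"
        using C.exponent_dvd_iff(2)[OF C.finite_carrier] by simp
      ultimately show ?thesis by (meson finite_SigmaI finite_lessThan finite_subset)
    qed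
    have "\<exists>f. Poly_Mapping.keys f \<subseteq> carrier G \<and> push proj f = q \<and>
      (\<forall>\<rho>\<in>R. \<forall>i<p. \<forall>j<p. ext (coeff_fun \<rho> i j) f = (case idx \<rho> of (d, l) \<Rightarrow> T d l $$ (i, j)))"
    proof (rule algebra_map_surjective[OF t(2), where \<kappa> = \<kappa>])
      show "finite R" using finJ by (simp add: R_def)
      show "\<rho> \<in> exact_chars (\<kappa> \<rho>)" if "\<rho> \<in> R" for \<rho>
        using that kap by (auto simp: R_def)
      show "\<rho> = \<rho>'" if r: "\<rho> \<in> R" "\<rho>' \<in> R" "sim \<rho> \<rho>'" for \<rho> \<rho>'
      proof -
        obtain d j where dj: "(d, j) \<in> J" "\<rho> = rep d j" using r(1) by (auto simp: R_def)
        obtain d' j' where d'j': "(d', j') \<in> J" "\<rho>' = rep d' j'" using r(2) by (auto simp: R_def)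
        have "d = d' \<and> j = j'" using rep3[of d d' j j'] dj d'j' r(3) by (simp add: J_def)
        thus ?thesis using dj d'j' by simp
      qed
      fix \<rho> i j assume r: "\<rho> \<in> R" and ij: "i < p" "j < p"
      obtain d l where dl: "(d, l) \<in> J" "\<rho> = rep d l" using r by (auto simp: R_def)
      have "T d l $$ (i, j) \<in> elements_mat (T d l)"
        using T[OF dl(1)] ij by (intro elements_matI[of _ p p i j]) (auto simp: matrix_algebra_simps)
      hence "T d l $$ (i, j) \<in> cyclotomic_field d" using T[OF dl(1)] by (auto simp: matrix_algebra_simps)
      moreover have "d = p ^ Suc (\<kappa> \<rho>)" using kap[OF dl(1)] dl(2) by blast
      ultimately show "(case idx \<rho> of (d, l) \<Rightarrow> T d l $$ (i, j)) \<in> cyclotomic_field (p ^ Suc (\<kappa> \<rho>))"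
        unfolding dl(2) idx[OF dl(1)] prod.case by (simp only: dl(2))
    qed
    then obtain f where f: "Poly_Mapping.keys f \<subseteq> carrier G" "push proj f = q"
      "\<forall>\<rho>\<in>R. \<forall>i<p. \<forall>j<p. ext (coeff_fun \<rho> i j) f = (case idx \<rho> of (d, l) \<Rightarrow> T d l $$ (i, j))" by blast
    have rhoT: "rho (rep d l) f = T d l" if dl: "(d, l) \<in> J" for d l
    proof (rule eq_matI)
      have Tc: "T d l \<in> carrier_mat p p" using T[OF dl] by (simp add: matrix_algebra_simps)
      show "dim_row (rho (rep d l) f) = dim_row (T d l)" "dim_col (rho (rep d l) f) = dim_col (T d l)"
        using Tc by (auto simp: rho_def)
      fix i j assume "i < dim_row (T d l)" "j < dim_col (T d l)"
      hence ij: "i < p" "j < p" using Tc by auto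
      have "rep d l \<in> R" using dl by (auto simp: R_def)
      hence "ext (coeff_fun (rep d l) i j) f = T d l $$ (i, j)" using f(3) ij idx[OF dl] by auto
      thus "rho (rep d l) f $$ (i, j) = T d l $$ (i, j)" using ij by (simp add: rho_def)
    qed
    have part_T: "part I f = t'"
      if I: "\<And>d. d \<in> I \<Longrightarrow> d dvd exponent Ag" and t': "t' \<in> carrier (?S I)"
        and TI: "\<And>d j. d \<in> I \<Longrightarrow> T d j = t' d j" for I t'
    proof (rule PiE_ext[of _ I "\<lambda>d. carrier (algebra_copies (ncomp d) (?M d))"])
      show "part I f \<in> (\<Pi>\<^sub>E d\<in>I. carrier (algebra_copies (ncomp d) (?M d)))"
        using part_closed[OF I] by (simp add: algebra_sum_simps)
      show t'': "t' \<in> (\<Pi>\<^sub>E d\<in>I. carrier (algebra_copies (ncomp d) (?M d)))"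
        using t' by (simp add: algebra_sum_simps)
      fix d assume d: "d \<in> I"
      have td: "t' d \<in> (\<Pi>\<^sub>E j\<in>{..<ncomp d}. carrier (?M d))"
        using PiE_mem[OF t'' d] by (simp add: algebra_sum_simps)
      show "part I f d = t' d"
      proof
        fix j
        show "part I f d j = t' d j"
        proof (cases "j < ncomp d")
          case True
          hence "(d, j) \<in> J" using I[OF d] by (simp add: J_def)
          thus ?thesis using rhoT TI[OF d] d True by (simp add: part_def)
        next
          case False
          thus ?thesis using PiE_arb[OF td, of j] d by (simp add: part_def)
        qed
      qed
    qed
    have "h f = t"
      unfolding h_def t(1) f(2)
      using part_T[OF D12(1) t(3)] part_T[OF D12(2) t(4)] by (auto simp: T_def D1_def D2_def)
    thus "t \<in> h ` carrier (rat_group_algebra G)" using f(1) by (auto simp: rat_group_algebra_simps)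
  qed
  have "bij_betw h (carrier (rat_group_algebra G)) (carrier ?B)"
    unfolding bij_betw_def using inj surj ring_hom_closed[OF hom] by blast
  hence "h \<in> ring_iso (rat_group_algebra G) ?B" using hom by (simp add: ring_iso_def)
  thus "rat_algebra_iso (rat_group_algebra G)
      (rat_group_algebra (G Mod D)
        \<oplus>\<^sub>Q algebra_sum {d. d dvd exponent Ag \<and> \<not> d dvd exponent QA}
              (\<lambda>d. algebra_copies (ncomp d) (matrix_algebra p (cyclotomic_field d)))
        \<oplus>\<^sub>Q algebra_sum {d. d dvd exponent Ag \<and> d dvd exponent QA}
              (\<lambda>d. algebra_copies (ncomp d) (matrix_algebra p (cyclotomic_field d))))"
    unfolding rat_algebra_iso_def D1_def D2_def using smult[unfolded D1_def D2_def] by blast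
qed

end

theorem theorem36:
  fixes p :: nat and G C :: "('a, 'b) monoid_scheme" and Q :: "'a set monoid"
    and m m' :: nat and a a' :: "nat \<Rightarrow> nat"
  assumes "Factorial_Ring.prime p" and "odd p"
    and "group G" and "Coset.order G = p ^ 5" and "isoclinic G (phi9_group p)"
    and "C = G\<lparr>carrier := centralizer G (commutator_subgroup G)\<rparr>"
    and "Q = C Mod commutator_subgroup G"
    and "m = exponent C" and "m' = exponent Q"
    and "a = num_cyclic_subgroups C" and "a' = num_cyclic_subgroups Q"
  shows "(\<forall>d. d dvd m \<and> \<not> d dvd m' \<longrightarrow> p dvd a d) \<and>
    (\<forall>d. d dvd m \<and> d dvd m' \<longrightarrow> a' d \<le> a d \<and> p dvd a d - a' d) \<and>
    rat_algebra_iso (rat_group_algebra G)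
      (rat_group_algebra (G Mod commutator_subgroup G)
        \<oplus>\<^sub>Q algebra_sum {d. d dvd m \<and> \<not> d dvd m'}
              (\<lambda>d. algebra_copies (a d div p) (matrix_algebra p (cyclotomic_field d)))
        \<oplus>\<^sub>Q algebra_sum {d. d dvd m \<and> d dvd m'}
              (\<lambda>d. algebra_copies ((a d - a' d) div p) (matrix_algebra p (cyclotomic_field d))))"
proof -
  interpret G: group G by fact
  have "group (phi9_group p)" unfolding phi9_group_def by (rule group_presented_group)
  then obtain g a1 a2 a3 a4 where frame: "phi9_frame G p g a1 a2 a3 a4"
    using phi9_group_frame[OF assms(1,2)] phi9_frame_isoclinic[OF assms(3) _ assms(5)] by metis
  interpret cyclic_extension G p "centralizer G (commutator_subgroup G)" g
    by (rule G.phi9_frame_cyclic_extension[OF assms(1,4) frame])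
  note defs = assms(6-11)
  have count: "p * ncomp d + a' d = a d" if "d dvd m" for d
    using wedderburn(1)[of d] that by (simp add: defs)
  \<comment> \<open>By this the multiplicities of the first sum, which mention only
    \<open>a d\<close>, agree with \<open>ncomp d\<close>.\<close>
  have zero: "a' d = 0" if "\<not> d dvd m'" for d
    using num_cyclic_subgroups_quotient_0[of d] that by (simp add: defs)
  have nc: "ncomp d = (a d - a' d) div p" for d by (simp add: ncomp_def defs)
  have "algebra_sum {d. d dvd m \<and> \<not> d dvd m'}
        (\<lambda>d. algebra_copies (a d div p) (matrix_algebra p (cyclotomic_field d))) =
      algebra_sum {d. d dvd m \<and> \<not> d dvd m'}
        (\<lambda>d. algebra_copies (ncomp d) (matrix_algebra p (cyclotomic_field d)))"
    by (rule algebra_sum_cong) (simp add: nc zero)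
  moreover have "(\<lambda>d. algebra_copies ((a d - a' d) div p) (matrix_algebra p (cyclotomic_field d))) =
      (\<lambda>d. algebra_copies (ncomp d) (matrix_algebra p (cyclotomic_field d)))"
    by (simp add: nc)
  moreover note wedderburn(2)
  moreover have "p dvd a d" if "d dvd m" "\<not> d dvd m'" for d
    using count[OF that(1)] zero[OF that(2)] by (metis add.right_neutral dvd_triv_left)
  moreover have "a' d \<le> a d \<and> p dvd a d - a' d" if "d dvd m" for d
    using count[OF that] by (metis add_diff_cancel_right' dvd_triv_left le_add2)
  ultimately show ?thesis by (simp add: defs)
qed

end
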